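(* Let $A \subset \mathbb{R}^d$ be a polytope (not necessarily convex or connected). If $A$ is spectral, then $H_\Phi(A) = 0$ for every $r$-flag $\Phi$ in $\mathbb{R}^d$ and every integer $r$ with $1 \leq r \leq d-1$, where $H_\Phi$ is the Hadwiger functional associated to $\Phi$.
   Context: Spectral sets. A bounded, measurable set $A \subset \mathbb{R}^d$ of positive Lebesgue measure is called spectral if there exists a countable set $\Lambda \subset \mathbb{R}^d$ such that the system of exponential functions $\{e_\lambda\}_{\lambda \in \Lambda}$, $e_\lambda(x) = e^{2\pi i \langle \lambda, x\rangle}$, is orthogonal and complete in $L^2(A)$. Polytopes and faces. A simplex in $\mathbb{R}^d$ is the convex hull of $d+1$ points which do not all lie in some hyperplane. A polytope in $\mathbb{R}^d$ is a set which can be represented as the union of a finite number of simplices with disjoint interiors (not necessarily convex or connected). The same notions are used inside any $j$-dimensional affine subspace, giving $j$-dimensional polytopes (a $0$-dimensional polytope is a single point). If $F$ is a $j$-dimensional polytope in a $j$-dimensional affine subspace $U$, a facet ($(j-1)$-dimensional subface) of $F$ is a nonempty set obtained as follows: choose an affine hyperplane $H$ of $U$ and one of the two closed half-spaces of $U$ bounded by $H$, and take the closure of the set of points $x \in H$ such that $F$ coincides with this closed half-space in some neighborhood of $x$ in $U$; we then say that $F$ adjoins this facet from the side of that half-space. An $r$-sequence of faces of $A$ is a sequence $F_r \subset F_{r+1} \subset \cdots \subset F_{d-1} \subset F_d = A$ in which $F_j$ is a facet of $F_{j+1}$ for $r \leq j \leq d-1$; thus $F_j$ is a $j$-dimensional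 face of $A$. Flags. For $0 \leq r \leq d-1$, an $r$-flag $\Phi$ in $\mathbb{R}^d$ is a sequence of linear subspaces $V_r \subset V_{r+1} \subset \cdots \subset V_{d-1} \subset V_d = \mathbb{R}^d$ with $\dim V_j = j$, together with, for each $r \leq j \leq d-1$, a choice of one of the two half-spaces into which $V_j$ divides $V_{j+1}$ being called positive and the other negative. Hadwiger functionals. An $r$-sequence of faces is parallel to $\Phi$ if the affine hull of $F_j$ is a translate of $V_j$ for each $r \leq j \leq d-1$. To such a sequence associate coefficients $\varepsilon_j$ ($r \leq j \leq d-1$): $\varepsilon_j = +1$ if $F_{j+1}$ adjoins $F_j$ from the same side where the positive half-space of $V_{j+1}$ adjoins $V_j$, and $\varepsilon_j = -1$ if $F_{j+1}$ adjoins $F_j$ from the opposite side. For $1 \leq r \leq d-1$ define $$H_\Phi(A) = \sum \varepsilon_r \varepsilon_{r+1} \cdots \varepsilon_{d-1} \operatorname{Vol}_r(F_r),$$ where the sum is over all $r$-sequences of faces of $A$ parallel to $\Phi$ and $\operatorname{Vol}_r$ is $r$-dimensional volume; if there are no such sequences, $H_\Phi(A) = 0$. *)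

theory Defs
  imports "HOL-Analysis.Analysis"
begin

section \<open>Spectral sets\<close>

definition expo :: "'a::euclidean_space \<Rightarrow> 'a \<Rightarrow> complex" where
  "expo l x = exp (2 * of_real pi * \<i> * of_real (l \<bullet> x))"

definition square_integrable_on :: "('a::euclidean_space \<Rightarrow> complex) \<Rightarrow> 'a set \<Rightarrow> bool" where
  "square_integrable_on f A \<longleftrightarrow>
     f \<in> borel_measurable (lebesgue_on A) \<and> integrable (lebesgue_on A) (\<lambda>x. (norm (f x))\<^sup>2)"

definition L2_inner :: "'a::euclidean_space set \<Rightarrow> ('a \<Rightarrow> complex) \<Rightarrow> ('a \<Rightarrow> complex) \<Rightarrow> complex" where
  "L2_inner A f g = integral\<^sup>L (lebesgue_on A) (\<lambda>x. f x * cnj (g x))"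

definition L2_norm :: "'a::euclidean_space set \<Rightarrow> ('a \<Rightarrow> complex) \<Rightarrow> real" where
  "L2_norm A f = sqrt (integral\<^sup>L (lebesgue_on A) (\<lambda>x. (norm (f x))\<^sup>2))"

definition orthogonal_exponentials :: "'a::euclidean_space set \<Rightarrow> 'a set \<Rightarrow> bool" where
  "orthogonal_exponentials A \<Lambda> \<longleftrightarrow>
     (\<forall>l\<in>\<Lambda>. \<forall>m\<in>\<Lambda>. l \<noteq> m \<longrightarrow> L2_inner A (expo l) (expo m) = 0)"

text \<open>Completeness: the linear span of the system is dense in L2 of A.\<close>

definition complete_exponentials :: "'a::euclidean_space set \<Rightarrow> 'a set \<Rightarrow> bool" where
  "complete_exponentials A \<Lambda> \<longleftrightarrow>
     (\<forall>f. square_integrable_on f A \<longrightarrow>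
       (\<forall>\<epsilon>>0. \<exists>T c. finite T \<and> T \<subseteq> \<Lambda> \<and> L2_norm A (\<lambda>x. f x - (\<Sum>l\<in>T. c l * expo l x)) < \<epsilon>))"

definition spectral_set :: "'a::euclidean_space set \<Rightarrow> bool" where
  "spectral_set A \<longleftrightarrow>
     bounded A \<and> A \<in> sets lebesgue \<and> measure lebesgue A > 0 \<and>
     (\<exists>\<Lambda>. countable \<Lambda> \<and> orthogonal_exponentials A \<Lambda> \<and> complete_exponentials A \<Lambda>)"

section \<open>Polytopes and their faces\<close>

text \<open>A full-dimensional polytope inside the affine subspace \<open>U\<close>, not necessarily convex or
  connected (unlike the library's \<^const>\<open>polytope\<close>). A polytope in the whole space is
  the case \<open>U = UNIV\<close>.\<close>

definition polytope_in :: "'a::euclidean_space set \<Rightarrow> 'a set \<Rightarrow> bool" where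
  "polytope_in U F \<longleftrightarrow>
     affine U \<and> U \<noteq> {} \<and>
     (\<exists>\<T>. finite \<T> \<and> \<T> \<noteq> {} \<and>
        (\<forall>S\<in>\<T>. aff_dim U simplex S \<and> S \<subseteq> U) \<and>
        pairwise (\<lambda>S T. (top_of_set U interior_of S) \<inter> (top_of_set U interior_of T) = {}) \<T> \<and>
        F = \<Union>\<T>)"

text \<open>\<open>K\<close> is one of the two closed half-spaces of \<open>U\<close> bounded by the affine
  hyperplane \<open>H\<close> of \<open>U\<close>. The other one is obtained from \<open>-a\<close> and
  \<open>-b\<close>.\<close>

definition halfspace_in :: "'a::euclidean_space set \<Rightarrow> 'a set \<Rightarrow> 'a set \<Rightarrow> bool" where
  "halfspace_in U H K \<longleftrightarrow>
     affine H \<and> H \<subseteq> U \<and> aff_dim U = aff_dim H + 1 \<and>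
     (\<exists>a b. H = {x \<in> U. a \<bullet> x = b} \<and> K = {x \<in> U. a \<bullet> x \<ge> b})"

text \<open>\<open>G\<close> is a facet of \<open>F\<close>, and \<open>F\<close> adjoins it from the side of the
  half-space \<open>K\<close>. The ambient affine subspace of a (nonempty) polytope \<open>F\<close> is its
  affine hull. The facet determines \<open>K\<close> uniquely.\<close>

definition adjoins_from :: "'a::euclidean_space set \<Rightarrow> 'a set \<Rightarrow> 'a set \<Rightarrow> bool" where
  "adjoins_from F G K \<longleftrightarrow>
     (let U = affine hull F in
      polytope_in U F \<and> G \<noteq> {} \<and>
      (\<exists>H. halfspace_in U H K \<and>
           G = closure {x \<in> H. \<exists>N. openin (top_of_set U) N \<and> x \<in> N \<and> F \<inter> N = K \<inter> N}))"

definition poly_facet :: "'a::euclidean_space set \<Rightarrow> 'a set \<Rightarrow> bool" where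
  "poly_facet F G \<longleftrightarrow> (\<exists>K. adjoins_from F G K)"

text \<open>Sequences indexed by \<open>{r..d}\<close> are functions that are \<^const>\<open>undefined\<close> outside
  this range, so that each sequence of faces is represented exactly once.\<close>

definition face_sequences :: "nat \<Rightarrow> 'a::euclidean_space set \<Rightarrow> (nat \<Rightarrow> 'a set) set" where
  "face_sequences r A =
     {F \<in> extensional {r..DIM('a)}. F DIM('a) = A \<and> (\<forall>j\<in>{r..<DIM('a)}. poly_facet (F (Suc j)) (F j))}"

section \<open>Flags\<close>

text \<open>A flag is given by the subspaces \<open>V j\<close> for \<open>r \<le> j \<le> d\<close> and, for \<open>r \<le> j < d\<close>, the
  (closed) half-space \<open>P j\<close> of \<open>V (j + 1)\<close> bounded by \<open>V j\<close> that is called positive.\<close>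

definition is_flag :: "nat \<Rightarrow> (nat \<Rightarrow> 'a::euclidean_space set) \<Rightarrow> (nat \<Rightarrow> 'a set) \<Rightarrow> bool" where
  "is_flag r V P \<longleftrightarrow>
     (\<forall>j\<in>{r..DIM('a)}. subspace (V j) \<and> dim (V j) = j) \<and> V DIM('a) = UNIV \<and>
     (\<forall>j\<in>{r..<DIM('a)}. V j \<subseteq> V (Suc j) \<and> halfspace_in (V (Suc j)) (V j) (P j))"

section \<open>Hadwiger functionals\<close>

text \<open>Lebesgue (Borel) measure of dimension \<open>aff_dim U\<close> on the affine subspace \<open>U\<close>, transported
  along orthonormal coordinates just as \<^const>\<open>lborel\<close> is along \<^const>\<open>Basis\<close>. It does
  not depend on the choice of the origin \<open>p\<close> and the orthonormal basis \<open>B\<close>.\<close>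

definition orthonormal_frame :: "'a::euclidean_space set \<Rightarrow> 'a \<Rightarrow> 'a set \<Rightarrow> bool" where
  "orthonormal_frame U p B \<longleftrightarrow>
     p \<in> U \<and> pairwise orthogonal B \<and> (\<forall>b\<in>B. norm b = 1) \<and> span B = (\<lambda>x. x - p) ` U"

definition flat_lborel :: "'a::euclidean_space set \<Rightarrow> 'a measure" where
  "flat_lborel U =
     (let (p, B) = (SOME (p, B). orthonormal_frame U p B)
      in distr (\<Pi>\<^sub>M b\<in>B. lborel) borel (\<lambda>c. p + (\<Sum>b\<in>B. c b *\<^sub>R b)))"

definition flat_vol :: "'a::euclidean_space set \<Rightarrow> real" where
  "flat_vol F = measure (flat_lborel (affine hull F)) F"

definition parallel_to :: "nat \<Rightarrow> (nat \<Rightarrow> 'a::euclidean_space set) \<Rightarrow> (nat \<Rightarrow> 'a set) \<Rightarrow> bool" where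
  "parallel_to r V F \<longleftrightarrow> (\<forall>j\<in>{r..<DIM('a)}. \<exists>v. affine hull (F j) = (+) v ` V j)"

text \<open>\<open>P\<close> is the positive half-space. As the half-space from which \<open>F\<close> adjoins \<open>G\<close> is unique,
  the value \<open>-1\<close> for a facet parallel to the flag means that \<open>F\<close> adjoins from the
  opposite side.\<close>

definition side_sign :: "'a::euclidean_space set \<Rightarrow> 'a set \<Rightarrow> 'a set \<Rightarrow> real" where
  "side_sign P F G = (if \<exists>K v. adjoins_from F G K \<and> K = (+) v ` P then 1 else -1)"

text \<open>A polytope has only finitely many sequences of faces, so the sum is a genuine finite sum.\<close>

definition hadwiger ::
    "nat \<Rightarrow> (nat \<Rightarrow> 'a::euclidean_space set) \<Rightarrow> (nat \<Rightarrow> 'a set) \<Rightarrow> 'a set \<Rightarrow> real" where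
  "hadwiger r V P A =
     (\<Sum>F\<in>{F \<in> face_sequences r A. parallel_to r V F}.
        (\<Prod>j=r..<DIM('a). side_sign (P j) (F (Suc j)) (F j)) * flat_vol (F r))"

end

theory Submission
  imports Defs
begin

text \<open>
  Let \<open>\<Lambda>\<close> be a spectrum of \<open>A\<close>. For distinct \<open>\<lambda>, \<lambda>'\<close> in \<open>\<Lambda>\<close>, orthogonality says that the Fourier
  integral of the indicator function of \<open>A\<close> vanishes at \<open>\<lambda> - \<lambda>'\<close>. The Hadwiger functional of a flag
  is the leading coefficient of this Fourier integral along the flag, so it vanishes as soon as enough
  differences \<open>\<lambda> - \<lambda>'\<close> escape to infinity along the flag.

  To make this precise, describe the flag by orthonormal vectors: \<open>v k\<close> is the unit normal of \<open>V k\<close>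
  in \<open>V (k + 1)\<close> that points into the positive half-space. Write a frequency as
  \<open>\<xi> = w + (\<Sum>k. t k *\<^sub>R v k)\<close> with \<open>w\<close> in \<open>V r\<close>. Let \<open>w\<close> tend to zero, let each coefficient \<open>t k\<close> tend
  to infinity faster than the product of the preceding ones, and let the phases of \<open>\<xi>\<close> tend to one at
  finitely many points that locate the \<open>r\<close>-dimensional faces. Then the Fourier integral of \<open>A\<close> at \<open>\<xi>\<close>,
  multiplied by all the factors \<open>- 2 pi i t k\<close>, tends to the Hadwiger functional of \<open>A\<close>
  (\<open>fourier_asymptotics\<close>).

  The asymptotics descend by one dimension at a time (\<open>fourier_step\<close>). Let \<open>F\<close> be a polytope of
  dimension \<open>k + 1\<close> in a flat parallel to \<open>V (k + 1)\<close>, written as a union of cells of a hyperplane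
  arrangement. Integrate first along the lines in direction \<open>v k\<close>. A line meets \<open>F\<close> in segments whose
  end points lie on hyperplanes of the arrangement, and each end point contributes its exponential
  divided by \<open>2 pi i t k\<close>. Over a hyperplane parallel to \<open>V k\<close> the end points have constant height, and
  their contributions add up to the signed Fourier integrals of the facets of \<open>F\<close> in this hyperplane.
  Over any other hyperplane the height is an affine function of the base point, so the exponential
  oscillates with a frequency proportional to \<open>t k\<close>, and its integral over a convex region is of order
  \<open>1 / t k\<close> (\<open>flat_osc\<close>). This error is negligible because \<open>t k\<close> dominates the product of the factors
  that are still to come. The facets are again polytopes (\<open>polytope_closure_D\<close>), so the descent
  continues; at dimension \<open>r\<close> the integrals converge to volumes.

  The frequencies come from two facts. First, \<open>\<Lambda>\<close> meets every ball of some fixed radius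
  (\<open>spectrum_relatively_dense\<close>): for a bump function supported in \<open>A\<close> and modulated to the centre of
  the ball, completeness fixes the sum of the squared coefficients, while Bessel's inequality for the
  derivatives of the bump function bounds the part of this sum that comes from frequencies far from
  the centre. Second, among the points of \<open>\<Lambda>\<close> near \<open>\<Sum>k. n ^ (2 ^ k) *\<^sub>R v k\<close>, for \<open>n = 0, 1, 2, \<dots>\<close>,
  compactness yields a subsequence along which the components in \<open>V r\<close> and the required phases
  converge; differences of two late members of it that are far apart have all the required properties
  (\<open>dominated_differences_exist\<close>).
\<close>

section \<open>Integration over linear subspaces\<close>

definition orthonormal :: "'a::euclidean_space set \<Rightarrow> bool" where
  "orthonormal W \<longleftrightarrow> pairwise orthogonal W \<and> (\<forall>w\<in>W. norm w = 1)"

definition perp :: "'a::euclidean_space set \<Rightarrow> 'a set" where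
  "perp W = {x. \<forall>w\<in>W. w \<bullet> x = 0}"

definition prj :: "'a::euclidean_space set \<Rightarrow> 'a \<Rightarrow> 'a" where
  "prj W x = x - (\<Sum>w\<in>W. (w \<bullet> x) *\<^sub>R w)"

definition slab :: "'a::euclidean_space set \<Rightarrow> 'a set" where
  "slab W = {x. \<forall>w\<in>W. 0 \<le> w \<bullet> x \<and> w \<bullet> x < 1}"

text \<open>
  The integral of \<open>g\<close> over the orthogonal complement of the orthonormal set \<open>W\<close>. The slab has unit
  thickness in each direction of \<open>W\<close>, so integrating \<open>g \<circ> prj W\<close> over it adds a factor one. Subspaces of
  all dimensions are thus handled by the Lebesgue measure of the ambient space.
\<close>

definition flat_int :: "'a::euclidean_space set \<Rightarrow> ('a \<Rightarrow> 'b) \<Rightarrow> 'b::{banach, second_countable_topology}" where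
  "flat_int W g = (LINT x|lborel. indicator (slab W) x *\<^sub>R g (prj W x))"

text \<open>
  Only the values on \<open>perp W\<close> are restricted: \<open>g\<close> may be the indicator function of a cylinder that is
  unbounded in the directions of \<open>W\<close>.
\<close>

definition tame :: "'a::euclidean_space set \<Rightarrow> ('a \<Rightarrow> 'b::{banach, second_countable_topology}) \<Rightarrow> bool" where
  "tame W g \<longleftrightarrow> g \<in> borel_measurable borel \<and>
     (\<exists>B. \<forall>y\<in>perp W. norm (g y) \<le> B \<and> (g y \<noteq> 0 \<longrightarrow> norm y \<le> B))"

lemma orthonormal_finite: "orthonormal W \<Longrightarrow> finite W"
  unfolding orthonormal_def by (simp add: pairwise_orthogonal_imp_finite)

lemma orthonormal_inner:
  "\<lbrakk>orthonormal W; u \<in> W; w \<in> W\<rbrakk> \<Longrightarrow> u \<bullet> w = (if u = w then 1 else 0)"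
  unfolding orthonormal_def pairwise_def orthogonal_def
  by (auto simp: norm_eq_1)

lemma orthonormal_insertD:
  assumes "orthonormal (insert v W)"
  shows "orthonormal W" "norm v = 1" "v \<bullet> v = 1"
  using assms unfolding orthonormal_def by (auto simp: pairwise_insert norm_eq_1)

lemma orthonormal_insert_perp: "\<lbrakk>orthonormal (insert v W); v \<notin> W\<rbrakk> \<Longrightarrow> v \<in> perp W"
  unfolding perp_def using orthonormal_inner[of "insert v W"] by auto

lemma perp_empty [simp]: "perp {} = UNIV"
  by (simp add: perp_def)

lemma prj_empty [simp]: "prj {} x = x"
  by (simp add: prj_def)

lemma slab_empty [simp]: "slab {} = UNIV"
  by (simp add: slab_def)

lemma subspace_perp: "subspace (perp W)"
  unfolding perp_def by (auto simp: subspace_def inner_add_right)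

lemma zero_in_perp [simp]: "0 \<in> perp W"
  by (simp add: perp_def)

lemma perp_add: "\<lbrakk>x \<in> perp W; y \<in> perp W\<rbrakk> \<Longrightarrow> x + y \<in> perp W"
  by (simp add: perp_def inner_add_right)

lemma perp_diff: "\<lbrakk>x \<in> perp W; y \<in> perp W\<rbrakk> \<Longrightarrow> x - y \<in> perp W"
  by (simp add: perp_def inner_diff_right)

lemma perp_scale: "x \<in> perp W \<Longrightarrow> c *\<^sub>R x \<in> perp W"
  by (simp add: perp_def)

lemma perp_insert: "perp (insert v W) = {x \<in> perp W. v \<bullet> x = 0}"
  by (auto simp: perp_def)

lemma linear_prj: "linear (prj W)"
  unfolding prj_def
  by (rule linearI) (simp_all add: inner_add_right scaleR_add_left sum.distrib
      scaleR_diff_right scaleR_sum_right)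

lemma prj_add: "prj W (x + y) = prj W x + prj W y"
  and prj_diff: "prj W (x - y) = prj W x - prj W y"
  and prj_scale: "prj W (c *\<^sub>R x) = c *\<^sub>R prj W x"
  and prj_zero [simp]: "prj W 0 = 0"
  using linear_add[OF linear_prj] linear_diff[OF linear_prj] linear_scale[OF linear_prj]
    linear_0[OF linear_prj] by auto

lemma prj_in_perp: 
  assumes "orthonormal W" shows "prj W x \<in> perp W"
proof -
  have "w \<bullet> (\<Sum>u\<in>W. (u \<bullet> x) *\<^sub>R u) = w \<bullet> x" if "w \<in> W" for w
  proof -
    have "w \<bullet> (\<Sum>u\<in>W. (u \<bullet> x) *\<^sub>R u) = (\<Sum>u\<in>W. if w = u then u \<bullet> x else 0)"
      unfolding inner_sum_right
      by (intro sum.cong refl) (use that orthonormal_inner[OF assms] in auto)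
    then show ?thesis using that orthonormal_finite[OF assms] by simp
  qed
  then show ?thesis by (simp add: perp_def prj_def inner_diff_right)
qed

lemma prj_id: "x \<in> perp W \<Longrightarrow> prj W x = x"
  by (simp add: perp_def prj_def)

lemma inner_prj: "a \<in> perp W \<Longrightarrow> a \<bullet> prj W x = a \<bullet> x"
  by (simp add: perp_def prj_def inner_diff_right inner_sum_right inner_commute)

lemma inner_prj_left: "a \<in> perp W \<Longrightarrow> prj W x \<bullet> a = x \<bullet> a"
  using inner_prj by (metis inner_commute)

lemma norm_prj_le:
  assumes "orthonormal W" shows "norm (prj W x) \<le> norm x"
proof -
  have "norm (prj W x) ^ 2 = prj W x \<bullet> x"
    using inner_prj[OF prj_in_perp[OF assms], of x x] by (simp add: power2_norm_eq_inner)
  also have "\<dots> \<le> norm (prj W x) * norm x"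
    by (rule norm_cauchy_schwarz)
  finally show ?thesis
    by (metis mult_le_cancel_left_pos norm_ge_zero norm_le_zero_iff not_le_imp_less order_trans
        power2_eq_square)
qed

lemma continuous_on_prj [continuous_intros]:
  "continuous_on S f \<Longrightarrow> continuous_on S (\<lambda>x. prj W (f x))"
  unfolding prj_def by (intro continuous_intros)

lemma borel_measurable_prj [measurable]: "prj W \<in> borel_measurable borel"
  by (intro borel_measurable_continuous_onI continuous_intros continuous_on_id)

lemma prj_insert:
  assumes "orthonormal (insert v W)" "v \<notin> W"
  shows "prj (insert v W) x = prj W x - (v \<bullet> x) *\<^sub>R v"
  using assms(2) orthonormal_finite[OF orthonormal_insertD(1)[OF assms(1)]]
  by (simp add: prj_def)

lemma slab_insert: "slab (insert v W) = slab W \<inter> {x. 0 \<le> v \<bullet> x \<and> v \<bullet> x < 1}"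
  by (auto simp: slab_def)

lemma slab_borel [measurable]: "orthonormal W \<Longrightarrow> slab W \<in> sets borel"
proof -
  assume "orthonormal W"
  then have "finite W" by (rule orthonormal_finite)
  then show ?thesis
  proof (induction W)
    case (insert w W)
    have "slab W \<in> sets borel" using insert by simp
    moreover have "{x. 0 \<le> w \<bullet> x \<and> w \<bullet> x < 1} \<in> sets borel" by measurable
    ultimately show ?case by (simp add: slab_insert)
  qed simp
qed

lemma slab_shift: "y \<in> perp W \<Longrightarrow> x + y \<in> slab W \<longleftrightarrow> x \<in> slab W"
  by (simp add: slab_def perp_def inner_add_right)

lemma norm_slab_le:
  assumes "orthonormal W" "x \<in> slab W"
  shows "norm x \<le> norm (prj W x) + card W"
proof -
  have "norm (\<Sum>w\<in>W. (w \<bullet> x) *\<^sub>R w) \<le> (\<Sum>w\<in>W. 1)"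
  proof (rule sum_norm_le)
    fix w assume "w \<in> W"
    then show "norm ((w \<bullet> x) *\<^sub>R w) \<le> 1"
      using assms by (auto simp: orthonormal_def slab_def)
  qed
  moreover have "norm x \<le> norm (prj W x) + norm (\<Sum>w\<in>W. (w \<bullet> x) *\<^sub>R w)"
    unfolding prj_def by (metis diff_add_cancel norm_triangle_ineq)
  ultimately show ?thesis by simp
qed

lemma integrable_bounded_support:
  fixes g :: "'a::euclidean_space \<Rightarrow> 'b::{banach, second_countable_topology}"
  assumes "g \<in> borel_measurable borel" "\<And>x. norm (g x) \<le> B" "\<And>x. g x \<noteq> 0 \<Longrightarrow> norm x \<le> R"
  shows "integrable lborel g"
proof (rule integrableI_bounded_set[where A = "cball 0 R" and B = B])
  show "emeasure lborel (cball (0::'a) R) < \<infinity>"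
    using emeasure_bounded_finite bounded_cball by blast
qed (use assms in \<open>auto simp: dist_norm\<close>)

lemma tame_empty_integrable: "tame {} g \<Longrightarrow> integrable lborel g"
  unfolding tame_def by (auto intro!: integrable_bounded_support)

lemma tame_thicken:
  assumes "orthonormal W" "tame W g"
  shows "tame {} (\<lambda>x. indicator (slab W) x *\<^sub>R g (prj W x))"
proof -
  obtain B where B: "\<And>y. y \<in> perp W \<Longrightarrow> norm (g y) \<le> B" 
      "\<And>y. y \<in> perp W \<Longrightarrow> g y \<noteq> 0 \<Longrightarrow> norm y \<le> B"
    and [measurable]: "g \<in> borel_measurable borel"
    using assms unfolding tame_def by blast
  have [measurable]: "slab W \<in> sets borel" using assms slab_borel by blast
  have "(\<lambda>x. indicator (slab W) x *\<^sub>R g (prj W x)) \<in> borel_measurable borel" by measurable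
  moreover have "0 \<le> B" using B(1)[of 0] norm_ge_zero order_trans zero_in_perp by blast
  moreover have "norm x \<le> B + card W" if "indicator (slab W) x *\<^sub>R g (prj W x) \<noteq> 0" for x
    using that norm_slab_le[OF assms(1), of x] B(2)[OF prj_in_perp[OF assms(1)], of x]
    by (auto simp: indicator_def split: if_splits)
  moreover have "norm (indicator (slab W) x *\<^sub>R g (prj W x)) \<le> B + card W" for x
    using B(1)[OF prj_in_perp[OF assms(1)], of x] \<open>0 \<le> B\<close>
    by (auto simp: indicator_def)
  ultimately show ?thesis unfolding tame_def by blast
qed

lemma tame_integrable:
  "\<lbrakk>orthonormal W; tame W g\<rbrakk> \<Longrightarrow> integrable lborel (\<lambda>x. indicator (slab W) x *\<^sub>R g (prj W x))"
  using tame_empty_integrable tame_thicken by blast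

lemma lborel_integral_translate:
  fixes g :: "'a::euclidean_space \<Rightarrow> 'b::{banach, second_countable_topology}"
  assumes "g \<in> borel_measurable borel"
  shows "(LINT x|lborel. g (x + c)) = (LINT x|lborel. g x)"
proof -
  have "(LINT x|lborel. g x) = (LINT x|distr lborel borel ((+) c). g x)"
    by (simp add: lborel_distr_plus)
  also have "\<dots> = (LINT x|lborel. g (c + x))"
    by (subst integral_distr) (use assms in auto)
  finally show ?thesis by (simp add: add.commute)
qed

lemma lborel_integral_reflect_shift:
  "(LINT s|lborel. indicator {0..<1::real} (c - s) :: real) = 1"
proof -
  have "indicator {0..<1::real} (c - s) = (indicator {c - 1<..c} s :: real)" for s
    by (auto simp: indicator_def)
  then show ?thesis by simp
qed

text \<open>
  Fubini along the direction \<open>u\<close>, without splitting the space as a product: translating \<open>x\<close> by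
  \<open>s *\<^sub>R u\<close> turns the weight into \<open>indicator {0..<1} (u \<bullet> x - s)\<close>, whose integral over \<open>s\<close> is one.
\<close>

lemma
  fixes g :: "'a::euclidean_space \<Rightarrow> 'b::{banach, second_countable_topology}"
  assumes g: "tame {} g" and u: "norm u = 1"
  shows slice_unit_integrable: "integrable lborel
      (\<lambda>x. indicator {0..<1::real} (u \<bullet> x) *\<^sub>R (LINT s|lborel. g (x + s *\<^sub>R u)))"
    and slice_unit: "(LINT x|lborel. g x) =
     (LINT x|lborel. indicator {0..<1::real} (u \<bullet> x) *\<^sub>R (LINT s|lborel. g (x + s *\<^sub>R u)))"
proof -
  obtain B where B: "\<And>y. norm (g y) \<le> B" "\<And>y. g y \<noteq> 0 \<Longrightarrow> norm y \<le> B"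
    and gm [measurable]: "g \<in> borel_measurable borel"
    using g unfolding tame_def by auto
  have uu: "u \<bullet> u = 1" using u by (simp add: norm_eq_1)
  have [measurable]: "g \<in> borel_measurable (lborel)" by simp
  let ?h = "\<lambda>x s. indicator {0..<1::real} (u \<bullet> x) *\<^sub>R g (x + s *\<^sub>R u)"
  let ?k = "\<lambda>x s. indicator {0..<1::real} (u \<bullet> x - s) *\<^sub>R g x"
  have int1: "integrable (lborel \<Otimes>\<^sub>M lborel) (case_prod ?h)"
    unfolding lborel_prod
  proof (rule integrable_bounded_support[where B = B and R = "B + (B + 1) + (B + 1)"])
    show "case_prod ?h \<in> borel_measurable borel"
      unfolding borel_prod[symmetric] by measurable
    show "norm (case_prod ?h p) \<le> B" for p
      using B(1) order_trans[OF norm_ge_zero B(1)] by (auto simp: indicator_def split: prod.split)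
    fix p assume "case_prod ?h p \<noteq> 0"
    moreover obtain x s where p: "p = (x, s)" by fastforce
    ultimately have *: "0 \<le> u \<bullet> x" "u \<bullet> x < 1" "norm (x + s *\<^sub>R u) \<le> B" 
      using B(2) by (auto simp: indicator_def split: if_splits)
    have "\<bar>u \<bullet> (x + s *\<^sub>R u)\<bar> \<le> B" 
      using Cauchy_Schwarz_ineq2[of u "x + s *\<^sub>R u"] u * by simp
    then have s: "\<bar>s\<bar> \<le> B + 1" using * by (simp add: inner_add_right uu)
    have "norm x \<le> norm (x + s *\<^sub>R u) + norm (s *\<^sub>R u)"
      by (metis add_diff_cancel_right' norm_triangle_ineq4)
    then have "norm x \<le> B + (B + 1)" using * s u by simp
    moreover have "norm p \<le> norm x + \<bar>s\<bar>" using p norm_Pair_le[of x s] by simp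
    ultimately show "norm p \<le> B + (B + 1) + (B + 1)" using s by simp
  qed
  show "integrable lborel
      (\<lambda>x. indicator {0..<1::real} (u \<bullet> x) *\<^sub>R (LINT s|lborel. g (x + s *\<^sub>R u)))"
    using lborel_pair.integrable_fst[OF int1] by simp
  have int2: "integrable (lborel \<Otimes>\<^sub>M lborel) (case_prod ?k)"
    unfolding lborel_prod
  proof (rule integrable_bounded_support[where B = B and R = "B + (B + 1)"])
    show "case_prod ?k \<in> borel_measurable borel"
      unfolding borel_prod[symmetric] by measurable
    show "norm (case_prod ?k p) \<le> B" for p
      using B(1) order_trans[OF norm_ge_zero B(1)] by (auto simp: indicator_def split: prod.split)
    fix p assume "case_prod ?k p \<noteq> 0"
    moreover obtain x s where p: "p = (x, s)" by fastforce
    ultimately have *: "0 \<le> u \<bullet> x - s" "u \<bullet> x - s < 1" "norm x \<le> B" 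
      using B(2) by (auto simp: indicator_def split: if_splits)
    have "\<bar>u \<bullet> x\<bar> \<le> B" 
      using Cauchy_Schwarz_ineq2[of u "x"] u * by simp
    then have s: "\<bar>s\<bar> \<le> B + 1" using * by simp
    moreover have "norm p \<le> norm x + \<bar>s\<bar>" using p norm_Pair_le[of x s] by simp
    ultimately show "norm p \<le> B + (B + 1)" using * by simp
  qed
  have "(LINT x|lborel. indicator {0..<1::real} (u \<bullet> x) *\<^sub>R (LINT s|lborel. g (x + s *\<^sub>R u)))
      = (LINT x|lborel. LINT s|lborel. ?h x s)" by simp
  also have "\<dots> = (LINT s|lborel. LINT x|lborel. ?h x s)"
    using lborel_pair.Fubini_integral[OF int1] by simp
  also have "\<dots> = (LINT s|lborel. LINT x|lborel. ?k x s)"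
  proof (rule Bochner_Integration.integral_cong[OF refl])
    fix s :: real
    have "(LINT x|lborel. ?k x s) = (LINT x|lborel. ?k (x + s *\<^sub>R u) s)"
      by (rule lborel_integral_translate[symmetric]) measurable
    then show "(LINT x|lborel. ?h x s) = (LINT x|lborel. ?k x s)"
      by (simp add: inner_add_right uu)
  qed
  also have "\<dots> = (LINT x|lborel. LINT s|lborel. ?k x s)"
    using lborel_pair.Fubini_integral[OF int2] by simp
  also have "\<dots> = (LINT x|lborel. g x)"
  proof (rule Bochner_Integration.integral_cong[OF refl])
    fix x
    have "integrable lborel (\<lambda>s. indicator {0..<1::real} (u \<bullet> x - s) :: real)"
    proof -
      have "indicator {0..<1::real} (u \<bullet> x - s) = (indicator {u \<bullet> x - 1<..u \<bullet> x} s :: real)" for s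
        by (auto simp: indicator_def)
      then show ?thesis by simp
    qed
    then show "(LINT s|lborel. ?k x s) = g x"
      by (simp add: lborel_integral_reflect_shift)
  qed
  finally show "(LINT x|lborel. g x) =
     (LINT x|lborel. indicator {0..<1::real} (u \<bullet> x) *\<^sub>R (LINT s|lborel. g (x + s *\<^sub>R u)))" by simp
qed

text \<open>
  Fubini for the splitting of \<open>perp W\<close> into \<open>perp (insert v W)\<close> and the line spanned by \<open>v\<close>. The slab
  of \<open>insert v W\<close> is the slab of \<open>W\<close> cut down by the weight that \<open>slice_unit\<close> introduces.
\<close>

lemma flat_slice:
  fixes g :: "'a::euclidean_space \<Rightarrow> 'b::{banach, second_countable_topology}"
  assumes W: "orthonormal (insert v W)" "v \<notin> W" and g: "tame W g"
  shows "flat_int W g = flat_int (insert v W) (\<lambda>y. LINT s|lborel. g (y + s *\<^sub>R v))"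
proof -
  note W' = orthonormal_insertD[OF W(1)]
  have v: "v \<in> perp W" using W orthonormal_insert_perp by blast
  have [measurable]: "g \<in> borel_measurable borel" using g by (simp add: tame_def)
  let ?G = "\<lambda>x. indicator (slab W) x *\<^sub>R g (prj W x)"
  have "flat_int W g = (LINT x|lborel. indicator {0..<1::real} (v \<bullet> x) *\<^sub>R 
            (LINT s|lborel. ?G (x + s *\<^sub>R v)))"
    unfolding flat_int_def using slice_unit[OF tame_thicken[OF W'(1) g] W'(2)] .
  also have "\<dots> = (LINT x|lborel. indicator (slab (insert v W)) x *\<^sub>R 
            (LINT s|lborel. g (prj (insert v W) x + s *\<^sub>R v)))"
  proof (rule Bochner_Integration.integral_cong[OF refl])
    fix x
    have "(LINT s|lborel. ?G (x + s *\<^sub>R v)) = 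
      (LINT s|lborel. indicator (slab W) x *\<^sub>R g (prj W x + s *\<^sub>R v))"
      by (simp add: indicator_def slab_shift perp_scale[OF v] prj_add prj_id)
    also have "\<dots> = indicator (slab W) x *\<^sub>R (LINT s|lborel. g (prj W x + s *\<^sub>R v))"
      by simp
    also have "(LINT s|lborel. g (prj W x + s *\<^sub>R v)) = 
       (LINT s|lborel. (\<lambda>s. g (prj (insert v W) x + s *\<^sub>R v)) (s + v \<bullet> x))"
      by (simp add: prj_insert[OF W] algebra_simps)
    also have "\<dots> = (LINT s|lborel. g (prj (insert v W) x + s *\<^sub>R v))"
      by (rule lborel_integral_translate) measurable
    finally show "indicator {0..<1::real} (v \<bullet> x) *\<^sub>R (LINT s|lborel. ?G (x + s *\<^sub>R v)) = 
      indicator (slab (insert v W)) x *\<^sub>R (LINT s|lborel. g (prj (insert v W) x + s *\<^sub>R v))"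
      by (auto simp: slab_insert indicator_def)
  qed
  finally show ?thesis by (simp add: flat_int_def)
qed

lemma flat_int_cong:
  assumes "orthonormal W" "\<And>y. y \<in> perp W \<Longrightarrow> f y = g y"
  shows "flat_int W f = flat_int W g"
  unfolding flat_int_def using assms prj_in_perp by metis

section \<open>Exponentials and oscillatory integrals\<close>

lemma expo_add_right: "expo l (x + y) = expo l x * expo l y"
  by (simp add: expo_def inner_add_right distrib_left exp_add)

lemma expo_add_left: "expo (l + m) x = expo l x * expo m x"
  by (simp add: expo_def inner_add_left distrib_left exp_add)

lemma expo_zero [simp]: "expo 0 x = 1" "expo l 0 = 1"
  by (simp_all add: expo_def)

lemma norm_expo [simp]: "norm (expo l x) = 1"
proof -
  have "expo l x = cis (2 * pi * (l \<bullet> x))" by (simp add: expo_def cis_conv_exp mult_ac)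
  then show ?thesis by simp
qed

lemma expo_uminus: "expo (- l) x = cnj (expo l x)"
  by (simp add: expo_def exp_cnj)

lemma expo_diff_left: "expo (l - m) x = expo l x * cnj (expo m x)"
  using expo_add_left[of l "- m" x] by (simp add: expo_uminus)

lemma expo_scale_right: "expo l (s *\<^sub>R u) = expo (l \<bullet> u) s"
  by (simp add: expo_def mult.commute)

lemma expo_cong: "l \<bullet> x = m \<bullet> y \<Longrightarrow> expo l x = expo m y"
  by (simp add: expo_def)

lemma continuous_on_expo [continuous_intros]:
  "continuous_on S f \<Longrightarrow> continuous_on S (\<lambda>x. expo l (f x))"
  unfolding expo_def by (intro continuous_intros)

lemma borel_measurable_expo [measurable]: "expo l \<in> borel_measurable borel"
  by (intro borel_measurable_continuous_onI continuous_intros continuous_on_id)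

lemma tendsto_expo_left [tendsto_intros]:
  "(f \<longlongrightarrow> l) F \<Longrightarrow> ((\<lambda>n. expo (f n) x) \<longlongrightarrow> expo l x) F"
  unfolding expo_def by (intro tendsto_intros)

lemma integral_expo_interval:
  fixes a b \<omega> :: real
  assumes "a \<le> b" "\<omega> \<noteq> 0" and J: "J \<in> sets borel" "{a<..<b} \<subseteq> J" "J \<subseteq> {a..b}"
  shows "(LINT s|lborel. indicator J s *\<^sub>R expo \<omega> s) 
        = (expo \<omega> b - expo \<omega> a) / (2 * of_real pi * \<i> * of_real \<omega>)"
proof -
  let ?c = "2 * of_real pi * \<i> * of_real \<omega> :: complex"
  have c: "?c \<noteq> 0" using assms by simp
  have "(LINT s|lborel. indicator J s *\<^sub>R expo \<omega> s) = (LINT s|lborel. indicator {a..b} s *\<^sub>R expo \<omega> s)"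
  proof (rule integral_cong_AE)
    show "AE s in lborel. indicat_real J s *\<^sub>R expo \<omega> s = indicat_real {a..b} s *\<^sub>R expo \<omega> s"
      using AE_lborel_singleton[of a] AE_lborel_singleton[of b]
    proof eventually_elim
      case (elim s)
      then have "s \<in> J \<longleftrightarrow> s \<in> {a..b}" using J by force
      then show ?case by (simp add: indicator_def)
    qed
  qed (use J in measurable)
  also have "\<dots> = expo \<omega> b / ?c - expo \<omega> a / ?c"
  proof (rule integral_FTC_Icc[OF assms(1)])
    fix s
    have "((\<lambda>z::complex. exp (?c * z) / ?c) has_field_derivative exp (?c * of_real s)) (at (of_real s))"
      using c by (auto intro!: derivative_eq_intros)
    then have "((\<lambda>s. exp (?c * of_real s) / ?c) has_vector_derivative exp (?c * of_real s)) (at s within {a..b})"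
      by (rule has_vector_derivative_real_field)
    then show "((\<lambda>s. expo \<omega> s / ?c) has_vector_derivative expo \<omega> s) (at s within {a..b})"
      by (simp add: expo_def mult_ac)
  qed (intro continuous_intros continuous_on_id)
  finally show ?thesis by (simp add: diff_divide_distrib)
qed

lemma convex_real_between:
  fixes J :: "real set"
  assumes "convex J" "bounded J" "J \<noteq> {}"
  shows "{Inf J<..<Sup J} \<subseteq> J" "J \<subseteq> {Inf J..Sup J}" "Inf J \<le> Sup J"
proof -
  have bd: "bdd_above J" "bdd_below J"
    using assms by (auto simp: bounded_imp_bdd_above bounded_imp_bdd_below)
  show "J \<subseteq> {Inf J..Sup J}"
    using bd by (auto intro: cInf_lower cSup_upper)
  then show "Inf J \<le> Sup J" using assms by fastforce
  show "{Inf J<..<Sup J} \<subseteq> J"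
  proof
    fix s assume "s \<in> {Inf J<..<Sup J}"
    then obtain a b where "a \<in> J" "a < s" "b \<in> J" "s < b"
      using assms bd by (auto simp: cInf_less_iff less_cSup_iff)
    then show "s \<in> J"
      using assms(1) by (meson is_interval_convex_1 less_imp_le mem_is_interval_1_I)
  qed
qed

lemma norm_integral_expo_convex:
  fixes J :: "real set"
  assumes "convex J" "bounded J" "J \<in> sets borel" "\<omega> \<noteq> 0"
  shows "norm (LINT s|lborel. indicator J s *\<^sub>R expo \<omega> s) \<le> 1 / (pi * \<bar>\<omega>\<bar>)"
proof (cases "J = {}")
  case False
  note * = convex_real_between[OF assms(1,2) False]
  have "norm (LINT s|lborel. indicator J s *\<^sub>R expo \<omega> s) = 
      norm (expo \<omega> (Sup J) - expo \<omega> (Inf J)) / (2 * pi * \<bar>\<omega>\<bar>)"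
    unfolding integral_expo_interval[OF *(3) assms(4) assms(3) *(1,2)]
    by (simp add: norm_divide norm_mult)
  also have "\<dots> \<le> 2 / (2 * pi * \<bar>\<omega>\<bar>)"
    using norm_triangle_ineq4[of "expo \<omega> (Sup J)" "expo \<omega> (Inf J)"]
    by (intro divide_right_mono) auto
  finally show ?thesis by simp
qed simp

text \<open>
  The set under the integral is the interval between the largest lower threshold (index in \<open>L\<close>) and
  the smallest upper one. A threshold satisfies all the other constraints exactly if it is an end
  point of this interval, and none does if the interval is empty. Naming the end points by this
  condition keeps the formula uniform when the thresholds vary with a parameter.
\<close>

lemma integral_expo_cell_on_line:
  fixes T :: "'i \<Rightarrow> real"
  assumes "finite I" "inj_on T I" "I \<inter> L \<noteq> {}" "I - L \<noteq> {}" "\<omega> \<noteq> 0"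
  shows "(2 * of_real pi * \<i> * of_real \<omega>) * 
    (LINT s|lborel. indicator {s. \<forall>i\<in>I. if i \<in> L then T i < s else s < T i} s *\<^sub>R expo \<omega> s) =
    (\<Sum>i\<in>I. (if i \<in> L then - 1 else 1) * 
       (if \<forall>j\<in>I - {i}. if j \<in> L then T j < T i else T i < T j then expo \<omega> (T i) else 0))"
    (is "?c * (LINT s|lborel. indicator ?J s *\<^sub>R _) = (\<Sum>i\<in>I. ?sg i * (if ?ok i then _ else 0))")
proof -
  have c: "?c \<noteq> 0" using assms by simp
  obtain p where p: "p \<in> I \<inter> L" "\<And>i. i \<in> I \<inter> L \<Longrightarrow> T i \<le> T p"
  proof -
    have "finite (T ` (I \<inter> L))" "T ` (I \<inter> L) \<noteq> {}" using assms(1,3) by auto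
    then have "Max (T ` (I \<inter> L)) \<in> T ` (I \<inter> L)" "\<And>i. i \<in> I \<inter> L \<Longrightarrow> T i \<le> Max (T ` (I \<inter> L))"
      by (auto intro: Max_in)
    then show thesis using that by (smt (verit) imageE)
  qed
  obtain q where q: "q \<in> I - L" "\<And>i. i \<in> I - L \<Longrightarrow> T q \<le> T i"
    by (metis (no_types, lifting) arg_min_if_finite(1) arg_min_if_finite(2) assms(1,4) finite_Diff linorder_not_less)
  have pq: "T p \<noteq> T q" using assms(2) p q by (auto simp: inj_on_def)
  have pmax: "T i < T p" if "i \<in> I" "i \<in> L" "i \<noteq> p" for i
    using p(1) p(2)[of i] that assms(2) by (force simp: inj_on_def less_le)
  have qmin: "T q < T i" if "i \<in> I" "i \<notin> L" "i \<noteq> q" for i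
    using q(1) q(2)[of i] that assms(2) by (force simp: inj_on_def less_le)
  have J: "?J = {T p<..<T q}"
  proof (intro equalityI subsetI)
    fix s assume "s \<in> ?J" then show "s \<in> {T p<..<T q}" using p(1) q(1) by auto
  next
    fix s assume "s \<in> {T p<..<T q}" then show "s \<in> ?J" using p(2) q(2) by force
  qed
  show ?thesis
  proof (cases "T p < T q")
    case False
    then have "\<not> ?ok i" if "i \<in> I" for i
      using p q pq that by (smt (verit, ccfv_SIG) DiffD1 DiffD2 DiffI Int_iff singletonD)
    then have "(\<Sum>i\<in>I. ?sg i * (if ?ok i then expo \<omega> (T i) else 0)) = 0"
      by (intro sum.neutral ballI) (simp only: if_False mult_zero_right)
    moreover have "?J = {}" using False J by auto
    ultimately show ?thesis by simp
  next
    case True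
    have ok: "?ok i \<longleftrightarrow> i = p \<or> i = q" if "i \<in> I" for i
    proof
      assume *: "?ok i"
      show "i = p \<or> i = q"
      proof (rule ccontr)
        assume **: "\<not> (i = p \<or> i = q)"
        show False
        proof (cases "i \<in> L")
          case True
          then have "T i < T p" using pmax that ** by blast
          moreover have "T p < T i" using * p(1) ** by auto
          ultimately show False by simp
        next
          case False
          then have "T q < T i" using qmin that ** by blast
          moreover have "T i < T q" using * q(1) ** by auto
          ultimately show False by simp
        qed
      qed
    next
      assume "i = p \<or> i = q"
      then show "?ok i"
      proof
        assume i: "i = p"
        have "if j \<in> L then T j < T i else T i < T j" if "j \<in> I - {i}" for j
          using that i pmax[of j] q(2)[of j] True by auto
        then show ?thesis by blast
      next
        assume i: "i = q"
        have "if j \<in> L then T j < T i else T i < T j" if "j \<in> I - {i}" for j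
          using that i qmin[of j] p(2)[of j] True by auto
        then show ?thesis by blast
      qed
    qed
    have pq': "p \<noteq> q" using pq by auto
    have "(\<Sum>i\<in>I. ?sg i * (if ?ok i then expo \<omega> (T i) else 0)) = 
        (\<Sum>i\<in>I. ?sg i * (if i = p \<or> i = q then expo \<omega> (T i) else 0))"
      by (intro sum.cong refl) (simp only: ok)
    also have "\<dots> = (\<Sum>i\<in>{p, q}. ?sg i * expo \<omega> (T i))"
      using p(1) q(1) by (intro sum.mono_neutral_cong_right assms(1)) auto
    also have "\<dots> = expo \<omega> (T q) - expo \<omega> (T p)" using pq' p(1) q(1) by simp
    finally have S: "(\<Sum>i\<in>I. ?sg i * (if ?ok i then expo \<omega> (T i) else 0)) = expo \<omega> (T q) - expo \<omega> (T p)" .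
    have "(LINT s|lborel. indicator ?J s *\<^sub>R expo \<omega> s) = (expo \<omega> (T q) - expo \<omega> (T p)) / ?c"
      unfolding J using True assms(5) by (intro integral_expo_interval) auto
    then show ?thesis unfolding S using c by simp
  qed
qed

text \<open>
  Lines in direction \<open>\<zeta>\<close> meet a convex set in intervals, on which the integral of the exponential is at
  most \<open>1 / (pi * norm \<zeta>)\<close>. The lines that contribute start in a ball whose volume gives \<open>M\<close>.
\<close>

lemma flat_osc:
  fixes W :: "'a::euclidean_space set"
  assumes W: "orthonormal W" and C: "C \<in> sets borel" "convex C" 
    and R: "\<And>y. y \<in> perp W \<Longrightarrow> y \<in> C \<Longrightarrow> norm y \<le> R"
  obtains M where "M \<ge> 0" 
    "\<And>\<zeta>. \<zeta> \<in> perp W \<Longrightarrow> \<zeta> \<noteq> 0 \<Longrightarrow> 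
        norm (flat_int W (\<lambda>y. indicator C y *\<^sub>R expo \<zeta> y)) \<le> M / norm \<zeta>"
proof
  define R' where "R' = R + (R + 1) + card W"
  let ?M = "measure lborel (cball (0::'a) R') / pi"
  show "?M \<ge> 0" by simp
  fix \<zeta> assume z: "\<zeta> \<in> perp W" "\<zeta> \<noteq> 0"
  define u where "u = \<zeta> /\<^sub>R norm \<zeta>"
  have u: "norm u = 1" "u \<in> perp W" "u \<bullet> u = 1"
  proof -
    show "norm u = 1" using z by (simp add: u_def)
    then show "u \<bullet> u = 1" by (simp add: norm_eq_1)
    show "u \<in> perp W" using z by (simp add: u_def perp_scale)
  qed
  have zu: "\<zeta> \<bullet> u = norm \<zeta>" using z by (simp add: u_def dot_square_norm power2_eq_square)
  let ?g = "\<lambda>y. indicator C y *\<^sub>R expo \<zeta> y"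
  have [measurable]: "C \<in> sets borel" by fact
  have tame: "tame W ?g"
    unfolding tame_def
  proof (intro conjI exI[of _ "max 1 R"] ballI)
    show "?g \<in> borel_measurable borel" by measurable
  qed (auto simp: indicator_def dest: R)
  let ?G = "\<lambda>x. indicator (slab W) x *\<^sub>R ?g (prj W x)"
  have "norm (flat_int W ?g) = norm (LINT x|lborel. indicator {0..<1::real} (u \<bullet> x) *\<^sub>R 
            (LINT s|lborel. ?G (x + s *\<^sub>R u)))"
    unfolding flat_int_def using slice_unit[OF tame_thicken[OF W tame] u(1)] by simp
  also have "\<dots> \<le> (LINT x|lborel. indicator (cball (0::'a) R') x *\<^sub>R (1 / (pi * norm \<zeta>)))"
  proof (rule Bochner_Integration.integral_norm_bound_integral)
    show "integrable lborel (\<lambda>x. indicat_real {0..<1} (u \<bullet> x) *\<^sub>R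
           (LBINT s. indicat_real (slab W) (x + s *\<^sub>R u) *\<^sub>R
             indicat_real C (prj W (x + s *\<^sub>R u)) *\<^sub>R expo \<zeta> (prj W (x + s *\<^sub>R u))))" (is "integrable _ ?f")
      by (rule slice_unit_integrable[OF tame_thicken[OF W tame] u(1)])
    show "integrable lborel (\<lambda>x. indicator (cball (0::'a) R') x *\<^sub>R (1 / (pi * norm \<zeta>)))"
      by (intro integrable_scaleR_left integrable_real_indicator) 
         (use emeasure_bounded_finite[OF bounded_cball] in auto)
    fix x :: 'a
    let ?J = "{s. prj W x + s *\<^sub>R u \<in> C}"
    have [measurable]: "?J \<in> sets borel" by measurable
    show "norm (?f x) \<le> indicator (cball (0::'a) R') x *\<^sub>R (1 / (pi * norm \<zeta>))"
    proof (cases "u \<bullet> x \<in> {0..<1} \<and> x \<in> slab W \<and> ?J \<noteq> {}")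
      case False
      then have 0: "?f x = 0"
        by (auto simp: slab_shift u perp_scale prj_add prj_id indicator_def)
      show ?thesis unfolding 0 by simp
    next
      case True
      have bd: "norm (prj W x + s *\<^sub>R u) \<le> R" if "s \<in> ?J" for s
        using that R perp_add[OF prj_in_perp[OF W] perp_scale[OF u(2)]] by auto
      have ux: "u \<bullet> prj W x = u \<bullet> x" using inner_prj u by blast
      have s: "\<bar>s\<bar> \<le> R + 1" if "s \<in> ?J" for s
      proof -
        have "\<bar>u \<bullet> (prj W x + s *\<^sub>R u)\<bar> \<le> R" 
          using Cauchy_Schwarz_ineq2[of u "prj W x + s *\<^sub>R u"] u bd[OF that] by simp
        then have "\<bar>u \<bullet> x + s\<bar> \<le> R" by (simp add: inner_add_right u ux)
        moreover have "0 \<le> u \<bullet> x" "u \<bullet> x < 1" using True by auto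
        ultimately show ?thesis by linarith
      qed
      have "bounded ?J" using s by (auto simp: bounded_iff)
      moreover have "convex ?J"
      proof (rule convexI)
        fix s t and a b :: real assume *: "s \<in> ?J" "t \<in> ?J" "0 \<le> a" "0 \<le> b" "a + b = 1"
        have "prj W x + (a *\<^sub>R s + b *\<^sub>R t) *\<^sub>R u = 
            (a + b) *\<^sub>R prj W x + (a *\<^sub>R s + b *\<^sub>R t) *\<^sub>R u" using * by simp
        also have "\<dots> = a *\<^sub>R (prj W x + s *\<^sub>R u) + b *\<^sub>R (prj W x + t *\<^sub>R u)"
          by (simp add: algebra_simps)
        finally show "a *\<^sub>R s + b *\<^sub>R t \<in> ?J"
          using * convexD[OF C(2), of "prj W x + s *\<^sub>R u" "prj W x + t *\<^sub>R u" a b] by simp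
      qed
      ultimately have J: "norm (LINT s|lborel. indicator ?J s *\<^sub>R expo (norm \<zeta>) s) \<le> 1 / (pi * norm \<zeta>)"
        using norm_integral_expo_convex[of ?J "norm \<zeta>"] z by simp
      have "?f x = (LINT s|lborel. expo \<zeta> (prj W x) * (indicator ?J s *\<^sub>R expo (norm \<zeta>) s))"
        using True by (simp add: slab_shift u perp_scale prj_add prj_id indicator_def expo_add_right
            expo_scale_right zu)
      also have "\<dots> = expo \<zeta> (prj W x) * (LINT s|lborel. indicator ?J s *\<^sub>R expo (norm \<zeta>) s)"
        by (rule integral_mult_right_zero)
      finally have 1: "norm (?f x) \<le> 1 / (pi * norm \<zeta>)" using J by (simp add: norm_mult)
      obtain s0 where "s0 \<in> ?J" using True by blast
      have "norm (prj W x) \<le> norm (prj W x + s0 *\<^sub>R u) + norm (s0 *\<^sub>R u)"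
        by (metis add_diff_cancel_right' norm_triangle_ineq4)
      then have "norm (prj W x) \<le> R + (R + 1)"
        using bd[OF \<open>s0 \<in> ?J\<close>] s[OF \<open>s0 \<in> ?J\<close>] u by simp
      then have "norm x \<le> R'" using norm_slab_le[OF W, of x] True by (simp add: R'_def)
      then show ?thesis using 1 by simp
    qed
  qed
  also have "\<dots> = ?M / norm \<zeta>" by simp
  finally show "norm (flat_int W ?g) \<le> ?M / norm \<zeta>" .
qed

section \<open>Generic points of a flat\<close>

text \<open>
  Since \<open>prj W\<close> is self-adjoint, each condition excludes a set \<open>{x. prj W a \<bullet> x = b - a \<bullet> q}\<close>, which is a
  hyperplane or empty.
\<close>

lemma AE_flat_generic:
  fixes W :: "'a::euclidean_space set"
  assumes W: "orthonormal W" and "finite H" 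
    and proper: "\<And>a b. (a, b) \<in> H \<Longrightarrow> \<exists>z\<in>perp W. a \<bullet> (q + z) \<noteq> b"
  shows "AE x in lborel. \<forall>(a, b)\<in>H. a \<bullet> (q + prj W x) \<noteq> b"
proof -
  have "AE x in lborel. a \<bullet> (q + prj W x) \<noteq> b" if ab: "(a, b) \<in> H" for a b
  proof -
    have sym: "a \<bullet> prj W x = prj W a \<bullet> x" for x
      by (metis W inner_prj inner_prj_left prj_in_perp)
    obtain z where z: "z \<in> perp W" "a \<bullet> (q + z) \<noteq> b" using proper[OF ab] by blast
    then have "prj W a \<noteq> 0 \<or> b - a \<bullet> q \<noteq> 0"
      by (metis add.right_neutral diff_eq_diff_eq diff_self inner_add_right inner_zero_left prj_id sym)
    then have "negligible {x. prj W a \<bullet> x = b - a \<bullet> q}" by (rule negligible_hyperplane)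
    then have "{x. prj W a \<bullet> x = b - a \<bullet> q} \<in> null_sets lebesgue" by (simp add: negligible_iff_null_sets)
    moreover have "{x. prj W a \<bullet> x = b - a \<bullet> q} \<in> sets lborel"
      using closed_hyperplane by (simp add: borel_closed)
    ultimately have "{x. prj W a \<bullet> x = b - a \<bullet> q} \<in> null_sets lborel"
      by (simp add: null_sets_completion_iff)
    then have "AE x in lborel. x \<notin> {x. prj W a \<bullet> x = b - a \<bullet> q}" by (rule AE_not_in)
    then show ?thesis by eventually_elim (auto simp: inner_add_right sym)
  qed
  then have "AE x in lborel. \<forall>h\<in>H. fst h \<bullet> (q + prj W x) \<noteq> snd h"
    using \<open>finite H\<close> by (intro AE_finite_allI) auto
  then show ?thesis by eventually_elim auto
qed

lemma AE_imp_dense: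
  fixes c :: "'a::euclidean_space"
  assumes "AE x in lborel. P x" "e > 0"
  shows "\<exists>x\<in>ball c e. P x"
proof (rule ccontr)
  assume "\<not> ?thesis"
  then have *: "ball c e \<subseteq> {x. \<not> P x}" by blast
  obtain N where N: "{x \<in> space lborel. \<not> P x} \<subseteq> N" "emeasure lborel N = 0" "N \<in> sets lborel"
    using assms(1) by (rule AE_E)
  then have "N \<in> null_sets lebesgue" by (simp add: null_sets_completionI null_setsI)
  then have "negligible N" by (simp add: negligible_iff_null_sets)
  moreover have "ball c e \<subseteq> N" using N(1) * by auto
  ultimately have "negligible (ball c e)" by (rule negligible_subset)
  then show False using open_not_negligible[of "ball c e"] assms(2) by simp
qed

lemma flat_generic_dense:
  fixes W :: "'a::euclidean_space set"
  assumes W: "orthonormal W" and "finite H" 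
    and proper: "\<And>a b. (a, b) \<in> H \<Longrightarrow> \<exists>z\<in>perp W. a \<bullet> (q + z) \<noteq> b"
    and x: "x \<in> (+) q ` perp W" "e > 0"
  shows "\<exists>z \<in> (+) q ` perp W. dist z x < e \<and> (\<forall>(a, b)\<in>H. a \<bullet> z \<noteq> b)"
proof -
  obtain y where y: "y \<in> perp W" "x = q + y" using x by blast
  obtain p where p: "p \<in> ball y e" "\<forall>(a, b)\<in>H. a \<bullet> (q + prj W p) \<noteq> b"
    using AE_imp_dense[OF AE_flat_generic[OF W \<open>finite H\<close> proper] x(2)] by blast
  have "dist (q + prj W p) x = norm (prj W (p - y))"
    by (simp add: y dist_norm prj_diff prj_id)
  also have "\<dots> \<le> norm (p - y)" by (rule norm_prj_le[OF W])
  also have "\<dots> < e" using p by (simp add: dist_norm norm_minus_commute)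
  finally show ?thesis using p prj_in_perp[OF W] by blast
qed

section \<open>Hyperplane arrangements and polytopes\<close>

text \<open>
  A pair \<open>(a, b)\<close> in \<open>H\<close> stands for the hyperplane \<open>{x. a \<bullet> x = b}\<close>, and a cell is named by the set \<open>\<sigma>\<close> of
  those pairs on whose positive side it lies.
\<close>

definition opencell :: "('a::euclidean_space \<times> real) set \<Rightarrow> ('a \<times> real) set \<Rightarrow> 'a set" where
  "opencell H \<sigma> = {x. \<forall>h\<in>H. if h \<in> \<sigma> then snd h < fst h \<bullet> x else fst h \<bullet> x < snd h}"

definition closedcell :: "('a::euclidean_space \<times> real) set \<Rightarrow> ('a \<times> real) set \<Rightarrow> 'a set" where
  "closedcell H \<sigma> = {x. \<forall>h\<in>H. if h \<in> \<sigma> then snd h \<le> fst h \<bullet> x else fst h \<bullet> x \<le> snd h}"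

definition signs :: "('a::euclidean_space \<times> real) set \<Rightarrow> 'a \<Rightarrow> ('a \<times> real) set" where
  "signs H x = {h \<in> H. snd h < fst h \<bullet> x}"

definition generic :: "('a::euclidean_space \<times> real) set \<Rightarrow> 'a \<Rightarrow> bool" where
  "generic H x \<longleftrightarrow> (\<forall>h\<in>H. fst h \<bullet> x \<noteq> snd h)"

lemma opencellD:
  "\<lbrakk>x \<in> opencell H \<sigma>; h \<in> H\<rbrakk> \<Longrightarrow> if h \<in> \<sigma> then snd h < fst h \<bullet> x else fst h \<bullet> x < snd h"
  unfolding opencell_def by (drule CollectD) (rule bspec)

lemma closedcellD:
  "\<lbrakk>x \<in> closedcell H \<sigma>; h \<in> H\<rbrakk> \<Longrightarrow> if h \<in> \<sigma> then snd h \<le> fst h \<bullet> x else fst h \<bullet> x \<le> snd h"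
  unfolding closedcell_def by (drule CollectD) (rule bspec)

lemma opencell_subset_closedcell: "opencell H \<sigma> \<subseteq> closedcell H \<sigma>"
proof
  fix x assume "x \<in> opencell H \<sigma>"
  then have "if h \<in> \<sigma> then snd h \<le> fst h \<bullet> x else fst h \<bullet> x \<le> snd h" if "h \<in> H" for h
    using opencellD[OF _ that, of x \<sigma>] by (simp split: if_splits)
  then show "x \<in> closedcell H \<sigma>" unfolding closedcell_def by (intro CollectI ballI)
qed

lemma opencell_Inter: 
  "opencell H \<sigma> = (\<Inter>h\<in>H. if h \<in> \<sigma> then {x. snd h < fst h \<bullet> x} else {x. fst h \<bullet> x < snd h})"
proof -
  have "(x \<in> (if h \<in> \<sigma> then {x. snd h < fst h \<bullet> x} else {x. fst h \<bullet> x < snd h})) = 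
      (if h \<in> \<sigma> then snd h < fst h \<bullet> x else fst h \<bullet> x < snd h)" for h x by simp
  note * = this
  show ?thesis unfolding opencell_def set_eq_iff INT_iff mem_Collect_eq * by (intro allI refl)
qed

lemma closedcell_Inter: 
  "closedcell H \<sigma> = (\<Inter>h\<in>H. if h \<in> \<sigma> then {x. snd h \<le> fst h \<bullet> x} else {x. fst h \<bullet> x \<le> snd h})"
proof -
  have "(x \<in> (if h \<in> \<sigma> then {x. snd h \<le> fst h \<bullet> x} else {x. fst h \<bullet> x \<le> snd h})) = 
      (if h \<in> \<sigma> then snd h \<le> fst h \<bullet> x else fst h \<bullet> x \<le> snd h)" for h x by simp
  note * = this
  show ?thesis unfolding closedcell_def set_eq_iff INT_iff mem_Collect_eq * by (intro allI refl)
qed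

lemma open_opencell: "finite H \<Longrightarrow> open (opencell H \<sigma>)"
  unfolding opencell_Inter by (auto simp: open_halfspace_lt open_halfspace_gt)

lemma convex_opencell: "convex (opencell H \<sigma>)"
  unfolding opencell_Inter by (intro convex_INT) (auto simp: convex_halfspace_gt convex_halfspace_lt)

lemma closed_closedcell: "closed (closedcell H \<sigma>)"
  unfolding closedcell_Inter by (intro closed_INT) (auto simp: closed_halfspace_ge closed_halfspace_le)

lemma polyhedron_closedcell: "finite H \<Longrightarrow> polyhedron (closedcell H \<sigma>)"
  unfolding closedcell_Inter 
  by (intro polyhedron_Inter) (auto simp: polyhedron_halfspace_ge polyhedron_halfspace_le)

lemma signs_opencell: "generic H x \<Longrightarrow> x \<in> opencell H (signs H x)"
  unfolding opencell_def
proof (intro CollectI ballI)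
  fix h assume "generic H x" "h \<in> H"
  then have "fst h \<bullet> x \<noteq> snd h" by (simp add: generic_def)
  with \<open>h \<in> H\<close> show "if h \<in> signs H x then snd h < fst h \<bullet> x else fst h \<bullet> x < snd h"
    by (auto simp: signs_def)
qed

lemma signs_subset: "signs H x \<subseteq> H"
  by (auto simp: signs_def)

lemma closedcell_signs: 
  assumes "generic H x" "x \<in> closedcell H \<sigma>" "\<sigma> \<subseteq> H" 
  shows "\<sigma> = signs H x"
proof (rule set_eqI)
  fix h show "h \<in> \<sigma> \<longleftrightarrow> h \<in> signs H x"
  proof (cases "h \<in> H")
    case True
    then have "fst h \<bullet> x \<noteq> snd h" using assms(1) by (simp add: generic_def)
    then show ?thesis using closedcellD[OF assms(2) True] True
      by (auto simp: signs_def split: if_splits)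
  qed (use assms(3) signs_subset in blast)
qed

lemma opencell_generic: "x \<in> opencell H \<sigma> \<Longrightarrow> generic H x"
  unfolding generic_def
proof
  fix h assume "x \<in> opencell H \<sigma>" "h \<in> H"
  from opencellD[OF this] show "fst h \<bullet> x \<noteq> snd h" by (simp split: if_splits)
qed

lemma opencell_signs: "\<lbrakk>x \<in> opencell H \<sigma>; \<sigma> \<subseteq> H\<rbrakk> \<Longrightarrow> \<sigma> = signs H x"
  using closedcell_signs opencell_generic opencell_subset_closedcell by blast

text \<open>
  A segment that starts at a point of the open cell stays in the open cell until its end point.
\<close>

lemma closedcell_subset_closure:
  assumes "convex U" "z \<in> opencell H \<sigma> \<inter> U" 
  shows "U \<inter> closedcell H \<sigma> \<subseteq> closure (opencell H \<sigma> \<inter> U)"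
proof
  fix x assume x: "x \<in> U \<inter> closedcell H \<sigma>"
  let ?f = "\<lambda>t::real. (1 - t) *\<^sub>R x + t *\<^sub>R z"
  have "?f t \<in> opencell H \<sigma> \<inter> U" if "0 < t" "t \<le> 1" for t
  proof
    show "?f t \<in> U" using assms x that by (simp add: convexD_alt)
    have "if h \<in> \<sigma> then snd h < fst h \<bullet> ?f t else fst h \<bullet> ?f t < snd h" if "h \<in> H" for h
    proof -
      have sp: "snd h = (1 - t) * snd h + t * snd h" by (simp add: algebra_simps)
      have ip: "fst h \<bullet> ?f t = (1 - t) * (fst h \<bullet> x) + t * (fst h \<bullet> z)" by (simp add: inner_add_right)
      show ?thesis
      proof (cases "h \<in> \<sigma>")
        case True
        then have "snd h \<le> fst h \<bullet> x" "snd h < fst h \<bullet> z"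
          using x assms(2) \<open>h \<in> H\<close> by (auto simp: closedcell_def opencell_def)
        then have "(1 - t) * snd h \<le> (1 - t) * (fst h \<bullet> x)" "t * snd h < t * (fst h \<bullet> z)"
          using \<open>0 < t\<close> \<open>t \<le> 1\<close> by (auto intro: mult_left_mono)
        then show ?thesis using True sp ip by simp
      next
        case False
        then have "fst h \<bullet> x \<le> snd h" "fst h \<bullet> z < snd h"
          using x assms(2) \<open>h \<in> H\<close> by (auto simp: closedcell_def opencell_def)
        then have "(1 - t) * (fst h \<bullet> x) \<le> (1 - t) * snd h" "t * (fst h \<bullet> z) < t * snd h"
          using \<open>0 < t\<close> \<open>t \<le> 1\<close> by (auto intro: mult_left_mono)
        then show ?thesis using False sp ip by simp
      qed
    qed
    then show "?f t \<in> opencell H \<sigma>" unfolding opencell_def by blast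
  qed
  then have "?f (1 / real (Suc n)) \<in> opencell H \<sigma> \<inter> U" for n by auto
  moreover have "(\<lambda>n. ?f (1 / real (Suc n))) \<longlonglongrightarrow> (1 - 0) *\<^sub>R x + 0 *\<^sub>R z"
    using LIMSEQ_Suc[OF lim_1_over_n] by (intro tendsto_intros) auto
  ultimately show "x \<in> closure (opencell H \<sigma> \<inter> U)"
    unfolding closure_sequential by (metis (no_types, lifting) add.right_neutral diff_zero scaleR_one scaleR_zero_left)
qed

lemma aff_dim_contains_open:
  fixes U :: "'a::euclidean_space set"
  assumes "affine U" "openin (top_of_set U) N" "N \<noteq> {}" "N \<subseteq> S" "S \<subseteq> U"
  shows "aff_dim S = aff_dim U"
proof -
  have "aff_dim N = aff_dim U"
    using aff_dim_openin[of U N] assms by (simp add: affine_hull_eq)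
  then show ?thesis using aff_dim_subset[OF assms(4)] aff_dim_subset[OF assms(5)] by simp
qed

lemma affine_hull_full:
  fixes U :: "'a::euclidean_space set"
  assumes "affine U" "S \<subseteq> U" "aff_dim S = aff_dim U"
  shows "affine hull S = U"
proof (cases "U = {}")
  case False
  have "affine hull S \<subseteq> U" using assms by (simp add: hull_minimal)
  moreover have "S \<noteq> {}" using assms(3) False by (metis aff_dim_empty)
  ultimately show ?thesis
    using affine_dim_equal[of "affine hull S" U] assms by (simp add: aff_dim_affine_hull)
qed (use assms in auto)

lemma polytope_in_affine_hull: "polytope_in U F \<Longrightarrow> affine hull F = U"
proof -
  assume "polytope_in U F"
  then obtain T where T: "affine U" "T \<noteq> {}" "\<And>S. S \<in> T \<Longrightarrow> aff_dim U simplex S \<and> S \<subseteq> U" "F = \<Union>T"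
    unfolding polytope_in_def by blast
  then obtain S where S: "S \<in> T" by blast
  have "aff_dim S = aff_dim U" using T(3)[OF S] aff_dim_simplex by blast
  then have "affine hull S = U" using affine_hull_full T S by blast
  moreover have "affine hull S \<subseteq> affine hull F" using S T(4) by (simp add: hull_mono Union_upper)
  moreover have "affine hull F \<subseteq> U" using T by (intro hull_minimal) auto
  ultimately show ?thesis by blast
qed

lemma polytope_in_compact: "polytope_in U F \<Longrightarrow> compact F"
  unfolding polytope_in_def by (auto intro!: compact_Union dest: compact_simplex)

text \<open>
  Each \<open>C\<close> is triangulated separately. Two simplices of one triangulation meet in a common face, so
  they coincide if they share a relatively open set.
\<close>

lemma polytope_in_Union:
  fixes U :: "'a::euclidean_space set"
  assumes U: "affine U" "U \<noteq> {}" and C: "finite \<C>" "\<C> \<noteq> {}" 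
    and poly: "\<And>C. C \<in> \<C> \<Longrightarrow> polytope C \<and> C \<subseteq> U \<and> aff_dim C = aff_dim U"
    and disj: "pairwise (\<lambda>S T. (top_of_set U interior_of S) \<inter> (top_of_set U interior_of T) = {}) \<C>"
  shows "polytope_in U (\<Union>\<C>)"
proof -
  have "\<exists>T. triangulation T \<and> (\<forall>k\<in>T. aff_dim k = aff_dim U) \<and> \<Union>T = C" if "C \<in> \<C>" for C
  proof (rule fine_triangular_subdivision_of_cell_complex[of 1 "{C}" "aff_dim U"])
    show "C1 \<inter> C2 face_of C1" if "C1 \<in> {C}" "C2 \<in> {C}" for C1 C2
      using that poly[OF \<open>C \<in> \<C>\<close>] polytope_imp_convex by (auto intro: face_of_refl)
  qed (use poly[OF that] in auto)
  then obtain T where T: "\<And>C. C \<in> \<C> \<Longrightarrow> triangulation (T C) \<and> (\<forall>k\<in>T C. aff_dim k = aff_dim U) \<and> \<Union>(T C) = C"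
    by metis
  let ?T = "\<Union>(T ` \<C>)"
  have un: "\<Union>?T = \<Union>\<C>"
  proof -
    have "\<Union>?T = (\<Union>C\<in>\<C>. \<Union>(T C))" by blast
    also have "\<dots> = (\<Union>C\<in>\<C>. C)" using T by (intro SUP_cong) auto
    finally show ?thesis by simp
  qed
  have simp: "aff_dim U simplex S \<and> S \<subseteq> U" if "S \<in> ?T" for S
  proof -
    obtain C where C: "C \<in> \<C>" "S \<in> T C" using \<open>S \<in> ?T\<close> by blast
    then obtain n where n: "n simplex S" using T[OF C(1)] unfolding triangulation_def by blast
    have "aff_dim S = aff_dim U" using T C by blast
    then have "aff_dim U simplex S" using n aff_dim_simplex[OF n] by simp
    moreover have "S \<subseteq> U" using C T poly by blast
    ultimately show ?thesis by blast
  qed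
  have disjT: "(top_of_set U interior_of S) \<inter> (top_of_set U interior_of S') = {}" 
    if S: "S \<in> ?T" "S' \<in> ?T" "S \<noteq> S'" for S S'
  proof (rule ccontr)
    let ?N = "(top_of_set U interior_of S) \<inter> (top_of_set U interior_of S')"
    assume ne: "?N \<noteq> {}"
    have op: "openin (top_of_set U) ?N" by (intro openin_Int openin_interior_of)
    obtain C where C: "C \<in> \<C>" "S \<in> T C" using S by blast
    obtain C' where C': "C' \<in> \<C>" "S' \<in> T C'" using S by blast
    have "S \<subseteq> C" "S' \<subseteq> C'" using T C C' by blast+
    then have "?N \<subseteq> (top_of_set U interior_of C) \<inter> (top_of_set U interior_of C')"
      using interior_of_mono by (metis inf_mono)
    then have "C = C'" using disj ne C(1) C'(1) unfolding pairwise_def by blast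
    then have fc: "S \<inter> S' face_of S" "S \<inter> S' face_of S'"
      using T C C' unfolding triangulation_def by (metis inf_commute)+
    have sub: "?N \<subseteq> S \<inter> S'" using interior_of_subset by fast
    have "aff_dim (S \<inter> S') = aff_dim U"
      by (rule aff_dim_contains_open[OF U(1) op ne sub]) (use simp S in blast)
    moreover have "aff_dim S = aff_dim U" "aff_dim S' = aff_dim U" "convex S" "convex S'"
      using simp S aff_dim_simplex convex_simplex by blast+
    ultimately have "S \<inter> S' = S" "S \<inter> S' = S'"
      using face_of_aff_dim_lt[OF _ fc(1)] face_of_aff_dim_lt[OF _ fc(2)] by auto
    then show False using S by blast
  qed
  have "finite (T C)" if "C \<in> \<C>" for C using T[OF that] by (simp add: triangulation_def)
  then have "finite ?T" using C(1) by (rule finite_UN_I[rotated])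
  moreover have "?T \<noteq> {}"
  proof
    assume "?T = {}"
    then have "\<Union>\<C> = {}" using un by simp
    moreover obtain C where "C \<in> \<C>" using C by blast
    ultimately have "C = {}" by blast
    then show False using poly[OF \<open>C \<in> \<C>\<close>] U by (metis aff_dim_empty)
  qed
  ultimately show ?thesis
    unfolding polytope_in_def pairwise_def
    by (intro conjI exI[of _ ?T] U ballI impI) (use simp disjT un[symmetric] in simp_all)
qed

text \<open>
  If two cells shared a relatively open set, this set would contain a generic point, and the signs of
  a generic point determine its cell.
\<close>

lemma polytope_in_closedcells:
  fixes W :: "'a::euclidean_space set"
  assumes W: "orthonormal W" and U: "U = (+) q ` perp W" and H: "finite H"
    and proper: "\<And>a b. (a, b) \<in> H \<Longrightarrow> \<exists>z\<in>perp W. a \<bullet> (q + z) \<noteq> b"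
    and S: "S \<subseteq> Pow H" "S \<noteq> {}" "\<And>\<sigma>. \<sigma> \<in> S \<Longrightarrow> opencell H \<sigma> \<inter> U \<noteq> {}"
    and bd: "bounded (U \<inter> \<Union>(closedcell H ` S))"
  shows "polytope_in U (U \<inter> \<Union>(closedcell H ` S))"
proof -
  have aff: "affine U" unfolding U using subspace_perp subspace_imp_affine affine_translation by blast
  let ?C = "(\<lambda>\<sigma>. U \<inter> closedcell H \<sigma>) ` S"
  have op: "openin (top_of_set U) (U \<inter> opencell H \<sigma>)" for \<sigma>
    using open_opencell[OF H] by (simp add: openin_open_Int)
  have "U \<noteq> {}" using U zero_in_perp by blast
  then have "polytope_in U (\<Union>?C)"
  proof (rule polytope_in_Union[OF aff])
    show "finite ?C" using S(1) H finite_subset by (metis finite_Pow_iff finite_imageI)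
    show "?C \<noteq> {}" using S by blast
    show "polytope C \<and> C \<subseteq> U \<and> aff_dim C = aff_dim U" if C: "C \<in> ?C" for C
    proof -
      obtain \<sigma> where \<sigma>: "\<sigma> \<in> S" "C = U \<inter> closedcell H \<sigma>" using C by blast
      have "polyhedron C" unfolding \<sigma> 
        using polyhedron_closedcell[OF H] affine_imp_polyhedron[OF aff] polyhedron_Int by blast
      moreover have "bounded C" using bd \<sigma> by (auto intro: bounded_subset)
      ultimately have "polytope C" by (simp add: polytope_eq_bounded_polyhedron)
      moreover have "aff_dim C = aff_dim U"
      proof (rule aff_dim_contains_open[OF aff op[of \<sigma>]])
        show "U \<inter> opencell H \<sigma> \<noteq> {}" using S(3)[OF \<sigma>(1)] by (simp add: Int_commute)
      qed (use \<sigma> opencell_subset_closedcell[of H \<sigma>] in auto)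
      ultimately show ?thesis using \<sigma> by blast
    qed
    show "pairwise (\<lambda>S T. (top_of_set U interior_of S) \<inter> (top_of_set U interior_of T) = {}) ?C"
    proof (clarsimp simp: pairwise_def)
      fix \<sigma> \<tau> assume st: "\<sigma> \<in> S" "\<tau> \<in> S" "U \<inter> closedcell H \<sigma> \<noteq> U \<inter> closedcell H \<tau>"
      let ?N = "(top_of_set U interior_of (U \<inter> closedcell H \<sigma>)) \<inter> (top_of_set U interior_of (U \<inter> closedcell H \<tau>))"
      show "?N = {}"
      proof (rule ccontr)
        assume "?N \<noteq> {}"
        then obtain x where x: "x \<in> ?N" by blast
        have "openin (top_of_set U) ?N" by (intro openin_Int openin_interior_of)
        then obtain e where e: "e > 0" "ball x e \<inter> U \<subseteq> ?N" "x \<in> U"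
          using x unfolding openin_contains_ball by blast
        obtain z where z: "z \<in> U" "dist z x < e" "\<forall>(a, b)\<in>H. a \<bullet> z \<noteq> b"
        using flat_generic_dense[OF W H proper, of x e] e(1,3) unfolding U by blast
        have gz: "generic H z" using z(3) by (auto simp: generic_def)
        have zN: "z \<in> ?N" using e z by (auto simp: dist_commute)
        have zc: "z \<in> closedcell H \<sigma>" "z \<in> closedcell H \<tau>"
          using zN interior_of_subset[of "top_of_set U" "U \<inter> closedcell H \<sigma>"]
            interior_of_subset[of "top_of_set U" "U \<inter> closedcell H \<tau>"] by auto
        have "\<sigma> \<subseteq> H" "\<tau> \<subseteq> H" using S(1) st by auto
        then have "\<sigma> = \<tau>" using closedcell_signs[OF gz zc(1)] closedcell_signs[OF gz zc(2)] by simp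
        then show False using st(3) by simp
      qed
    qed
  qed
  moreover have "\<Union>?C = U \<inter> \<Union>(closedcell H ` S)" by auto
  ultimately show ?thesis by (rule back_subst)
qed

text \<open>
  On the flat, the inequality \<open>a \<bullet> x \<le> b\<close> depends only on the component of \<open>a\<close> along the flat. If this
  component is zero, the inequality holds on the whole flat, because it holds at a point of \<open>S\<close>.
\<close>

lemma polyhedron_in_flat:
  fixes W :: "'a::euclidean_space set"
  assumes W: "orthonormal W" and q: "prj W q = 0" and S: "polyhedron S" "S \<noteq> {}" "S \<subseteq> (+) q ` perp W"
  shows "\<exists>H. finite H \<and> (\<forall>h\<in>H. fst h \<in> perp W \<and> fst h \<noteq> 0) \<and> 
             S = (+) q ` perp W \<inter> {x. \<forall>h\<in>H. fst h \<bullet> x \<le> snd h}"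
proof -
  obtain G where G: "finite G" "S = \<Inter>G" "\<And>h. h \<in> G \<Longrightarrow> \<exists>a b. a \<noteq> 0 \<and> h = {x. a \<bullet> x \<le> b}"
    using S(1) unfolding polyhedron_def by blast
  then obtain a b where ab: "\<And>h. h \<in> G \<Longrightarrow> h = {x. a h \<bullet> x \<le> b h}" by metis
  let ?H = "(\<lambda>h. (prj W (a h), b h - a h \<bullet> q)) ` {h \<in> G. prj W (a h) \<noteq> 0}"
  have ip: "a h \<bullet> (q + y) = a h \<bullet> q + prj W (a h) \<bullet> (q + y)" if "y \<in> perp W" for h y
  proof -
    have "a h \<bullet> y = prj W (a h) \<bullet> y" using inner_prj_left[OF that] by simp
    moreover have "prj W (a h) \<bullet> q = 0"
      using inner_prj[OF prj_in_perp[OF W], of "a h" q] q by simp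
    ultimately show ?thesis by (simp add: inner_add_right)
  qed
  obtain y0 where y0: "y0 \<in> perp W" "q + y0 \<in> S" using S by blast
  have "x \<in> S \<longleftrightarrow> (\<forall>h\<in>?H. fst h \<bullet> x \<le> snd h)" if "x \<in> (+) q ` perp W" for x
  proof -
    obtain y where y: "y \<in> perp W" "x = q + y" using \<open>x \<in> _\<close> by blast
    have "x \<in> h \<longleftrightarrow> (prj W (a h) \<noteq> 0 \<longrightarrow> prj W (a h) \<bullet> x \<le> b h - a h \<bullet> q)" if "h \<in> G" for h
    proof -
      have h: "h = {x. a h \<bullet> x \<le> b h}" using ab[OF that] .
      then have 1: "x \<in> h \<longleftrightarrow> a h \<bullet> x \<le> b h" for x by blast
      have "q + y0 \<in> h" using y0 G(2) that by blast
      then have "a h \<bullet> q + prj W (a h) \<bullet> (q + y0) \<le> b h" using 1 ip[OF y0(1)] by metis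
      then show ?thesis unfolding 1 y(2) ip[OF y(1)] by (auto simp: inner_add_right)
    qed
    then have "(\<forall>h\<in>G. x \<in> h) \<longleftrightarrow> (\<forall>h\<in>G. prj W (a h) \<noteq> 0 \<longrightarrow> prj W (a h) \<bullet> x \<le> b h - a h \<bullet> q)" 
      by blast
    then show ?thesis unfolding G(2) by auto
  qed
  then have "S = (+) q ` perp W \<inter> {x. \<forall>h\<in>?H. fst h \<bullet> x \<le> snd h}" using S(3) by blast
  moreover have "finite ?H" using G by simp
  moreover have "\<forall>h\<in>?H. fst h \<in> perp W \<and> fst h \<noteq> 0" using prj_in_perp[OF W] by auto
  ultimately show ?thesis by blast
qed

text \<open>
  The arrangement collects the hyperplanes from a representation of each simplex of \<open>F\<close> as an
  intersection of half-spaces, so an open cell is contained in a simplex as soon as it meets it. The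
  vector \<open>v\<close> is the direction in which \<open>F\<close> will be sliced. Scaling the normals to \<open>v \<bullet> a = 1\<close> makes a
  hyperplane that is not parallel to \<open>v\<close> the graph of \<open>b - a \<bullet> y\<close> over \<open>perp (insert v W)\<close> and leaves
  only one pair \<open>(a, b)\<close> for it.
\<close>

lemma polytope_in_imp_closedcells:
  fixes W :: "'a::euclidean_space set"
  assumes W: "orthonormal W" and q: "prj W q = 0" and U: "U = (+) q ` perp W"
    and F: "polytope_in U F"
  obtains H S where "finite H" 
    "\<And>a b. (a, b) \<in> H \<Longrightarrow> a \<in> perp W \<and> a \<noteq> 0 \<and> (v \<bullet> a = 0 \<or> v \<bullet> a = 1)"
    "S \<subseteq> Pow H" "S \<noteq> {}" "\<And>\<sigma>. \<sigma> \<in> S \<Longrightarrow> opencell H \<sigma> \<inter> U \<noteq> {}"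
    "F = U \<inter> \<Union>(closedcell H ` S)"
proof -
  obtain T where T: "affine U" "U \<noteq> {}" "finite T" "T \<noteq> {}" 
      "\<And>S. S \<in> T \<Longrightarrow> aff_dim U simplex S" "\<And>S. S \<in> T \<Longrightarrow> S \<subseteq> U" "F = \<Union>T"
    using F unfolding polytope_in_def by blast
  have dimS: "aff_dim S = aff_dim U" "convex S" if "S \<in> T" for S
    using aff_dim_simplex convex_simplex T(5)[OF that] by blast+
  have hullS: "affine hull S = U" if "S \<in> T" for S
    using affine_hull_full[OF T(1) T(6) dimS(1)] that by blast
  have neS: "S \<noteq> {}" if "S \<in> T" for S
    using hullS[OF that] T(2) by auto
  have "\<forall>S\<in>T. \<exists>H. finite H \<and> (\<forall>h\<in>H. fst h \<in> perp W \<and> fst h \<noteq> 0) \<and> 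
             S = U \<inter> {x. \<forall>h\<in>H. fst h \<bullet> x \<le> snd h}"
  proof
    fix S assume S: "S \<in> T"
    have "polyhedron S" using T(5)[OF S] simplex_imp_polyhedron by blast
    then show "\<exists>H. finite H \<and> (\<forall>h\<in>H. fst h \<in> perp W \<and> fst h \<noteq> 0) \<and> 
             S = U \<inter> {x. \<forall>h\<in>H. fst h \<bullet> x \<le> snd h}"
      using polyhedron_in_flat[OF W q _ neS[OF S]] T(6)[OF S] unfolding U by blast
  qed
  from bchoice[OF this] obtain G where G0: "\<forall>S\<in>T. finite (G S) \<and> (\<forall>h\<in>G S. fst h \<in> perp W \<and> fst h \<noteq> 0) \<and> 
             S = U \<inter> {x. \<forall>h\<in>G S. fst h \<bullet> x \<le> snd h}" ..
  have G: "finite (G S)" 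
      "h \<in> G S \<Longrightarrow> fst h \<in> perp W \<and> fst h \<noteq> 0"
      "x \<in> S \<longleftrightarrow> x \<in> U \<and> (\<forall>h\<in>G S. fst h \<bullet> x \<le> snd h)" if "S \<in> T" for S h x
  proof -
    note * = bspec[OF G0 that]
    show "finite (G S)" using * by (rule conjunct1)
    show "h \<in> G S \<Longrightarrow> fst h \<in> perp W \<and> fst h \<noteq> 0" using * by blast
    have "S = U \<inter> {x. \<forall>h\<in>G S. fst h \<bullet> x \<le> snd h}" using * by simp
    from eqset_imp_iff[OF this, of x]
    show "x \<in> S \<longleftrightarrow> x \<in> U \<and> (\<forall>h\<in>G S. fst h \<bullet> x \<le> snd h)" by simp
  qed
  define c where "c h = (if v \<bullet> fst h = 0 then 1 else v \<bullet> fst h)" for h :: "'a \<times> real"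
  \<comment> \<open>Dividing by a negative \<open>c h\<close> exchanges the two sides of the hyperplane.\<close>
  define nrm where "nrm h = (fst h /\<^sub>R c h, snd h / c h)" for h
  define H where "H = nrm ` \<Union>(G ` T)"
  have c: "c h \<noteq> 0" for h by (simp add: c_def)
  have nrm: "fst h \<bullet> x = c h * (fst (nrm h) \<bullet> x)" "snd h = c h * snd (nrm h)" for h x
    using c by (auto simp: nrm_def)
  have finH: "finite H" unfolding H_def using T(3) G(1) by blast
  have H: "a \<in> perp W \<and> a \<noteq> 0 \<and> (v \<bullet> a = 0 \<or> v \<bullet> a = 1)" if ab: "(a, b) \<in> H" for a b
  proof -
    obtain S h where h: "S \<in> T" "h \<in> G S" "(a, b) = nrm h" using ab unfolding H_def by blast
    then have "a = fst h /\<^sub>R c h" by (simp add: nrm_def)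
    then show ?thesis using G(2)[OF h(1,2)] c perp_scale by (auto simp: c_def)
  qed
  have transfer: "fst h \<bullet> x \<le> snd h" 
    if h: "S \<in> T" "h \<in> G S" and z: "z \<in> opencell H \<sigma>" "fst h \<bullet> z \<le> snd h" and x: "x \<in> closedcell H \<sigma>" 
    for S h z x \<sigma>
  proof -
    have hH: "nrm h \<in> H" using h unfolding H_def by blast
    have z': "if nrm h \<in> \<sigma> then snd (nrm h) < fst (nrm h) \<bullet> z else fst (nrm h) \<bullet> z < snd (nrm h)"
      using opencellD[OF z(1) hH] .
    have x': "if nrm h \<in> \<sigma> then snd (nrm h) \<le> fst (nrm h) \<bullet> x else fst (nrm h) \<bullet> x \<le> snd (nrm h)"
      using closedcellD[OF x hH] .
    note nz = nrm(1)[of h z] and nx = nrm(1)[of h x] and ns = nrm(2)[of h]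
    show ?thesis
    proof (cases "c h > 0")
      case True
      then have "fst (nrm h) \<bullet> z \<le> snd (nrm h)" using z(2) unfolding nz nx ns by simp
      then have "fst (nrm h) \<bullet> x \<le> snd (nrm h)" using z' x' by (metis not_less)
      then show ?thesis using True unfolding nz nx ns by simp
    next
      case False
      then have cn: "c h < 0" using c[of h] by simp
      then have "fst (nrm h) \<bullet> z \<ge> snd (nrm h)" using z(2) unfolding nz nx ns by (simp add: mult_le_cancel_left_neg)
      then have "fst (nrm h) \<bullet> x \<ge> snd (nrm h)" using z' x' by (metis not_less)
      then show ?thesis using cn unfolding nz nx ns by (simp add: mult_le_cancel_left_neg)
    qed
  qed
  define \<Sigma> where "\<Sigma> = {\<sigma> \<in> Pow H. \<exists>S\<in>T. opencell H \<sigma> \<inter> S \<noteq> {}}"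
  have fin\<Sigma>: "finite \<Sigma>" unfolding \<Sigma>_def using finH by auto
  have proper: "\<exists>z\<in>perp W. a \<bullet> (q + z) \<noteq> b" if "(a, b) \<in> H" for a b
  proof -
    have a: "a \<in> perp W" "a \<noteq> 0" using H[OF that] by auto
    then have "a \<bullet> (q + 0) \<noteq> b \<or> a \<bullet> (q + a) \<noteq> b" by (auto simp: inner_add_right)
    then show ?thesis using a zero_in_perp by blast
  qed
  have closedZ: "closed (\<Union>(closedcell H ` \<Sigma>))"
    using fin\<Sigma> closed_closedcell by blast
  have sub: "S \<subseteq> \<Union>(closedcell H ` \<Sigma>)" if S: "S \<in> T" for S
  proof (rule ccontr)
    assume "\<not> ?thesis"
    then obtain x where x: "x \<in> S" "x \<in> - \<Union>(closedcell H ` \<Sigma>)" by blast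
    then obtain e where e: "e > 0" "ball x e \<subseteq> - \<Union>(closedcell H ` \<Sigma>)"
      using closedZ open_contains_ball open_Compl by metis
    have "x \<in> closure (rel_interior S)" 
      using x(1) convex_closure_rel_interior[OF dimS(2)[OF S]] closure_subset by blast
    then obtain z where z: "z \<in> rel_interior S" "dist z x < e / 2"
      using e(1) unfolding closure_approachable by (meson half_gt_zero)
    obtain e' where e': "e' > 0" "ball z e' \<inter> U \<subseteq> S" "z \<in> S"
      using z(1) hullS[OF S] unfolding mem_rel_interior_ball by auto
    have "z \<in> (+) q ` perp W" using e'(3) T(6)[OF S] U by blast
    then obtain y where y: "y \<in> U" "dist y z < min (e / 2) e'" "\<forall>(a, b)\<in>H. a \<bullet> y \<noteq> b"
      using flat_generic_dense[OF W finH proper, of z "min (e / 2) e'"] e e' U by auto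
    have "y \<in> S" using y e' by (auto simp: dist_commute)
    moreover have "generic H y" using y by (auto simp: generic_def)
    ultimately have "signs H y \<in> \<Sigma>" "y \<in> closedcell H (signs H y)"
      using signs_opencell signs_subset S opencell_subset_closedcell unfolding \<Sigma>_def by blast+
    moreover have "y \<in> ball x e"
      using dist_triangle[of x y z] y(2) z(2) by (simp add: dist_commute)
    ultimately show False using e(2) by blast
  qed
  have eq: "F = U \<inter> \<Union>(closedcell H ` \<Sigma>)"
  proof
    show "F \<subseteq> U \<inter> \<Union>(closedcell H ` \<Sigma>)" using sub T by blast
    show "U \<inter> \<Union>(closedcell H ` \<Sigma>) \<subseteq> F"
    proof
      fix x assume "x \<in> U \<inter> \<Union>(closedcell H ` \<Sigma>)"
      then obtain \<sigma> where s: "\<sigma> \<in> \<Sigma>" "x \<in> closedcell H \<sigma>" "x \<in> U" by blast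
      then obtain S z where S: "S \<in> T" "z \<in> opencell H \<sigma>" "z \<in> S" unfolding \<Sigma>_def by blast
      have "fst h \<bullet> x \<le> snd h" if "h \<in> G S" for h
        using transfer[OF S(1) that S(2) _ s(2)] G(3)[OF S(1)] S(3) that by blast
      then have "x \<in> S" using G(3)[OF S(1)] s(3) by blast
      then show "x \<in> F" using T(7) S(1) by blast
    qed
  qed
  have ne: "\<Sigma> \<noteq> {}"
  proof -
    obtain S where "S \<in> T" using T by blast
    then show ?thesis using sub neS by blast
  qed
  have "opencell H \<sigma> \<inter> U \<noteq> {}" if "\<sigma> \<in> \<Sigma>" for \<sigma>
    using that T(6) unfolding \<Sigma>_def by blast
  moreover have "\<Sigma> \<subseteq> Pow H" unfolding \<Sigma>_def by blast
  ultimately show thesis by (intro that[OF finH H _ ne _ eq])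
qed

section \<open>Facets with a prescribed direction\<close>

lemma mem_translate: "x \<in> (+) a ` S \<longleftrightarrow> x - a \<in> S" for a :: "'a::ab_group_add"
proof
  assume "x - a \<in> S"
  then have "a + (x - a) \<in> (+) a ` S" by (rule imageI)
  then show "x \<in> (+) a ` S" by simp
qed auto

text \<open>
  A polytope \<open>F\<close> in the flat \<open>U\<close>, written as a union of closed cells, together with a unit vector \<open>v\<close>
  along the flat. The point \<open>q\<close> is the one at which the flat meets the span of \<open>W\<close>.
\<close>

locale cellular =
  fixes W :: "'a::euclidean_space set" and v q :: 'a and U F :: "'a set" 
    and H :: "('a \<times> real) set" and \<Sigma> :: "('a \<times> real) set set"
  assumes W: "orthonormal (insert v W)" "v \<notin> W" and q: "prj W q = 0" and U: "U = (+) q ` perp W"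
    and F: "polytope_in U F" and finH: "finite H"
    and H: "\<And>a b. (a, b) \<in> H \<Longrightarrow> a \<in> perp W \<and> a \<noteq> 0 \<and> (v \<bullet> a = 0 \<or> v \<bullet> a = 1)"
    and \<Sigma>: "\<Sigma> \<subseteq> Pow H" "\<And>\<sigma>. \<sigma> \<in> \<Sigma> \<Longrightarrow> opencell H \<sigma> \<inter> U \<noteq> {}"
    and F_eq: "F = U \<inter> \<Union>(closedcell H ` \<Sigma>)"
begin

definition W' where "W' = insert v W"
definition hyp where "hyp s = {x \<in> U. v \<bullet> x = s}"
definition K where "K s \<epsilon> = {x \<in> U. \<epsilon> * (v \<bullet> x - s) \<ge> (0::real)}"
text \<open>
  The relative interior of the facet in \<open>hyp s\<close> that \<open>F\<close> adjoins from the side \<open>K s \<epsilon>\<close>, in the sense that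
  the closure of this set is the facet; \<open>\<epsilon>\<close> is \<open>1\<close> or \<open>- 1\<close>.
\<close>

definition D where
  "D s \<epsilon> = {x \<in> hyp s. \<exists>N. openin (top_of_set U) N \<and> x \<in> N \<and> F \<inter> N = K s \<epsilon> \<inter> N}"
definition H' where "H' s = H - {(v, s)}"
text \<open>
  Let \<open>x\<close> be a point of \<open>hyp s\<close> that lies on no other hyperplane of \<open>H\<close>. These predicates tell
  whether \<open>F\<close> contains the cells that touch \<open>x\<close> from above and from below. If \<open>hyp s\<close> does not come from
  \<open>H\<close>, they refer to the same cell.
\<close>

definition above where "above s x \<longleftrightarrow> (if (v, s) \<in> H then insert (v, s) (signs (H' s) x) \<in> \<Sigma> else signs (H' s) x \<in> \<Sigma>)"
definition below where "below s x \<longleftrightarrow> signs (H' s) x \<in> \<Sigma>"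

lemma onW: "orthonormal W" and onW': "orthonormal W'" and vv: "v \<bullet> v = 1" and nv: "norm v = 1"
  and vW: "v \<in> perp W"
  using W orthonormal_insertD[OF W(1)] orthonormal_insert_perp[OF W] by (auto simp: W'_def)

lemma perp_q: "a \<in> perp W \<Longrightarrow> a \<bullet> q = 0"
  using inner_prj[of a W q] q by simp

lemma affU: "affine U"
  unfolding U using subspace_perp subspace_imp_affine affine_translation by blast

lemma U_iff: "x \<in> U \<longleftrightarrow> x - q \<in> perp W"
  unfolding U by (rule mem_translate)

lemma U_add: "\<lbrakk>x \<in> U; y \<in> perp W\<rbrakk> \<Longrightarrow> x + y \<in> U"
  unfolding U_iff using perp_add by (metis add_diff_eq add.commute)

lemma U_shift: "x \<in> U \<Longrightarrow> x + c *\<^sub>R v \<in> U"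
  using U_add perp_scale vW by blast

lemma perp_W': "perp W' = {y \<in> perp W. v \<bullet> y = 0}"
  by (simp add: W'_def perp_insert)

lemma prj_W': "prj W' x = prj W x - (v \<bullet> x) *\<^sub>R v"
  unfolding W'_def using prj_insert[OF W] .

lemma vq: "v \<bullet> q = 0" using perp_q vW by blast

lemma hyp_eq: "hyp s = (+) (q + s *\<^sub>R v) ` perp W'"
proof (rule set_eqI)
  fix x
  have "x - q \<in> perp W \<and> v \<bullet> x = s \<longleftrightarrow> x - (q + s *\<^sub>R v) \<in> perp W'"
  proof -
    have 1: "x - (q + s *\<^sub>R v) = (x - q) - s *\<^sub>R v" by simp
    have 2: "x - q \<in> perp W \<longleftrightarrow> (x - q) - s *\<^sub>R v \<in> perp W"
      using perp_diff[OF _ perp_scale[OF vW], of "x - q" s] 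
        perp_add[OF _ perp_scale[OF vW], of "(x - q) - s *\<^sub>R v" s] by auto
    show ?thesis unfolding perp_W' 1 using 2 by (auto simp: inner_diff_right vv vq)
  qed
  then show "x \<in> hyp s \<longleftrightarrow> x \<in> (+) (q + s *\<^sub>R v) ` perp W'"
    unfolding hyp_def mem_Collect_eq U_iff mem_translate .
qed

lemma hyp_translate: assumes "u \<in> U" shows "(+) u ` perp W' = hyp (v \<bullet> u)"
proof (rule set_eqI)
  fix x
  have "x - u \<in> perp W \<longleftrightarrow> x \<in> U"
    using assms U_add[of u "x - u"] perp_diff[of "x - q" W "u - q"] by (auto simp: U_iff)
  then have "x - u \<in> perp W' \<longleftrightarrow> x \<in> hyp (v \<bullet> u)"
    by (auto simp: perp_W' hyp_def inner_diff_right)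
  then show "x \<in> (+) u ` perp W' \<longleftrightarrow> x \<in> hyp (v \<bullet> u)"
    unfolding mem_translate .
qed

lemma prj_hyp: "prj W' (q + s *\<^sub>R v) = 0"
  by (simp add: prj_W' prj_add prj_scale q prj_id[OF vW] inner_add_right vq vv)

lemma hyp_sub: "hyp s \<subseteq> U" by (auto simp: hyp_def)

lemma hyp_ne: "hyp s \<noteq> {}" unfolding hyp_eq using zero_in_perp by blast

lemma hyp_Int: "hyp s = U \<inter> {x. v \<bullet> x = s}" by (auto simp: hyp_def)

lemma aff_hyp: "affine (hyp s)" unfolding hyp_Int using affU affine_hyperplane affine_Int by blast

lemma closed_hyp: "closed (hyp s)" using aff_hyp affine_closed by blast

lemma aff_dim_hyp: "aff_dim U = aff_dim (hyp s) + 1"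
proof -
  obtain x where x: "x \<in> hyp s" using hyp_ne by blast
  then have "x + 1 *\<^sub>R v \<in> U" "v \<bullet> (x + 1 *\<^sub>R v) \<noteq> s"
    using U_shift[of x 1] by (auto simp: hyp_def inner_add_right vv)
  then have "\<not> U \<subseteq> {x. v \<bullet> x = s}" by blast
  then show ?thesis using aff_dim_affine_Int_hyperplane[OF affU, of v s] hyp_ne[of s]
    by (simp add: hyp_Int)
qed

lemma halfspace_K: "\<bar>\<epsilon>\<bar> = 1 \<Longrightarrow> halfspace_in U (hyp s) (K s \<epsilon>)"
  unfolding halfspace_in_def
proof (intro conjI exI[of _ "\<epsilon> *\<^sub>R v"] exI[of _ "\<epsilon> * s"])
  assume e: "\<bar>\<epsilon>\<bar> = 1"
  then show "hyp s = {x \<in> U. (\<epsilon> *\<^sub>R v) \<bullet> x = \<epsilon> * s}" by (auto simp: hyp_def)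
  show "K s \<epsilon> = {x \<in> U. (\<epsilon> *\<^sub>R v) \<bullet> x \<ge> \<epsilon> * s}" by (auto simp: K_def algebra_simps)
qed (auto simp: aff_hyp hyp_sub aff_dim_hyp)

lemma generic_decompose: 
  "generic (H' s) x \<Longrightarrow> v \<bullet> x \<noteq> s \<Longrightarrow> generic H x"
  by (auto simp: generic_def H'_def)

lemma mem_F_generic: "\<lbrakk>generic H y; y \<in> U\<rbrakk> \<Longrightarrow> y \<in> F \<longleftrightarrow> signs H y \<in> \<Sigma>"
proof
  assume g: "generic H y" "y \<in> U"
  show "y \<in> F \<Longrightarrow> signs H y \<in> \<Sigma>"
    using closedcell_signs[OF g(1)] \<Sigma>(1) unfolding F_eq by blast
  show "signs H y \<in> \<Sigma> \<Longrightarrow> y \<in> F"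
    using signs_opencell[OF g(1)] g opencell_subset_closedcell unfolding F_eq by blast
qed

lemma signs_split: "signs H y = signs (H' s) y \<union> (if (v, s) \<in> H \<and> s < v \<bullet> y then {(v, s)} else {})"
  by (auto simp: signs_def H'_def)

lemma closedcell_split:
  assumes "generic (H' s) y" "v \<bullet> y = s" "(v, s) \<in> H" "\<sigma> \<subseteq> H"
  shows "y \<in> closedcell H \<sigma> \<longleftrightarrow> \<sigma> - {(v, s)} = signs (H' s) y"
proof
  assume y: "y \<in> closedcell H \<sigma>"
  have "if h \<in> \<sigma> - {(v, s)} then snd h \<le> fst h \<bullet> y else fst h \<bullet> y \<le> snd h" if "h \<in> H' s" for h
    using closedcellD[OF y, of h] that by (simp add: H'_def)
  then have "y \<in> closedcell (H' s) (\<sigma> - {(v, s)})"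
    unfolding closedcell_def by (intro CollectI ballI)
  then show "\<sigma> - {(v, s)} = signs (H' s) y"
    using closedcell_signs[OF assms(1)] assms(4) unfolding H'_def by blast
next
  assume eq: "\<sigma> - {(v, s)} = signs (H' s) y"
  have "if h \<in> \<sigma> then snd h \<le> fst h \<bullet> y else fst h \<bullet> y \<le> snd h" if "h \<in> H" for h
  proof (cases "h = (v, s)")
    case False
    then have "h \<in> H' s" "h \<in> \<sigma> \<longleftrightarrow> h \<in> signs (H' s) y" using that eq by (auto simp: H'_def)
    then show ?thesis by (auto simp: signs_def)
  qed (use assms in simp)
  then show "y \<in> closedcell H \<sigma>" unfolding closedcell_def by (intro CollectI ballI)
qed

lemma mem_F_on_hyp:
  assumes "generic (H' s) y" "y \<in> U" "v \<bullet> y = s"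
  shows "y \<in> F \<longleftrightarrow> above s y \<or> below s y"
proof (cases "(v, s) \<in> H")
  case True
  have "y \<in> F \<longleftrightarrow> (\<exists>\<sigma>\<in>\<Sigma>. y \<in> closedcell H \<sigma>)" using assms(2) unfolding F_eq by simp
  also have "\<dots> \<longleftrightarrow> (\<exists>\<sigma>\<in>\<Sigma>. \<sigma> - {(v, s)} = signs (H' s) y)"
    by (intro bex_cong refl closedcell_split[OF assms(1,3) True]) (use \<Sigma>(1) in blast)
  also have "\<dots> \<longleftrightarrow> insert (v, s) (signs (H' s) y) \<in> \<Sigma> \<or> signs (H' s) y \<in> \<Sigma>"
  proof -
    have "(v, s) \<notin> signs (H' s) y" by (auto simp: signs_def H'_def)
    then have "\<sigma> - {(v, s)} = signs (H' s) y \<longleftrightarrow> \<sigma> = insert (v, s) (signs (H' s) y) \<or> \<sigma> = signs (H' s) y" for \<sigma>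
      by auto
    then show ?thesis by (simp add: bex_disj_distrib)
  qed
  finally show ?thesis using True by (simp add: above_def below_def)
next
  case False
  then have "H' s = H" by (auto simp: H'_def)
  then show ?thesis using assms False mem_F_generic by (simp add: above_def below_def)
qed

lemma mem_F_off_hyp:
  assumes "generic (H' s) y" "y \<in> U" "v \<bullet> y \<noteq> s"
  shows "y \<in> F \<longleftrightarrow> (if s < v \<bullet> y then above s y else below s y)"
  using mem_F_generic[OF generic_decompose[OF assms(1,3)] assms(2)] signs_split[of y s]
  by (auto simp: above_def below_def)

lemma signs_locally_constant:
  assumes "finite G" "generic G x"
  obtains e where "e > 0" "\<And>y. dist y x < e \<Longrightarrow> generic G y \<and> signs G y = signs G x"
proof -
  have "open (opencell G (signs G x))" "x \<in> opencell G (signs G x)"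
    using open_opencell assms signs_opencell by blast+
  then obtain e where e: "e > 0" "ball x e \<subseteq> opencell G (signs G x)"
    using open_contains_ball by blast
  have "generic G y \<and> signs G y = signs G x" if "dist y x < e" for y
  proof -
    have "y \<in> opencell G (signs G x)" using that e by (auto simp: dist_commute)
    then show ?thesis using opencell_signs[OF _ signs_subset] opencell_generic by metis
  qed
  then show thesis using that e by blast
qed

text \<open>
  Near \<open>x\<close> only \<open>hyp s\<close> separates cells, so \<open>F\<close> consists of those of the two half-spaces at \<open>hyp s\<close> whose
  cells belong to \<open>\<Sigma>\<close>.
\<close>

lemma F_local:
  assumes "x \<in> hyp s" "generic (H' s) x"
  obtains e where "e > 0" "\<And>y. y \<in> U \<Longrightarrow> dist y x < e \<Longrightarrow> 
     y \<in> F \<longleftrightarrow> (s \<le> v \<bullet> y \<and> above s x) \<or> (v \<bullet> y \<le> s \<and> below s x)"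
proof -
  have "finite (H' s)" using finH by (simp add: H'_def)
  then obtain e where e: "e > 0" "\<And>y. dist y x < e \<Longrightarrow> generic (H' s) y \<and> signs (H' s) y = signs (H' s) x"
    using signs_locally_constant[OF _ assms(2)] by blast
  have "y \<in> F \<longleftrightarrow> (s \<le> v \<bullet> y \<and> above s x) \<or> (v \<bullet> y \<le> s \<and> below s x)"
    if y: "y \<in> U" "dist y x < e" for y
  proof -
    have g: "generic (H' s) y" and sg: "signs (H' s) y = signs (H' s) x" using e(2)[OF y(2)] by auto
    then have ab: "above s y \<longleftrightarrow> above s x" "below s y \<longleftrightarrow> below s x" by (auto simp: above_def below_def)
    show ?thesis
      using mem_F_on_hyp[OF g y(1)] mem_F_off_hyp[OF g y(1)] unfolding ab
      by (cases "v \<bullet> y" s rule: linorder_cases) auto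
  qed
  then show thesis using that e by blast
qed

lemma D_ball:
  "x \<in> D s \<epsilon> \<longleftrightarrow> x \<in> hyp s \<and> (\<exists>e>0. \<forall>y\<in>U. dist y x < e \<longrightarrow> (y \<in> F \<longleftrightarrow> 0 \<le> \<epsilon> * (v \<bullet> y - s)))"
proof
  assume "x \<in> D s \<epsilon>"
  then obtain N where N: "x \<in> hyp s" "openin (top_of_set U) N" "x \<in> N" "F \<inter> N = K s \<epsilon> \<inter> N"
    unfolding D_def by blast
  then obtain e where e: "e > 0" "ball x e \<inter> U \<subseteq> N" unfolding openin_contains_ball by blast
  have "y \<in> F \<longleftrightarrow> 0 \<le> \<epsilon> * (v \<bullet> y - s)" if "y \<in> U" "dist y x < e" for y
  proof -
    have "y \<in> N" using that e by (auto simp: dist_commute)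
    then have "y \<in> F \<longleftrightarrow> y \<in> K s \<epsilon>" using N(4) by blast
    then show ?thesis using that by (simp add: K_def)
  qed
  then show "x \<in> hyp s \<and> (\<exists>e>0. \<forall>y\<in>U. dist y x < e \<longrightarrow> (y \<in> F \<longleftrightarrow> 0 \<le> \<epsilon> * (v \<bullet> y - s)))"
    using N(1) e(1) by blast
next
  assume "x \<in> hyp s \<and> (\<exists>e>0. \<forall>y\<in>U. dist y x < e \<longrightarrow> (y \<in> F \<longleftrightarrow> 0 \<le> \<epsilon> * (v \<bullet> y - s)))"
  then obtain e where e: "x \<in> hyp s" "e > 0" "\<And>y. y \<in> U \<Longrightarrow> dist y x < e \<Longrightarrow> y \<in> F \<longleftrightarrow> 0 \<le> \<epsilon> * (v \<bullet> y - s)"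
    by blast
  have "F \<inter> (U \<inter> ball x e) = K s \<epsilon> \<inter> (U \<inter> ball x e)"
    using e(3) by (auto simp: K_def dist_commute)
  moreover have "openin (top_of_set U) (U \<inter> ball x e)" by (simp add: openin_open_Int)
  moreover have "x \<in> U \<inter> ball x e" using e hyp_sub by auto
  ultimately show "x \<in> D s \<epsilon>" unfolding D_def using e(1) by blast
qed

lemma D_sub_hyp: "D s \<epsilon> \<subseteq> hyp s" by (auto simp: D_def)

lemma D_sub_F: "D s \<epsilon> \<subseteq> F"
proof
  fix x assume "x \<in> D s \<epsilon>"
  then have "x \<in> hyp s" "\<exists>e>0. \<forall>y\<in>U. dist y x < e \<longrightarrow> (y \<in> F \<longleftrightarrow> 0 \<le> \<epsilon> * (v \<bullet> y - s))"
    unfolding D_ball by auto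
  then show "x \<in> F" by (auto simp: hyp_def)
qed

lemma D_open:
  assumes "x \<in> D s \<epsilon>" obtains e where "e > 0" "\<And>y. y \<in> hyp s \<Longrightarrow> dist y x < e \<Longrightarrow> y \<in> D s \<epsilon>"
proof -
  obtain e where e: "e > 0" "\<And>y. y \<in> U \<Longrightarrow> dist y x < e \<Longrightarrow> y \<in> F \<longleftrightarrow> 0 \<le> \<epsilon> * (v \<bullet> y - s)"
    using assms unfolding D_ball by blast
  have "y \<in> D s \<epsilon>" if y: "y \<in> hyp s" "dist y x < e / 2" for y
  proof -
    have "z \<in> F \<longleftrightarrow> 0 \<le> \<epsilon> * (v \<bullet> z - s)" if "z \<in> U" "dist z y < e / 2" for z
      using e(2)[OF that(1)] y(2) that(2) dist_triangle_half_r[of y z e x] by (simp add: dist_commute)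
    then show ?thesis unfolding D_ball using y(1) e(1) by (meson half_gt_zero)
  qed
  then show thesis using that e(1) by (meson half_gt_zero)
qed

text \<open>
  The points \<open>x + c *\<^sub>R v\<close> and \<open>x - c *\<^sub>R v\<close> with small \<open>c\<close> show on which sides of \<open>hyp s\<close> the polytope lies.
\<close>

lemma D_iff:
  assumes x: "x \<in> hyp s" and g: "generic (H' s) x" and \<epsilon>: "\<epsilon> = 1 \<or> \<epsilon> = - 1"
  shows "x \<in> D s \<epsilon> \<longleftrightarrow> (if \<epsilon> = 1 then above s x \<and> \<not> below s x else below s x \<and> \<not> above s x)"
proof -
  obtain e where e: "e > 0" "\<And>y. y \<in> U \<Longrightarrow> dist y x < e \<Longrightarrow> 
     y \<in> F \<longleftrightarrow> (s \<le> v \<bullet> y \<and> above s x) \<or> (v \<bullet> y \<le> s \<and> below s x)"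
    using F_local[OF x g] by blast
  have xs: "x \<in> U" "v \<bullet> x = s" using x by (auto simp: hyp_def)
  show ?thesis
  proof
    assume "x \<in> D s \<epsilon>"
    then obtain e' where e': "e' > 0" "\<And>y. y \<in> U \<Longrightarrow> dist y x < e' \<Longrightarrow> y \<in> F \<longleftrightarrow> 0 \<le> \<epsilon> * (v \<bullet> y - s)"
      unfolding D_ball by blast
    define c where "c = min e e' / 2"
    have c: "c > 0" "c < e" "c < e'" using e(1) e'(1) by (auto simp: c_def)
    have y: "x + c *\<^sub>R v \<in> U" "dist (x + c *\<^sub>R v) x < e" "dist (x + c *\<^sub>R v) x < e'"
        "v \<bullet> (x + c *\<^sub>R v) = s + c"
      using c U_shift[OF xs(1)] xs nv vv by (auto simp: dist_norm inner_add_right)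
    have z: "x + (- c) *\<^sub>R v \<in> U" "dist (x + (- c) *\<^sub>R v) x < e" "dist (x + (- c) *\<^sub>R v) x < e'"
        "v \<bullet> (x + (- c) *\<^sub>R v) = s - c"
      using c U_shift[OF xs(1), of "- c"] xs nv vv by (auto simp: dist_norm inner_diff_right)
    have "above s x \<longleftrightarrow> 0 \<le> \<epsilon> * c"
      using e(2)[OF y(1,2)] e'(2)[OF y(1,3)] c unfolding y(4) by auto
    moreover have "below s x \<longleftrightarrow> 0 \<le> \<epsilon> * (- c)"
      using e(2)[OF z(1,2)] e'(2)[OF z(1,3)] c unfolding z(4) by auto
    ultimately show "if \<epsilon> = 1 then above s x \<and> \<not> below s x else below s x \<and> \<not> above s x"
      using \<epsilon> c by auto
  next
    assume *: "if \<epsilon> = 1 then above s x \<and> \<not> below s x else below s x \<and> \<not> above s x"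
    have "y \<in> F \<longleftrightarrow> 0 \<le> \<epsilon> * (v \<bullet> y - s)" if "y \<in> U" "dist y x < e" for y
      using e(2)[OF that] * \<epsilon> by (auto split: if_splits)
    then show "x \<in> D s \<epsilon>" unfolding D_ball using x e(1) by blast
  qed
qed

text \<open>
  By the normalisation of the normals, \<open>(v, s)\<close> is the only pair in \<open>H\<close> whose hyperplane contains
  \<open>hyp s\<close>.
\<close>

lemma proper_H': 
  assumes "(a, b) \<in> H' s" shows "\<exists>z\<in>perp W'. a \<bullet> ((q + s *\<^sub>R v) + z) \<noteq> b"
proof -
  have ab: "(a, b) \<in> H" "(a, b) \<noteq> (v, s)" using assms by (auto simp: H'_def)
  then have a: "a \<in> perp W" "a \<noteq> 0" "v \<bullet> a = 0 \<or> v \<bullet> a = 1" using H by auto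
  define a' where "a' = a - (v \<bullet> a) *\<^sub>R v"
  have a': "a' \<in> perp W'" unfolding perp_W' a'_def using a vW perp_diff perp_scale 
    by (auto simp: inner_diff_right vv)
  show ?thesis
  proof (cases "a' = 0")
    case True
    then have "a = (v \<bullet> a) *\<^sub>R v" by (simp add: a'_def)
    then have "v \<bullet> a = 1" "a = v" using a by auto
    then have "a \<bullet> ((q + s *\<^sub>R v) + 0) \<noteq> b" using ab by (auto simp: inner_add_right vq vv)
    then show ?thesis using zero_in_perp by blast
  next
    case False
    have "a \<bullet> a' = a' \<bullet> a'"
      using a' unfolding perp_W' by (simp add: a'_def inner_diff_left inner_diff_right vv inner_commute)
    then have "a \<bullet> a' \<noteq> 0" using False by simp
    then have "a \<bullet> ((q + s *\<^sub>R v) + 0) \<noteq> b \<or> a \<bullet> ((q + s *\<^sub>R v) + a') \<noteq> b"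
      by (auto simp: inner_add_right)
    then show ?thesis using a' zero_in_perp by blast
  qed
qed

lemma finH': "finite (H' s)" using finH by (simp add: H'_def)

lemma hyp_generic_dense:
  assumes "x \<in> hyp s" "e > 0" obtains z where "z \<in> hyp s" "dist z x < e" "generic (H' s) z"
proof -
  have "\<exists>z \<in> (+) (q + s *\<^sub>R v) ` perp W'. dist z x < e \<and> (\<forall>(a, b)\<in>H' s. a \<bullet> z \<noteq> b)"
    by (rule flat_generic_dense[OF onW' finH' proper_H']) (use assms in \<open>simp_all add: hyp_eq\<close>)
  then obtain z where "z \<in> hyp s" "dist z x < e" "\<forall>(a, b)\<in>H' s. a \<bullet> z \<noteq> b"
    unfolding hyp_eq by blast
  then have "generic (H' s) z" unfolding generic_def by auto
  then show thesis using that \<open>z \<in> hyp s\<close> \<open>dist z x < e\<close> by blast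
qed

lemma D_generic_point:
  assumes "x \<in> D s \<epsilon>" "e > 0" obtains z where "z \<in> D s \<epsilon>" "generic (H' s) z" "dist z x < e"
proof -
  obtain e' where e': "e' > 0" "\<And>y. y \<in> hyp s \<Longrightarrow> dist y x < e' \<Longrightarrow> y \<in> D s \<epsilon>"
    using D_open[OF assms(1)] by blast
  obtain z where "z \<in> hyp s" "dist z x < min e e'" "generic (H' s) z"
  proof (rule hyp_generic_dense)
    show "x \<in> hyp s" using assms(1) D_sub_hyp by blast
    show "0 < min e e'" using assms(2) e'(1) by simp
  qed
  then show thesis using that e'(2)[of z] by simp
qed

lemma D_cell:
  assumes "x \<in> D s \<epsilon>" "generic (H' s) x" "y \<in> hyp s" "generic (H' s) y" "signs (H' s) y = signs (H' s) x"
    and \<epsilon>: "\<epsilon> = 1 \<or> \<epsilon> = - 1"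
  shows "y \<in> D s \<epsilon>"
proof -
  have "x \<in> hyp s" using assms D_sub_hyp by blast
  note D_iff[OF this assms(2) \<epsilon>]
  moreover have "above s y = above s x" "below s y = below s x"
    using assms(5) by (auto simp: above_def below_def)
  ultimately show ?thesis using D_iff[OF assms(3,4) \<epsilon>] assms(1) by simp
qed

definition \<Sigma>' where "\<Sigma>' s \<epsilon> = {\<tau> \<in> Pow (H' s). opencell (H' s) \<tau> \<inter> D s \<epsilon> \<noteq> {}}"

lemma opencell_sub_D:
  assumes "\<tau> \<in> \<Sigma>' s \<epsilon>" and \<epsilon>: "\<epsilon> = 1 \<or> \<epsilon> = - 1"
  shows "opencell (H' s) \<tau> \<inter> hyp s \<subseteq> D s \<epsilon>"
proof
  fix y assume y: "y \<in> opencell (H' s) \<tau> \<inter> hyp s"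
  obtain x where x: "x \<in> opencell (H' s) \<tau>" "x \<in> D s \<epsilon>" and \<tau>: "\<tau> \<subseteq> H' s"
    using assms(1) unfolding \<Sigma>'_def by blast
  have gx: "generic (H' s) x" and gy: "generic (H' s) y" using x y opencell_generic by blast+
  have "signs (H' s) y = signs (H' s) x" using opencell_signs[OF _ \<tau>] x y by (metis IntD1)
  then show "y \<in> D s \<epsilon>" using D_cell x gx gy y \<epsilon> by blast
qed

text \<open>
  Whether a point generic in \<open>hyp s\<close> belongs to \<open>D s \<epsilon>\<close> depends only on its signs, so a cell of the
  arrangement induced on \<open>hyp s\<close> is contained in \<open>D s \<epsilon>\<close> as soon as it meets it. Generic points are dense
  in the relatively open set \<open>D s \<epsilon>\<close>.
\<close>

lemma closure_D:
  assumes \<epsilon>: "\<epsilon> = 1 \<or> \<epsilon> = - 1"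
  shows "closure (D s \<epsilon>) = hyp s \<inter> \<Union>(closedcell (H' s) ` \<Sigma>' s \<epsilon>)"
proof
  have fin: "finite (\<Sigma>' s \<epsilon>)" unfolding \<Sigma>'_def using finH' by auto
  have cl: "closed (hyp s \<inter> \<Union>(closedcell (H' s) ` \<Sigma>' s \<epsilon>))"
    using fin closed_closedcell closed_hyp by blast
  show "closure (D s \<epsilon>) \<subseteq> hyp s \<inter> \<Union>(closedcell (H' s) ` \<Sigma>' s \<epsilon>)"
  proof (rule closure_minimal[OF _ cl], rule subsetI)
    fix x assume x: "x \<in> D s \<epsilon>"
    have "x \<in> closure (hyp s \<inter> \<Union>(closedcell (H' s) ` \<Sigma>' s \<epsilon>))"
      unfolding closure_approachable
    proof (intro allI impI)
      fix e :: real assume "e > 0"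
      then obtain z where z: "z \<in> D s \<epsilon>" "generic (H' s) z" "dist z x < e"
        using D_generic_point[OF x] by blast
      then have "signs (H' s) z \<in> \<Sigma>' s \<epsilon>" "z \<in> closedcell (H' s) (signs (H' s) z)"
        using signs_opencell signs_subset opencell_subset_closedcell unfolding \<Sigma>'_def by blast+
      then show "\<exists>y\<in>hyp s \<inter> \<Union>(closedcell (H' s) ` \<Sigma>' s \<epsilon>). dist y x < e"
        using z D_sub_hyp by blast
    qed
    then show "x \<in> hyp s \<inter> \<Union>(closedcell (H' s) ` \<Sigma>' s \<epsilon>)" using closure_closed[OF cl] by simp
  qed
  show "hyp s \<inter> \<Union>(closedcell (H' s) ` \<Sigma>' s \<epsilon>) \<subseteq> closure (D s \<epsilon>)"
  proof
    fix x assume "x \<in> hyp s \<inter> \<Union>(closedcell (H' s) ` \<Sigma>' s \<epsilon>)"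
    then obtain \<tau> where t: "\<tau> \<in> \<Sigma>' s \<epsilon>" "x \<in> hyp s \<inter> closedcell (H' s) \<tau>" by blast
    then obtain z where "z \<in> opencell (H' s) \<tau> \<inter> hyp s" using D_sub_hyp unfolding \<Sigma>'_def by blast
    then have "x \<in> closure (opencell (H' s) \<tau> \<inter> hyp s)"
      using closedcell_subset_closure[OF affine_imp_convex[OF aff_hyp]] t(2) by blast
    then show "x \<in> closure (D s \<epsilon>)" using closure_mono[OF opencell_sub_D[OF t(1) \<epsilon>]] by blast
  qed
qed

lemma closure_D_generic:
  assumes \<epsilon>: "\<epsilon> = 1 \<or> \<epsilon> = - 1" and x: "generic (H' s) x"
  shows "x \<in> closure (D s \<epsilon>) \<longleftrightarrow> x \<in> D s \<epsilon>"
proof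
  assume "x \<in> closure (D s \<epsilon>)"
  then obtain \<tau> where t: "\<tau> \<in> \<Sigma>' s \<epsilon>" "x \<in> hyp s" "x \<in> closedcell (H' s) \<tau>" 
    unfolding closure_D[OF \<epsilon>] by blast
  then have "\<tau> = signs (H' s) x" using closedcell_signs[OF x] unfolding \<Sigma>'_def by blast
  then have "x \<in> opencell (H' s) \<tau>" using signs_opencell[OF x] by simp
  then show "x \<in> D s \<epsilon>" using opencell_sub_D[OF t(1) \<epsilon>] t(2) by blast
qed (use closure_subset in blast)

lemma compactF: "compact F" using F polytope_in_compact by blast

lemma closure_D_sub: "closure (D s \<epsilon>) \<subseteq> F"
  using D_sub_F compactF compact_imp_closed closure_minimal by blast

lemma closure_D_sub_hyp: "closure (D s \<epsilon>) \<subseteq> hyp s"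
  using D_sub_hyp closed_hyp closure_minimal by blast

lemma polytope_closure_D:
  assumes \<epsilon>: "\<epsilon> = 1 \<or> \<epsilon> = - 1" and ne: "D s \<epsilon> \<noteq> {}"
  shows "polytope_in (hyp s) (closure (D s \<epsilon>))"
  unfolding closure_D[OF \<epsilon>]
proof (rule polytope_in_closedcells[OF onW' hyp_eq finH' proper_H'])
  show "\<Sigma>' s \<epsilon> \<subseteq> Pow (H' s)" by (auto simp: \<Sigma>'_def)
  show "opencell (H' s) \<sigma> \<inter> hyp s \<noteq> {}" if "\<sigma> \<in> \<Sigma>' s \<epsilon>" for \<sigma>
    using that D_sub_hyp unfolding \<Sigma>'_def by blast
  have "bounded (closure (D s \<epsilon>))"
    using bounded_subset[OF compact_imp_bounded[OF compactF] closure_D_sub] .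
  then show "bounded (hyp s \<inter> \<Union> (closedcell (H' s) ` \<Sigma>' s \<epsilon>))" unfolding closure_D[OF \<epsilon>] .
  have "closure (D s \<epsilon>) \<noteq> {}" using ne by simp
  then show "\<Sigma>' s \<epsilon> \<noteq> {}" unfolding closure_D[OF \<epsilon>] by blast
qed

lemma affine_hull_closure_D:
  assumes "\<epsilon> = 1 \<or> \<epsilon> = - 1" "D s \<epsilon> \<noteq> {}" shows "affine hull (closure (D s \<epsilon>)) = hyp s"
  using polytope_closure_D[OF assms] polytope_in_affine_hull by blast

text \<open>
  Across a hyperplane \<open>hyp s\<close> that does not come from \<open>H\<close> the cell does not change at generic points, so \<open>F\<close> cannot lie on
  one side only.
\<close>

lemma D_level:
  assumes "\<epsilon> = 1 \<or> \<epsilon> = - 1" "D s \<epsilon> \<noteq> {}" shows "(v, s) \<in> H"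
proof (rule ccontr)
  assume n: "(v, s) \<notin> H"
  obtain x where "x \<in> D s \<epsilon>" using assms by blast
  then obtain z where z: "z \<in> D s \<epsilon>" "generic (H' s) z" using D_generic_point[of x s \<epsilon> 1] by auto
  have "above s z \<longleftrightarrow> below s z" using n by (simp add: above_def below_def)
  moreover have "z \<in> hyp s" using z(1) D_sub_hyp by blast
  ultimately show False using D_iff[OF _ z(2) assms(1)] z(1) by (simp split: if_splits)
qed

text \<open>
  At generic points a facet coincides with its \<open>D s \<epsilon>\<close>, and there \<open>D_iff\<close> tells the two sides apart.
\<close>

lemma closure_D_inj:
  assumes "\<epsilon> = 1 \<or> \<epsilon> = - 1" "D s \<epsilon> \<noteq> {}" "\<epsilon>' = 1 \<or> \<epsilon>' = - 1"
    and eq: "closure (D s \<epsilon>) = closure (D s' \<epsilon>')"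
  shows "s = s'" "\<epsilon> = \<epsilon>'"
proof -
  obtain x where x: "x \<in> D s \<epsilon>" using assms by blast
  then have "x \<in> hyp s" "x \<in> hyp s'" using eq closure_D_sub_hyp closure_subset by blast+
  then show s: "s = s'" by (simp add: hyp_def)
  obtain z where z: "z \<in> D s \<epsilon>" "generic (H' s) z" using D_generic_point[OF x, of 1] by auto
  then have "z \<in> D s \<epsilon>'" using eq closure_D_generic[OF assms(3) z(2)] closure_subset s by blast
  moreover have "z \<in> hyp s" using z(1) D_sub_hyp by blast
  ultimately show "\<epsilon> = \<epsilon>'"
    using z(1) D_iff[OF _ z(2) assms(1)] D_iff[OF _ z(2) assms(3)] assms(1,3)
    by (simp split: if_splits)
qed

lemma adjoins_D:
  assumes "\<epsilon> = 1 \<or> \<epsilon> = - 1" "D s \<epsilon> \<noteq> {}"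
  shows "adjoins_from F (closure (D s \<epsilon>)) (K s \<epsilon>)"
proof -
  have "\<bar>\<epsilon>\<bar> = 1" using assms by auto
  then show ?thesis
    unfolding adjoins_from_def Let_def polytope_in_affine_hull[OF F]
    using assms(2) F halfspace_K unfolding D_def by auto
qed

text \<open>
  On \<open>U\<close>, the functional that defines the half-space is constant on \<open>hyp s\<close> and hence an affine
  function of \<open>v \<bullet> x\<close>; the sign of its slope is \<open>\<epsilon>\<close>.
\<close>

lemma adjoins_imp_D:
  assumes adj: "adjoins_from F G K'" and par: "affine hull G = (+) u ` perp W'"
  obtains s \<epsilon> where "\<epsilon> = 1 \<or> \<epsilon> = - 1" "D s \<epsilon> \<noteq> {}" "G = closure (D s \<epsilon>)" "K' = K s \<epsilon>"
proof -
  obtain H0 where G: "G \<noteq> {}" and hs: "halfspace_in U H0 K'" and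
    Geq: "G = closure {x \<in> H0. \<exists>N. openin (top_of_set U) N \<and> x \<in> N \<and> F \<inter> N = K' \<inter> N}"
    using adj unfolding adjoins_from_def Let_def polytope_in_affine_hull[OF F] by (elim conjE exE)
  from hs obtain a b where H0: "affine H0" "H0 \<subseteq> U" "aff_dim U = aff_dim H0 + 1"
    "H0 = {x \<in> U. a \<bullet> x = b}" "K' = {x \<in> U. a \<bullet> x \<ge> b}" unfolding halfspace_in_def by (elim conjE exE)
  have "G \<subseteq> H0" unfolding Geq using H0(1) by (intro closure_minimal) (auto simp: affine_closed)
  then have hull: "affine hull G \<subseteq> H0" using H0(1) by (rule hull_minimal)
  moreover have "u \<in> affine hull G" unfolding par using zero_in_perp by force
  ultimately have uU: "u \<in> U" using H0 by blast
  define s where "s = v \<bullet> u"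
  have hG: "affine hull G = hyp s" using hyp_translate[OF uU] par by (simp add: s_def)
  then have "hyp s = H0"
    using affine_dim_equal[OF aff_hyp H0(1) hyp_ne, of s] hull H0(3) aff_dim_hyp[of s] by simp
  then have eq: "hyp s = {x \<in> U. a \<bullet> x = b}" using H0 by simp
  obtain x0 where x0: "x0 \<in> hyp s" using hyp_ne by blast
  have x0U: "x0 \<in> U" "v \<bullet> x0 = s" using x0 by (auto simp: hyp_def)
  have "x0 + 1 *\<^sub>R v \<in> U" "x0 + 1 *\<^sub>R v \<notin> hyp s" using x0U U_shift[of x0 1] by (auto simp: hyp_def inner_add_right vv)
  then have av: "a \<bullet> v \<noteq> 0" using eq x0 by (auto simp: inner_add_right)
  have ax: "a \<bullet> x = b + (v \<bullet> x - s) * (a \<bullet> v)" if "x \<in> U" for x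
  proof -
    have "x + (s - v \<bullet> x) *\<^sub>R v \<in> hyp s" using U_shift[OF that] by (simp add: hyp_def inner_add_right vv)
    then have "a \<bullet> (x + (s - v \<bullet> x) *\<^sub>R v) = b" using eq by blast
    then show ?thesis by (simp add: inner_add_right algebra_simps)
  qed
  \<comment> \<open>The sign of \<open>a \<bullet> v\<close> tells on which side of \<open>hyp s\<close> the half-space lies.\<close>
  define \<epsilon> where "\<epsilon> = sgn (a \<bullet> v)"
  have e: "\<epsilon> = 1 \<or> \<epsilon> = - 1" using av by (auto simp: \<epsilon>_def sgn_if)
  have "b \<le> a \<bullet> x \<longleftrightarrow> 0 \<le> \<epsilon> * (v \<bullet> x - s)" if "x \<in> U" for x
    unfolding ax[OF that] \<epsilon>_def using av by (auto simp: sgn_if zero_le_mult_iff)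
  then have KK: "K' = K s \<epsilon>" unfolding H0(5) K_def by blast
  have "G = closure (D s \<epsilon>)" unfolding Geq D_def \<open>hyp s = H0\<close> KK ..
  then show thesis using that e KK G by fastforce
qed

definition par_facets where
  "par_facets = {G. poly_facet F G \<and> (\<exists>u. affine hull G = (+) u ` perp W')}"

lemma par_facets_eq:
  "par_facets = (\<lambda>(s, \<epsilon>). closure (D s \<epsilon>)) ` {(s, \<epsilon>). (\<epsilon> = 1 \<or> \<epsilon> = - 1) \<and> (v, s) \<in> H \<and> D s \<epsilon> \<noteq> {}}" (is "_ = _ ` ?I")
proof
  show "par_facets \<subseteq> (\<lambda>(s, \<epsilon>). closure (D s \<epsilon>)) ` ?I"
  proof
    fix G assume "G \<in> par_facets"
    then obtain K' u where *: "adjoins_from F G K'" "affine hull G = (+) u ` perp W'"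
      unfolding par_facets_def poly_facet_def by blast
    show "G \<in> (\<lambda>(s, \<epsilon>). closure (D s \<epsilon>)) ` ?I"
    proof (rule adjoins_imp_D[OF *])
      fix s \<epsilon> assume se: "\<epsilon> = 1 \<or> \<epsilon> = - 1" "D s \<epsilon> \<noteq> {}" "G = closure (D s \<epsilon>)"
      then have "(s, \<epsilon>) \<in> ?I" using D_level[OF se(1,2)] by simp
      then show ?thesis using se(3) by (intro image_eqI[of _ _ "(s, \<epsilon>)"]) simp_all
    qed
  qed
  show "(\<lambda>(s, \<epsilon>). closure (D s \<epsilon>)) ` ?I \<subseteq> par_facets"
  proof clarify
    fix s \<epsilon> assume *: "\<epsilon> = 1 \<or> \<epsilon> = - 1" "(v, s) \<in> H" "D s \<epsilon> \<noteq> {}"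
    show "closure (D s \<epsilon>) \<in> par_facets"
      unfolding par_facets_def poly_facet_def
      using adjoins_D[OF *(1,3)] affine_hull_closure_D[OF *(1,3)] hyp_eq[of s] by auto
  qed
qed

lemma finite_levels: "finite {s. (v, s) \<in> H}"
proof -
  have "{s. (v, s) \<in> H} \<subseteq> snd ` H" by force
  then show ?thesis using finH finite_surj by blast
qed

lemma finite_par_facets: "finite par_facets"
proof -
  have "{(s, \<epsilon>). (\<epsilon> = 1 \<or> \<epsilon> = - 1) \<and> (v, s) \<in> H \<and> D s \<epsilon> \<noteq> {}} \<subseteq> {s. (v, s) \<in> H} \<times> {1, -1}" by auto
  then show ?thesis unfolding par_facets_eq using finite_levels finite_subset by blast
qed

lemma par_facets_inj:
  "inj_on (\<lambda>(s, \<epsilon>). closure (D s \<epsilon>)) {(s, \<epsilon>). (\<epsilon> = 1 \<or> \<epsilon> = - 1) \<and> (v, s) \<in> H \<and> D s \<epsilon> \<noteq> {}}"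
proof (rule inj_onI, clarsimp)
  fix s \<epsilon> s' \<epsilon>'
  assume "\<epsilon> = 1 \<or> \<epsilon> = - 1" "D s \<epsilon> \<noteq> {}" "\<epsilon>' = 1 \<or> \<epsilon>' = - 1" "closure (D s \<epsilon>) = closure (D s' \<epsilon>')"
  from closure_D_inj[OF this] show "s = s' \<and> \<epsilon> = \<epsilon>'" ..
qed

lemma K_translate: "K s 1 = (+) (q + s *\<^sub>R v) ` {x \<in> perp W. v \<bullet> x \<ge> 0}"
proof (rule set_eqI)
  fix x
  have 1: "x - (q + s *\<^sub>R v) = (x - q) - s *\<^sub>R v" by simp
  have 2: "x - q \<in> perp W \<longleftrightarrow> (x - q) - s *\<^sub>R v \<in> perp W"
    using perp_diff[OF _ perp_scale[OF vW], of "x - q" s] 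
      perp_add[OF _ perp_scale[OF vW], of "(x - q) - s *\<^sub>R v" s] by auto
  have "x \<in> K s 1 \<longleftrightarrow> x - (q + s *\<^sub>R v) \<in> {x \<in> perp W. v \<bullet> x \<ge> 0}"
    unfolding K_def mem_Collect_eq U_iff 1 using 2 by (auto simp: inner_diff_right vv vq)
  then show "x \<in> K s 1 \<longleftrightarrow> x \<in> (+) (q + s *\<^sub>R v) ` {x \<in> perp W. v \<bullet> x \<ge> 0}"
    unfolding mem_translate .
qed

text \<open>
  For \<open>\<epsilon> = - 1\<close> the half-space \<open>K s \<epsilon>\<close> is bounded above in direction \<open>v\<close>, unlike every translate of the
  positive half-space.
\<close>

lemma side_sign_D:
  assumes e: "\<epsilon> = 1 \<or> \<epsilon> = - 1" and ne: "D s \<epsilon> \<noteq> {}"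
  shows "side_sign {x \<in> perp W. v \<bullet> x \<ge> 0} F (closure (D s \<epsilon>)) = \<epsilon>"
proof (cases "\<epsilon> = 1")
  case True
  then show ?thesis using adjoins_D[OF e ne] K_translate[of s] unfolding side_sign_def by auto
next
  case False
  then have em: "\<epsilon> = - 1" using e by simp
  let ?P = "{x \<in> perp W. v \<bullet> x \<ge> 0}"
  have False if adj: "adjoins_from F (closure (D s \<epsilon>)) K'" and K': "K' = (+) u ` ?P" for K' u
  proof (rule adjoins_imp_D[OF adj affine_hull_closure_D[OF e ne, unfolded hyp_eq]])
    fix s' \<epsilon>'
    assume *: "\<epsilon>' = 1 \<or> \<epsilon>' = - 1" "closure (D s \<epsilon>) = closure (D s' \<epsilon>')" "K' = K s' \<epsilon>'"
    have "s = s'" "\<epsilon> = \<epsilon>'" using closure_D_inj[OF e ne *(1,2)] .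
    then have K2: "K' = K s (- 1)" using * em by simp
    define c where "c = \<bar>v \<bullet> u - s\<bar> + 1"
    have "c *\<^sub>R v \<in> ?P" using perp_scale[OF vW] vv by (simp add: c_def)
    then have "u + c *\<^sub>R v \<in> K'" unfolding K' by blast
    then have "v \<bullet> u + c \<le> s" unfolding K2 K_def by (simp add: inner_add_right vv)
    then show False unfolding c_def by linarith
  qed
  then show ?thesis unfolding side_sign_def using em by auto
qed

lemma sum_par_facets:
  fixes f :: "'a set \<Rightarrow> complex"
  assumes f0: "f {} = 0"
  shows "(\<Sum>G\<in>par_facets. of_real (side_sign {x \<in> perp W. v \<bullet> x \<ge> 0} F G) * f G) = 
     (\<Sum>s\<in>{s. (v, s) \<in> H}. f (closure (D s 1)) - f (closure (D s (- 1))))"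
proof -
  let ?I = "{(s, \<epsilon>::real). (\<epsilon> = 1 \<or> \<epsilon> = - 1) \<and> (v, s) \<in> H \<and> D s \<epsilon> \<noteq> {}}"
  let ?J = "{s. (v, s) \<in> H} \<times> {1, - 1 :: real}"
  have "(\<Sum>G\<in>par_facets. of_real (side_sign {x \<in> perp W. v \<bullet> x \<ge> 0} F G) * f G) = 
     (\<Sum>(s, \<epsilon>)\<in>?I. of_real (side_sign {x \<in> perp W. v \<bullet> x \<ge> 0} F (closure (D s \<epsilon>))) * f (closure (D s \<epsilon>)))"
    unfolding par_facets_eq sum.reindex[OF par_facets_inj] by (intro sum.cong refl) auto
  also have "\<dots> = (\<Sum>(s, \<epsilon>)\<in>?I. of_real \<epsilon> * f (closure (D s \<epsilon>)))"
  proof (intro sum.cong refl, clarify)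
    fix s \<epsilon> assume "\<epsilon> = 1 \<or> \<epsilon> = - 1" "D s \<epsilon> \<noteq> {}"
    from side_sign_D[OF this] 
    show "complex_of_real (side_sign {x \<in> perp W. v \<bullet> x \<ge> 0} F (closure (D s \<epsilon>))) * f (closure (D s \<epsilon>)) =
        complex_of_real \<epsilon> * f (closure (D s \<epsilon>))" by simp
  qed
  also have "\<dots> = (\<Sum>(s, \<epsilon>)\<in>?J. of_real \<epsilon> * f (closure (D s \<epsilon>)))"
    using finite_levels f0 by (intro sum.mono_neutral_left) auto
  also have "\<dots> = (\<Sum>s\<in>{s. (v, s) \<in> H}. f (closure (D s 1)) - f (closure (D s (- 1))))"
    by (subst sum.cartesian_product[symmetric]) simp
  finally show ?thesis .
qed

end

section \<open>The Fourier integral of a polytope in terms of its facets\<close>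

text \<open>
  For a nonempty subset \<open>F\<close> of a translate of \<open>perp W\<close> this is the point at which the translate meets
  the span of \<open>W\<close>, whatever point of \<open>F\<close> is chosen.
\<close>

definition foot :: "'a::euclidean_space set \<Rightarrow> 'a set \<Rightarrow> 'a" where
  "foot W F = (SOME x. x \<in> F) - prj W (SOME x. x \<in> F)"

definition fourier_on :: "'a::euclidean_space set \<Rightarrow> 'a set \<Rightarrow> 'a \<Rightarrow> complex" where
  "fourier_on W F \<xi> = flat_int W (\<lambda>y. indicator F (foot W F + y) *\<^sub>R expo \<xi> (foot W F + y))"

lemma foot_eq:
  assumes "F \<noteq> {}" "F \<subseteq> (+) q ` perp W" "prj W q = 0"
  shows "foot W F = q"
proof -
  have "(SOME x. x \<in> F) \<in> F" using assms(1) by (simp add: some_in_eq)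
  then obtain y where "(SOME x. x \<in> F) = q + y" "y \<in> perp W" using assms(2) by blast
  then show ?thesis using assms(3) by (simp add: foot_def prj_add prj_id)
qed

lemma fourier_on_empty [simp]: "fourier_on W {} \<xi> = 0"
  by (simp add: fourier_on_def flat_int_def)

lemma fourier_on_eq:
  assumes "F \<subseteq> (+) q ` perp W" "prj W q = 0"
  shows "fourier_on W F \<xi> = flat_int W (\<lambda>y. indicator F (q + y) *\<^sub>R expo \<xi> (q + y))"
proof (cases "F = {}")
  case True
  then show ?thesis by (simp add: flat_int_def)
next
  case False
  show ?thesis unfolding fourier_on_def foot_eq[OF False assms] ..
qed

lemma flat_int_sum:
  fixes f :: "'i \<Rightarrow> 'a::euclidean_space \<Rightarrow> complex"
  assumes "orthonormal W" "\<And>i. i \<in> I \<Longrightarrow> tame W (f i)"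
  shows "flat_int W (\<lambda>y. \<Sum>i\<in>I. c i * f i y) = (\<Sum>i\<in>I. c i * flat_int W (f i))"
proof -
  have "flat_int W (\<lambda>y. \<Sum>i\<in>I. c i * f i y) = 
      (LINT x|lborel. (\<Sum>i\<in>I. c i * (indicator (slab W) x *\<^sub>R f i (prj W x))))"
    unfolding flat_int_def by (simp add: scaleR_sum_right)
  also have "\<dots> = (\<Sum>i\<in>I. (LINT x|lborel. c i * (indicator (slab W) x *\<^sub>R f i (prj W x))))"
    by (intro Bochner_Integration.integral_sum integrable_mult_right tame_integrable assms)
  also have "\<dots> = (\<Sum>i\<in>I. c i * flat_int W (f i))"
    unfolding flat_int_def by (intro sum.cong refl integral_mult_right_zero)
  finally show ?thesis .
qed

lemma flat_int_mult:
  fixes f :: "'a::euclidean_space \<Rightarrow> complex"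
  shows "flat_int W (\<lambda>y. c * f y) = c * flat_int W f"
proof -
  have "flat_int W (\<lambda>y. c * f y) = (LINT x|lborel. c * (indicator (slab W) x *\<^sub>R f (prj W x)))"
    unfolding flat_int_def by simp
  also have "\<dots> = c * flat_int W f" unfolding flat_int_def by (rule integral_mult_right_zero)
  finally show ?thesis .
qed

lemma flat_int_cong_AE:
  fixes f g :: "'a::euclidean_space \<Rightarrow> complex"
  assumes W: "orthonormal W" and [measurable]: "f \<in> borel_measurable borel" "g \<in> borel_measurable borel"
    and P: "AE x in lborel. P (prj W x)" "\<And>y. y \<in> perp W \<Longrightarrow> P y \<Longrightarrow> f y = g y"
  shows "flat_int W f = flat_int W g"
  unfolding flat_int_def
proof (rule integral_cong_AE)
  have [measurable]: "slab W \<in> sets borel" using slab_borel[OF W] .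
  show "(\<lambda>x. indicat_real (slab W) x *\<^sub>R f (prj W x)) \<in> borel_measurable lborel"
    "(\<lambda>x. indicat_real (slab W) x *\<^sub>R g (prj W x)) \<in> borel_measurable lborel"
    by measurable
  show "AE x in lborel. indicat_real (slab W) x *\<^sub>R f (prj W x) = indicat_real (slab W) x *\<^sub>R g (prj W x)"
    using P(1) by eventually_elim (simp add: P(2)[OF prj_in_perp[OF W]])
qed

lemma tame_indicator_expo:
  assumes "C \<in> sets borel" "g \<in> borel_measurable borel" "\<And>y. norm (g y) \<le> 1"
    "\<And>y. y \<in> perp W \<Longrightarrow> y \<in> C \<Longrightarrow> norm y \<le> R"
  shows "tame W (\<lambda>y. indicator C y *\<^sub>R (g y :: complex))"
  unfolding tame_def
proof (intro conjI exI[of _ "max 1 R"] ballI)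
  show "(\<lambda>y. indicat_real C y *\<^sub>R g y) \<in> borel_measurable borel" using assms by measurable
  show "norm (indicat_real C y *\<^sub>R g y) \<le> max 1 R" for y
    using assms(3)[of y] by (auto simp: indicator_def le_max_iff_disj)
qed (auto simp: indicator_def le_max_iff_disj dest: assms(4))

context cellular
begin

lemma inner_H_q: "h \<in> H \<Longrightarrow> fst h \<bullet> (q + y) = fst h \<bullet> y"
  using H[of "fst h" "snd h"] perp_q by (simp add: inner_add_right)

lemma closedcell_q: 
  assumes "G \<subseteq> H" shows "q + y \<in> closedcell G \<sigma> \<longleftrightarrow> y \<in> closedcell G \<sigma>"
proof -
  have "fst h \<bullet> (q + y) = fst h \<bullet> y" if "h \<in> G" for h using inner_H_q assms that by blast
  then show ?thesis unfolding closedcell_def by (auto split: if_splits)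
qed

lemma signs_q: 
  assumes "G \<subseteq> H" shows "signs G (q + y) = signs G y" "generic G (q + y) \<longleftrightarrow> generic G y"
proof -
  have "fst h \<bullet> (q + y) = fst h \<bullet> y" if "h \<in> G" for h using inner_H_q assms that by blast
  then show "signs G (q + y) = signs G y" "generic G (q + y) \<longleftrightarrow> generic G y"
    unfolding signs_def generic_def by auto
qed

lemma finite_\<Sigma>: "finite \<Sigma>" using \<Sigma>(1) finH by (simp add: finite_subset)

lemma mem_F: "y \<in> perp W \<Longrightarrow> q + y \<in> F \<longleftrightarrow> (\<exists>\<sigma>\<in>\<Sigma>. y \<in> closedcell H \<sigma>)"
  unfolding F_eq U using closedcell_q[of H y] by auto

lemma cell_bound: obtains R where "R \<ge> 0" "\<And>y \<sigma>. y \<in> perp W \<Longrightarrow> \<sigma> \<in> \<Sigma> \<Longrightarrow> y \<in> closedcell H \<sigma> \<Longrightarrow> norm y \<le> R"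
proof -
  obtain B where B: "\<And>x. x \<in> F \<Longrightarrow> norm x \<le> B"
    using compactF compact_imp_bounded bounded_iff by metis
  have "norm y \<le> max 0 (B + norm q)" if "y \<in> perp W" "\<sigma> \<in> \<Sigma>" "y \<in> closedcell H \<sigma>" for y \<sigma>
  proof -
    have "norm (q + y) \<le> B" using B mem_F that by blast
    moreover have "norm y \<le> norm (q + y) + norm q"
      by (metis add.commute add_diff_cancel_right' norm_triangle_ineq4)
    ultimately show ?thesis by simp
  qed
  then show thesis using that[of "max 0 (B + norm q)"] by simp
qed

text \<open>
  The members of \<open>Hn\<close> are the hyperplanes that are not parallel to \<open>v\<close>. The line through a base point \<open>y\<close>
  in direction \<open>v\<close> crosses such a hyperplane \<open>h\<close> at \<open>X h y\<close>, at height \<open>T h y\<close>. The set \<open>R \<sigma> h\<close> consists of the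
  base points whose line enters or leaves the cell \<open>\<sigma>\<close> there; the sign \<open>sg \<sigma> h\<close> distinguishes lower from
  upper end points.
\<close>

definition Hn where "Hn = {h \<in> H. v \<bullet> fst h = 1}"
definition T where "T h y = snd h - fst h \<bullet> y" for h :: "'a \<times> real"
definition X where "X h y = y + T h y *\<^sub>R v" for h :: "'a \<times> real"
definition R where "R \<sigma> h = {y. X h y \<in> opencell (H - {h}) \<sigma>}"
definition sg :: "('a \<times> real) set \<Rightarrow> 'a \<times> real \<Rightarrow> complex" where "sg \<sigma> h = (if h \<in> \<sigma> then - 1 else 1)"

lemma finHn: "finite Hn" using finH by (simp add: Hn_def)

lemma H_v: "h \<in> H \<Longrightarrow> v \<bullet> fst h = (if h \<in> Hn then 1 else 0)"
  using H[of "fst h" "snd h"] by (auto simp: Hn_def)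

lemma opencell_line:
  assumes "G \<subseteq> H"
  shows "y + s *\<^sub>R v \<in> opencell G \<sigma> \<longleftrightarrow> y \<in> opencell (G - Hn) \<sigma> \<and> 
      (\<forall>h\<in>G \<inter> Hn. if h \<in> \<sigma> then T h y < s else s < T h y)"
proof -
  have ip: "fst h \<bullet> (y + s *\<^sub>R v) = (if h \<in> Hn then fst h \<bullet> y + s else fst h \<bullet> y)" if "h \<in> G" for h
    using H_v[of h] that assms by (auto simp: inner_add_right inner_commute)
  have split: "(\<forall>h\<in>G. Q h) \<longleftrightarrow> (\<forall>h\<in>G - Hn. Q h) \<and> (\<forall>h\<in>G \<inter> Hn. Q h)" for Q by blast
  have "y + s *\<^sub>R v \<in> opencell G \<sigma> \<longleftrightarrow> 
      (\<forall>h\<in>G. if h \<in> \<sigma> then snd h < fst h \<bullet> (y + s *\<^sub>R v) else fst h \<bullet> (y + s *\<^sub>R v) < snd h)"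
    unfolding opencell_def mem_Collect_eq ..
  also have "\<dots> \<longleftrightarrow> 
    (\<forall>h\<in>G - Hn. if h \<in> \<sigma> then snd h < fst h \<bullet> (y + s *\<^sub>R v) else fst h \<bullet> (y + s *\<^sub>R v) < snd h) \<and>
    (\<forall>h\<in>G \<inter> Hn. if h \<in> \<sigma> then snd h < fst h \<bullet> (y + s *\<^sub>R v) else fst h \<bullet> (y + s *\<^sub>R v) < snd h)"
    by (rule split)
  also have "(\<forall>h\<in>G - Hn. if h \<in> \<sigma> then snd h < fst h \<bullet> (y + s *\<^sub>R v) else fst h \<bullet> (y + s *\<^sub>R v) < snd h) \<longleftrightarrow>
      y \<in> opencell (G - Hn) \<sigma>"
    unfolding opencell_def mem_Collect_eq by (intro ball_cong refl) (simp add: ip)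
  also have "(\<forall>h\<in>G \<inter> Hn. if h \<in> \<sigma> then snd h < fst h \<bullet> (y + s *\<^sub>R v) else fst h \<bullet> (y + s *\<^sub>R v) < snd h) \<longleftrightarrow>
      (\<forall>h\<in>G \<inter> Hn. if h \<in> \<sigma> then T h y < s else s < T h y)"
    by (intro ball_cong refl) (auto simp: ip T_def)
  finally show ?thesis .
qed

text \<open>
  A cell without a lower or without an upper bound in direction \<open>v\<close> would contain a half-line, but the
  cells of \<open>\<Sigma>\<close> are bounded on \<open>perp W\<close>.
\<close>

lemma cell_two_sided:
  assumes "\<sigma> \<in> \<Sigma>" shows "Hn \<inter> \<sigma> \<noteq> {}" "Hn - \<sigma> \<noteq> {}"
proof -
  obtain B where B: "\<And>y. y \<in> perp W \<Longrightarrow> y \<in> closedcell H \<sigma> \<Longrightarrow> norm y \<le> B"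
    using cell_bound assms by metis
  obtain x where x: "x \<in> opencell H \<sigma>" "x \<in> U" using \<Sigma>(2)[OF assms] by blast
  then obtain y where y: "y \<in> perp W" "x = q + y" unfolding U by blast
  have "fst h \<bullet> (q + y) = fst h \<bullet> y" if "h \<in> H" for h using inner_H_q that by blast
  then have yo: "y \<in> opencell H \<sigma>" using x(1) unfolding y(2) opencell_def by (auto split: if_splits)
  have bd: "\<bar>v \<bullet> y + s\<bar> \<le> B" if "y + s *\<^sub>R v \<in> opencell H \<sigma>" for s
  proof -
    have "norm (y + s *\<^sub>R v) \<le> B"
      using B[of "y + s *\<^sub>R v"] that opencell_subset_closedcell y(1) perp_scale[OF vW] perp_add by blast
    moreover have "\<bar>v \<bullet> (y + s *\<^sub>R v)\<bar> \<le> norm v * norm (y + s *\<^sub>R v)" by (rule Cauchy_Schwarz_ineq2)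
    ultimately show ?thesis by (simp add: nv inner_add_right vv)
  qed
  have y0: "y + 0 *\<^sub>R v \<in> opencell H \<sigma>" using yo by simp
  define c where "c = \<bar>v \<bullet> y\<bar> + \<bar>B\<bar> + 1"
  have c: "c > 0" unfolding c_def by simp
  show "Hn \<inter> \<sigma> \<noteq> {}"
  proof
    assume e: "Hn \<inter> \<sigma> = {}"
    have "y + (- c) *\<^sub>R v \<in> opencell H \<sigma>"
      unfolding opencell_line[OF subset_refl]
    proof (intro conjI ballI)
      show "y \<in> opencell (H - Hn) \<sigma>" using y0 unfolding opencell_line[OF subset_refl] by blast
      fix h assume "h \<in> H \<inter> Hn"
      then have "h \<notin> \<sigma>" "if h \<in> \<sigma> then T h y < 0 else 0 < T h y" 
        using e y0 unfolding opencell_line[OF subset_refl] by blast+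
      then show "if h \<in> \<sigma> then T h y < - c else - c < T h y" using c by simp
    qed
    then show False using bd[of "- c"] unfolding c_def by linarith
  qed
  show "Hn - \<sigma> \<noteq> {}"
  proof
    assume e: "Hn - \<sigma> = {}"
    have "y + c *\<^sub>R v \<in> opencell H \<sigma>"
      unfolding opencell_line[OF subset_refl]
    proof (intro conjI ballI)
      show "y \<in> opencell (H - Hn) \<sigma>" using y0 unfolding opencell_line[OF subset_refl] by blast
      fix h assume "h \<in> H \<inter> Hn"
      then have "h \<in> \<sigma>" "if h \<in> \<sigma> then T h y < 0 else 0 < T h y" 
        using e y0 unfolding opencell_line[OF subset_refl] by blast+
      then show "if h \<in> \<sigma> then T h y < c else c < T h y" using c by simp
    qed
    then show False using bd[of c] unfolding c_def by linarith
  qed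
qed

text \<open>
  The point \<open>X h y\<close> belongs to the closed cell, and \<open>y\<close> is its projection.
\<close>

lemma R_bound:
  assumes "\<And>y. y \<in> perp W \<Longrightarrow> y \<in> closedcell H \<sigma> \<Longrightarrow> norm y \<le> B" 
    and h: "h \<in> Hn" and y: "y \<in> perp W'" "y \<in> R \<sigma> h"
  shows "norm y \<le> B"
proof -
  have yW: "y \<in> perp W" using y perp_W' by blast
  have XW: "X h y \<in> perp W" unfolding X_def using yW perp_scale[OF vW] perp_add by blast
  have hX: "fst h \<bullet> X h y = snd h"
    using h H_v[of h] by (auto simp: X_def T_def inner_add_right inner_commute Hn_def)
  have o: "X h y \<in> opencell (H - {h}) \<sigma>" using y by (simp add: R_def)
  have "if k \<in> \<sigma> then snd k \<le> fst k \<bullet> X h y else fst k \<bullet> X h y \<le> snd k" if "k \<in> H" for k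
  proof (cases "k = h")
    case False
    then have "k \<in> H - {h}" using that by blast
    from opencellD[OF o this] show ?thesis by (simp split: if_splits)
  qed (simp add: hX)
  then have "X h y \<in> closedcell H \<sigma>" unfolding closedcell_def by (intro CollectI ballI)
  then have "norm (X h y) \<le> B" using assms(1) XW by blast
  moreover have "prj W' v = 0" by (simp add: prj_W' prj_id[OF vW] vv)
  then have "prj W' (X h y) = y"
    by (simp add: X_def prj_add prj_scale prj_id[OF y(1)])
  ultimately show ?thesis using norm_prj_le[OF onW', of "X h y"] by simp
qed

lemma continuous_X: "continuous_on S (X h)"
  unfolding X_def T_def by (intro continuous_intros)

lemma R_open: "open (R \<sigma> h)"
proof -
  have "R \<sigma> h = X h -` opencell (H - {h}) \<sigma>" by (auto simp: R_def)
  then show ?thesis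
    using open_opencell[of "H - {h}" \<sigma>] continuous_X[of UNIV h] finH continuous_on_open_vimage[OF open_UNIV] by auto
qed

lemma X_affine: "a + b = 1 \<Longrightarrow> X h (a *\<^sub>R y + b *\<^sub>R z) = a *\<^sub>R X h y + b *\<^sub>R X h z"
proof -
  assume ab: "a + b = 1"
  have "T h (a *\<^sub>R y + b *\<^sub>R z) = (a + b) * snd h - (a * (fst h \<bullet> y) + b * (fst h \<bullet> z))"
    unfolding ab T_def by (simp add: inner_add_right)
  also have "\<dots> = a * T h y + b * T h z" by (simp add: T_def algebra_simps)
  finally show ?thesis by (simp add: X_def algebra_simps)
qed

lemma R_convex: "convex (R \<sigma> h)"
proof (rule convexI)
  fix y z a b assume *: "y \<in> R \<sigma> h" "z \<in> R \<sigma> h" "0 \<le> a" "0 \<le> b" "a + b = (1::real)"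
  then show "a *\<^sub>R y + b *\<^sub>R z \<in> R \<sigma> h"
    using convexD[OF convex_opencell, of "X h y" "H - {h}" \<sigma> "X h z" a b] unfolding R_def mem_Collect_eq X_affine[OF *(5)] by blast
qed

lemma borel_X [measurable]: "X h \<in> borel_measurable borel"
  by (intro borel_measurable_continuous_onI continuous_X)

lemma tame_R:
  assumes "\<sigma> \<in> \<Sigma>" "h \<in> Hn"
  shows "tame W' (\<lambda>y. indicator (R \<sigma> h) y *\<^sub>R expo \<xi> (X h y))"
proof -
  obtain B where "\<And>y. y \<in> perp W \<Longrightarrow> y \<in> closedcell H \<sigma> \<Longrightarrow> norm y \<le> B"
    using cell_bound assms by metis
  then have "norm y \<le> B" if "y \<in> perp W'" "y \<in> R \<sigma> h" for y
    using R_bound assms(2) that by metis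
  then show ?thesis using R_open[of \<sigma> h] by (intro tame_indicator_expo[where R = B]) auto
qed

lemma tame_O:
  assumes "\<sigma> \<in> \<Sigma>" shows "tame W (\<lambda>y. indicator (opencell H \<sigma>) y *\<^sub>R expo \<xi> y)"
proof -
  obtain B where "\<And>y. y \<in> perp W \<Longrightarrow> y \<in> closedcell H \<sigma> \<Longrightarrow> norm y \<le> B"
    using cell_bound assms by metis
  then have "norm y \<le> B" if "y \<in> perp W" "y \<in> opencell H \<sigma>" for y
    using that opencell_subset_closedcell by blast
  then show ?thesis using open_opencell[OF finH, of \<sigma>] by (intro tame_indicator_expo[where R = B]) auto
qed

text \<open>
  The line meets the cell in the interval of \<open>integral_expo_cell_on_line\<close> if \<open>y\<close> satisfies the constraints
  parallel to \<open>v\<close>, and not at all otherwise.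
\<close>

lemma line_integral:
  assumes \<sigma>: "\<sigma> \<in> \<Sigma>" and t: "\<xi> \<bullet> v \<noteq> 0" and inj: "inj_on (\<lambda>h. T h y) Hn"
  shows "(2 * of_real pi * \<i> * of_real (\<xi> \<bullet> v)) * 
      (LINT s|lborel. indicator (opencell H \<sigma>) (y + s *\<^sub>R v) *\<^sub>R expo \<xi> (y + s *\<^sub>R v))
     = (\<Sum>h\<in>Hn. sg \<sigma> h * (indicator (R \<sigma> h) y *\<^sub>R expo \<xi> (X h y)))"
proof (cases "y \<in> opencell (H - Hn) \<sigma>")
  case True
  have HHn: "H \<inter> Hn = Hn" "H - {h} - Hn = H - Hn" "(H - {h}) \<inter> Hn = Hn - {h}" if "h \<in> Hn" for h
    using that by (auto simp: Hn_def)
  have HHn0: "H \<inter> Hn = Hn" by (auto simp: Hn_def)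
  let ?J = "{s. \<forall>h\<in>Hn. if h \<in> \<sigma> then T h y < s else s < T h y}"
  let ?\<omega> = "\<xi> \<bullet> v"
  have 1: "indicat_real (opencell H \<sigma>) (y + s *\<^sub>R v) = indicator ?J s" for s
    using True unfolding indicator_def opencell_line[OF subset_refl] HHn0 by simp
  have "(LINT s|lborel. indicator (opencell H \<sigma>) (y + s *\<^sub>R v) *\<^sub>R expo \<xi> (y + s *\<^sub>R v)) =
     (LINT s|lborel. expo \<xi> y * (indicator ?J s *\<^sub>R expo ?\<omega> s))"
    unfolding 1 by (simp add: expo_add_right expo_scale_right)
  also have "\<dots> = expo \<xi> y * (LINT s|lborel. indicator ?J s *\<^sub>R expo ?\<omega> s)"
    by (rule integral_mult_right_zero)
  finally have 2: "(2 * of_real pi * \<i> * of_real ?\<omega>) * 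
      (LINT s|lborel. indicator (opencell H \<sigma>) (y + s *\<^sub>R v) *\<^sub>R expo \<xi> (y + s *\<^sub>R v)) = 
      expo \<xi> y * ((2 * of_real pi * \<i> * of_real ?\<omega>) * (LINT s|lborel. indicator ?J s *\<^sub>R expo ?\<omega> s))"
    by simp
  also have "\<dots> = expo \<xi> y * (\<Sum>h\<in>Hn. (if h \<in> \<sigma> then - 1 else 1) * 
       (if \<forall>j\<in>Hn - {h}. if j \<in> \<sigma> then T j y < T h y else T h y < T j y then expo ?\<omega> (T h y) else 0))"
    by (simp only: integral_expo_cell_on_line[OF finHn inj cell_two_sided[OF \<sigma>] t])
  also have "\<dots> = (\<Sum>h\<in>Hn. sg \<sigma> h * (indicator (R \<sigma> h) y *\<^sub>R expo \<xi> (X h y)))"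
    unfolding sum_distrib_left
  proof (intro sum.cong refl)
    fix h assume h: "h \<in> Hn"
    have "y \<in> R \<sigma> h \<longleftrightarrow> (\<forall>j\<in>Hn - {h}. if j \<in> \<sigma> then T j y < T h y else T h y < T j y)"
      unfolding R_def mem_Collect_eq X_def opencell_line[OF Diff_subset] HHn[OF h] using True by blast
    then have 3: "(if \<forall>j\<in>Hn - {h}. if j \<in> \<sigma> then T j y < T h y else T h y < T j y then expo ?\<omega> (T h y) else 0) =
      indicator (R \<sigma> h) y *\<^sub>R expo ?\<omega> (T h y)" by (simp only: indicator_def) simp
    show "expo \<xi> y * ((if h \<in> \<sigma> then - 1 else 1) * 
       (if \<forall>j\<in>Hn - {h}. if j \<in> \<sigma> then T j y < T h y else T h y < T j y then expo ?\<omega> (T h y) else 0)) =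
      sg \<sigma> h * (indicator (R \<sigma> h) y *\<^sub>R expo \<xi> (X h y))"
      unfolding 3 by (simp add: sg_def X_def expo_add_right expo_scale_right)
  qed
  finally show ?thesis .
next
  case False
  have "y + s *\<^sub>R v \<notin> opencell H \<sigma>" for s using False unfolding opencell_line[OF subset_refl] by blast
  moreover have "y \<notin> R \<sigma> h" if "h \<in> Hn" for h
  proof -
    have "H - {h} - Hn = H - Hn" using that by (auto simp: Hn_def)
    then show ?thesis using False unfolding R_def mem_Collect_eq X_def opencell_line[OF Diff_subset] by simp
  qed
  ultimately show ?thesis by (simp add: indicator_def)
qed

text \<open>
  Two hyperplanes of \<open>Hn\<close> have the same height only over a hyperplane of \<open>perp W'\<close> or nowhere, because
  distinct pairs describe distinct graphs.
\<close>

lemma T_inj_AE: "AE x in lborel. inj_on (\<lambda>h. T h (prj W' x)) Hn"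
proof -
  let ?G = "(\<lambda>(h, k). (fst h - fst k, snd h - snd k)) ` {(h, k). h \<in> Hn \<and> k \<in> Hn \<and> h \<noteq> k}"
  have "{(h, k). h \<in> Hn \<and> k \<in> Hn \<and> h \<noteq> k} \<subseteq> Hn \<times> Hn" by auto
  then have fin: "finite ?G" using finHn finite_subset by blast
  have "AE x in lborel. \<forall>(a, b)\<in>?G. a \<bullet> (0 + prj W' x) \<noteq> b"
  proof (rule AE_flat_generic[OF onW' fin])
    fix a b assume "(a, b) \<in> ?G"
    then obtain h k where hk: "h \<in> Hn" "k \<in> Hn" "h \<noteq> k" "a = fst h - fst k" "b = snd h - snd k" by auto
    then have "fst h \<in> perp W" "fst k \<in> perp W" "v \<bullet> fst h = 1" "v \<bullet> fst k = 1"
      using H[of "fst h" "snd h"] H[of "fst k" "snd k"] by (auto simp: Hn_def)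
    then have a: "a \<in> perp W'" unfolding perp_W' hk(4) using perp_diff by (auto simp: inner_diff_right)
    have "a \<noteq> 0 \<or> b \<noteq> 0" using hk by (auto simp: prod_eq_iff)
    then have "a \<bullet> (0 + 0) \<noteq> b \<or> a \<bullet> (0 + a) \<noteq> b" by auto
    then show "\<exists>z\<in>perp W'. a \<bullet> (0 + z) \<noteq> b" using a zero_in_perp by blast
  qed
  then show ?thesis
  proof eventually_elim
    case (elim x)
    show ?case
    proof (rule inj_onI, rule ccontr)
      fix h k assume hk: "h \<in> Hn" "k \<in> Hn" "T h (prj W' x) = T k (prj W' x)" "h \<noteq> k"
      then have "(fst h - fst k, snd h - snd k) \<in> ?G" by force
      then have "(fst h - fst k) \<bullet> (0 + prj W' x) \<noteq> snd h - snd k" using elim by blast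
      then show False using hk(3) by (simp add: T_def inner_diff_left)
    qed
  qed
qed

lemma cell_integral:
  assumes \<sigma>: "\<sigma> \<in> \<Sigma>" and t: "\<xi> \<bullet> v \<noteq> 0"
  shows "(2 * of_real pi * \<i> * of_real (\<xi> \<bullet> v)) * flat_int W (\<lambda>y. indicator (opencell H \<sigma>) y *\<^sub>R expo \<xi> y)
     = (\<Sum>h\<in>Hn. sg \<sigma> h * flat_int W' (\<lambda>y. indicator (R \<sigma> h) y *\<^sub>R expo \<xi> (X h y)))"
proof -
  let ?g = "\<lambda>y. indicator (opencell H \<sigma>) y *\<^sub>R expo \<xi> y"
  let ?c = "2 * of_real pi * \<i> * of_real (\<xi> \<bullet> v) :: complex"
  have [measurable]: "opencell H \<sigma> \<in> sets borel" using open_opencell[OF finH] by simp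
  have [measurable]: "R \<sigma> h \<in> sets borel" for h using R_open by simp
  have "?c * flat_int W ?g = ?c * flat_int W' (\<lambda>y. LINT s|lborel. ?g (y + s *\<^sub>R v))"
    unfolding W'_def flat_slice[OF W tame_O[OF \<sigma>]] ..
  also have "\<dots> = flat_int W' (\<lambda>y. ?c * (LINT s|lborel. ?g (y + s *\<^sub>R v)))"
    by (rule flat_int_mult[symmetric])
  also have "\<dots> = flat_int W' (\<lambda>y. \<Sum>h\<in>Hn. sg \<sigma> h * (indicator (R \<sigma> h) y *\<^sub>R expo \<xi> (X h y)))"
  proof (rule flat_int_cong_AE[OF onW' _ _ T_inj_AE])
    show "(\<lambda>y. ?c * (LINT s|lborel. ?g (y + s *\<^sub>R v))) \<in> borel_measurable borel" by measurable
    show "(\<lambda>y. \<Sum>h\<in>Hn. sg \<sigma> h * (indicator (R \<sigma> h) y *\<^sub>R expo \<xi> (X h y))) \<in> borel_measurable borel" 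
      by measurable
    show "?c * (LINT s|lborel. ?g (y + s *\<^sub>R v)) = 
        (\<Sum>h\<in>Hn. sg \<sigma> h * (indicator (R \<sigma> h) y *\<^sub>R expo \<xi> (X h y)))"
      if "inj_on (\<lambda>h. T h y) Hn" for y
      using line_integral[OF \<sigma> t that] .
  qed
  also have "\<dots> = (\<Sum>h\<in>Hn. sg \<sigma> h * flat_int W' (\<lambda>y. indicator (R \<sigma> h) y *\<^sub>R expo \<xi> (X h y)))"
    by (rule flat_int_sum[OF onW' tame_R[OF \<sigma>]])
  finally show ?thesis .
qed

text \<open>
  A point that lies on no hyperplane of \<open>H\<close> belongs to \<open>F\<close> exactly if its open cell is one of \<open>\<Sigma>\<close>.
\<close>

lemma fourier_F:
  "fourier_on W F \<xi> = expo \<xi> q * (\<Sum>\<sigma>\<in>\<Sigma>. flat_int W (\<lambda>y. indicator (opencell H \<sigma>) y *\<^sub>R expo \<xi> y))"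
proof -
  have [measurable]: "opencell H \<sigma> \<in> sets borel" for \<sigma> using open_opencell[OF finH] by simp
  have [measurable]: "F \<in> sets borel" using compactF by (simp add: compact_imp_closed)
  have "AE x in lborel. \<forall>(a, b)\<in>H. a \<bullet> (0 + prj W x) \<noteq> b"
  proof (rule AE_flat_generic[OF onW finH])
    fix a b assume "(a, b) \<in> H"
    then have a: "a \<in> perp W" "a \<noteq> 0" using H by auto
    then have "a \<bullet> (0 + 0) \<noteq> b \<or> a \<bullet> (0 + a) \<noteq> b" by auto
    then show "\<exists>z\<in>perp W. a \<bullet> (0 + z) \<noteq> b" using a zero_in_perp by blast
  qed
  then have AE: "AE x in lborel. generic H (prj W x)"
    by eventually_elim (auto simp: generic_def)
  have "F \<subseteq> U" unfolding F_eq by blast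
  then have "fourier_on W F \<xi> = flat_int W (\<lambda>y. indicator F (q + y) *\<^sub>R expo \<xi> (q + y))"
    using fourier_on_eq q unfolding U by blast
  also have "\<dots> = flat_int W (\<lambda>y. \<Sum>\<sigma>\<in>\<Sigma>. expo \<xi> q * (indicator (opencell H \<sigma>) y *\<^sub>R expo \<xi> y))"
  proof (rule flat_int_cong_AE[OF onW _ _ AE])
    show "(\<lambda>y. indicat_real F (q + y) *\<^sub>R expo \<xi> (q + y)) \<in> borel_measurable borel" by measurable
    show "(\<lambda>y. \<Sum>\<sigma>\<in>\<Sigma>. expo \<xi> q * (indicat_real (opencell H \<sigma>) y *\<^sub>R expo \<xi> y)) \<in> borel_measurable borel"
      by measurable
    fix y assume y: "y \<in> perp W" and g: "generic H y"
    have "y \<in> opencell H \<sigma> \<longleftrightarrow> \<sigma> = signs H y" if "\<sigma> \<in> \<Sigma>" for \<sigma>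
      using opencell_signs[of y H \<sigma>] signs_opencell[OF g] that \<Sigma>(1) by auto
    then have "(\<Sum>\<sigma>\<in>\<Sigma>. expo \<xi> q * (indicat_real (opencell H \<sigma>) y *\<^sub>R expo \<xi> y)) = 
        (\<Sum>\<sigma>\<in>\<Sigma>. if \<sigma> = signs H y then expo \<xi> q * expo \<xi> y else 0)"
      by (intro sum.cong refl) (simp add: indicator_def)
    also have "\<dots> = (if signs H y \<in> \<Sigma> then expo \<xi> q * expo \<xi> y else 0)"
      using finite_\<Sigma> by (simp add: sum.delta')
    also have "\<dots> = indicat_real F (q + y) *\<^sub>R expo \<xi> (q + y)"
    proof -
      have "q + y \<in> U" using y U by blast
      then have "q + y \<in> F \<longleftrightarrow> signs H y \<in> \<Sigma>"
        using mem_F_generic[of "q + y"] signs_q[OF subset_refl, of y] g by simp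
      then show ?thesis by (simp add: indicator_def expo_add_right)
    qed
    finally show "indicat_real F (q + y) *\<^sub>R expo \<xi> (q + y) = 
        (\<Sum>\<sigma>\<in>\<Sigma>. expo \<xi> q * (indicat_real (opencell H \<sigma>) y *\<^sub>R expo \<xi> y))" by simp
  qed
  also have "\<dots> = (\<Sum>\<sigma>\<in>\<Sigma>. expo \<xi> q * flat_int W (\<lambda>y. indicator (opencell H \<sigma>) y *\<^sub>R expo \<xi> y))"
    by (rule flat_int_sum[OF onW tame_O])
  finally show ?thesis by (simp add: sum_distrib_left)
qed

lemma fourier_F_faces:
  assumes t: "\<xi> \<bullet> v \<noteq> 0"
  shows "(2 * of_real pi * \<i> * of_real (\<xi> \<bullet> v)) * fourier_on W F \<xi> = 
    (\<Sum>h\<in>Hn. expo \<xi> q * (\<Sum>\<sigma>\<in>\<Sigma>. sg \<sigma> h * flat_int W' (\<lambda>y. indicator (R \<sigma> h) y *\<^sub>R expo \<xi> (X h y))))"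
proof -
  let ?c = "2 * of_real pi * \<i> * of_real (\<xi> \<bullet> v) :: complex"
  let ?r = "\<lambda>\<sigma> h. flat_int W' (\<lambda>y. indicator (R \<sigma> h) y *\<^sub>R expo \<xi> (X h y))"
  have "?c * fourier_on W F \<xi> = expo \<xi> q * (\<Sum>\<sigma>\<in>\<Sigma>. ?c * flat_int W (\<lambda>y. indicator (opencell H \<sigma>) y *\<^sub>R expo \<xi> y))"
    unfolding fourier_F by (simp add: sum_distrib_left mult_ac)
  also have "\<dots> = expo \<xi> q * (\<Sum>\<sigma>\<in>\<Sigma>. \<Sum>h\<in>Hn. sg \<sigma> h * ?r \<sigma> h)"
    using cell_integral[OF _ t] by simp
  also have "\<dots> = expo \<xi> q * (\<Sum>h\<in>Hn. \<Sum>\<sigma>\<in>\<Sigma>. sg \<sigma> h * ?r \<sigma> h)"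
    by (subst sum.swap) simp
  finally show ?thesis by (simp add: sum_distrib_left)
qed

text \<open>
  Over \<open>hyp s\<close> the height is the constant \<open>s\<close>. At a generic point the cell above contributes \<open>- 1\<close> and
  the cell below contributes \<open>1\<close> if they belong to \<open>\<Sigma>\<close>. The two contributions cancel when both do, so
  only the points of facets remain.
\<close>

lemma parallel_face_term:
  assumes h: "(v, s) \<in> H"
  shows "expo \<xi> q * (\<Sum>\<sigma>\<in>\<Sigma>. sg \<sigma> (v, s) * flat_int W' (\<lambda>y. indicator (R \<sigma> (v, s)) y *\<^sub>R expo \<xi> (X (v, s) y)))
    = fourier_on W' (closure (D s (- 1))) \<xi> - fourier_on W' (closure (D s 1)) \<xi>"
proof -
  let ?h = "(v, s)"
  have hn: "?h \<in> Hn" using h vv by (simp add: Hn_def)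
  let ?p = "q + s *\<^sub>R v"
  have [measurable]: "R \<sigma> h \<in> sets borel" for \<sigma> h using R_open by simp
  have clB [measurable]: "closure (D s \<epsilon>) \<in> sets borel" for \<epsilon> by simp
  have AE: "AE x in lborel. generic (H' s) (?p + prj W' x)"
  proof -
    have "AE x in lborel. \<forall>(a, b)\<in>H' s. a \<bullet> (?p + prj W' x) \<noteq> b"
      by (rule AE_flat_generic[OF onW' finH' proper_H'])
    then show ?thesis by eventually_elim (auto simp: generic_def)
  qed
  have fo: "fourier_on W' (closure (D s \<epsilon>)) \<xi> = flat_int W' (\<lambda>y. indicator (closure (D s \<epsilon>)) (?p + y) *\<^sub>R expo \<xi> (?p + y))" for \<epsilon>
    using fourier_on_eq[OF _ prj_hyp] closure_D_sub_hyp unfolding hyp_eq by blast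
  obtain B where B: "\<And>x. x \<in> F \<Longrightarrow> norm x \<le> B"
    using compactF compact_imp_bounded bounded_iff by metis
  have tD: "tame W' (\<lambda>y. indicator (closure (D s \<epsilon>)) (?p + y) *\<^sub>R expo \<xi> (?p + y))" for \<epsilon>
  proof -
    have "tame W' (\<lambda>y. indicator {y. ?p + y \<in> closure (D s \<epsilon>)} y *\<^sub>R expo \<xi> (?p + y))"
    proof (rule tame_indicator_expo)
      show "{y. ?p + y \<in> closure (D s \<epsilon>)} \<in> sets borel" by measurable
      show "norm y \<le> B + norm ?p" if "y \<in> {y. ?p + y \<in> closure (D s \<epsilon>)}" for y
      proof -
        have "norm (?p + y) \<le> B" using B closure_D_sub that by blast
        moreover have "norm y \<le> norm (?p + y) + norm ?p"
          by (metis add.commute add_diff_cancel_right' norm_triangle_ineq4)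
        ultimately show ?thesis by simp
      qed
    qed auto
    then show ?thesis by (simp add: indicator_def)
  qed
  have "expo \<xi> q * (\<Sum>\<sigma>\<in>\<Sigma>. sg \<sigma> ?h * flat_int W' (\<lambda>y. indicator (R \<sigma> ?h) y *\<^sub>R expo \<xi> (X ?h y)))
     = flat_int W' (\<lambda>y. expo \<xi> q * (\<Sum>\<sigma>\<in>\<Sigma>. sg \<sigma> ?h * (indicator (R \<sigma> ?h) y *\<^sub>R expo \<xi> (X ?h y))))"
  proof -
    have "flat_int W' (\<lambda>y. \<Sum>\<sigma>\<in>\<Sigma>. sg \<sigma> ?h * (indicator (R \<sigma> ?h) y *\<^sub>R expo \<xi> (X ?h y))) =
        (\<Sum>\<sigma>\<in>\<Sigma>. sg \<sigma> ?h * flat_int W' (\<lambda>y. indicator (R \<sigma> ?h) y *\<^sub>R expo \<xi> (X ?h y)))"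
      by (rule flat_int_sum[OF onW' tame_R[OF _ hn]])
    then show ?thesis unfolding flat_int_mult by (simp only:)
  qed
  also have "\<dots> = flat_int W' (\<lambda>y. \<Sum>\<epsilon>\<in>{1, - 1 :: real}. (- of_real \<epsilon>) * 
      (indicator (closure (D s \<epsilon>)) (?p + y) *\<^sub>R expo \<xi> (?p + y)))"
  proof (rule flat_int_cong_AE[OF onW' _ _ AE])
    show "(\<lambda>y. expo \<xi> q * (\<Sum>\<sigma>\<in>\<Sigma>. sg \<sigma> ?h * (indicat_real (R \<sigma> ?h) y *\<^sub>R expo \<xi> (X ?h y)))) \<in> borel_measurable borel"
      by measurable
    show "(\<lambda>y. \<Sum>\<epsilon>\<in>{1, - 1 :: real}. (- of_real \<epsilon>) * 
      (indicator (closure (D s \<epsilon>)) (?p + y) *\<^sub>R expo \<xi> (?p + y))) \<in> borel_measurable borel"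
      by measurable
    fix y assume y: "y \<in> perp W'" and g: "generic (H' s) (?p + y)"
    let ?x = "?p + y"
    let ?\<tau> = "signs (H' s) ?x"
    have xh: "?x \<in> hyp s" unfolding hyp_eq using y by blast
    have vy: "v \<bullet> y = 0" using y perp_W' by blast
    have X: "X ?h y = y + s *\<^sub>R v" by (simp add: X_def T_def vy)
    have px: "?x = q + (y + s *\<^sub>R v)" by simp
    have H'H: "H' s \<subseteq> H" by (auto simp: H'_def)
    have g2: "generic (H' s) (y + s *\<^sub>R v)" and s2: "signs (H' s) (y + s *\<^sub>R v) = ?\<tau>"
      using g signs_q[OF H'H] unfolding px by auto
    have hnot: "?h \<notin> ?\<tau>" by (auto simp: signs_def H'_def)
    have Rmem: "y \<in> R \<sigma> ?h \<longleftrightarrow> \<sigma> = insert ?h ?\<tau> \<or> \<sigma> = ?\<tau>" if "\<sigma> \<in> \<Sigma>" for \<sigma>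
    proof -
      have "h \<in> \<sigma> \<longleftrightarrow> h \<in> \<sigma> - {?h}" if "h \<in> H' s" for h using that by (auto simp: H'_def)
      then have oc: "opencell (H' s) \<sigma> = opencell (H' s) (\<sigma> - {?h})"
        unfolding opencell_def by (intro Collect_cong ball_cong refl) (simp only:)
      have sub: "\<sigma> - {?h} \<subseteq> H' s" using that \<Sigma>(1) by (auto simp: H'_def)
      have "y \<in> R \<sigma> ?h \<longleftrightarrow> y + s *\<^sub>R v \<in> opencell (H' s) (\<sigma> - {?h})"
        unfolding R_def mem_Collect_eq X H'_def[symmetric] oc[symmetric] ..
      also have "\<dots> \<longleftrightarrow> \<sigma> - {?h} = ?\<tau>"
      proof
        assume "y + s *\<^sub>R v \<in> opencell (H' s) (\<sigma> - {?h})"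
        from opencell_signs[OF this sub] show "\<sigma> - {?h} = ?\<tau>" unfolding s2 .
      next
        assume "\<sigma> - {?h} = ?\<tau>"
        with signs_opencell[OF g2] s2 show "y + s *\<^sub>R v \<in> opencell (H' s) (\<sigma> - {?h})" by simp
      qed
      also have "\<dots> \<longleftrightarrow> \<sigma> = insert ?h ?\<tau> \<or> \<sigma> = ?\<tau>" using hnot by auto
      finally show ?thesis .
    qed
    have "(\<Sum>\<sigma>\<in>\<Sigma>. sg \<sigma> ?h * (indicat_real (R \<sigma> ?h) y *\<^sub>R expo \<xi> (X ?h y))) = 
       (\<Sum>\<sigma>\<in>\<Sigma>. (if \<sigma> = ?\<tau> then expo \<xi> (X ?h y) else 0) - (if \<sigma> = insert ?h ?\<tau> then expo \<xi> (X ?h y) else 0))"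
    proof (intro sum.cong refl)
      fix \<sigma> assume "\<sigma> \<in> \<Sigma>"
      from Rmem[OF this] hnot show "sg \<sigma> ?h * (indicat_real (R \<sigma> ?h) y *\<^sub>R expo \<xi> (X ?h y)) = 
        (if \<sigma> = ?\<tau> then expo \<xi> (X ?h y) else 0) - (if \<sigma> = insert ?h ?\<tau> then expo \<xi> (X ?h y) else 0)"
        by (auto simp: sg_def indicator_def)
    qed
    also have "\<dots> = (of_bool (below s ?x) - of_bool (above s ?x)) * expo \<xi> (X ?h y)"
      using finite_\<Sigma> h unfolding sum_subtractf by (simp add: sum.delta' below_def above_def)
    finally have L: "expo \<xi> q * (\<Sum>\<sigma>\<in>\<Sigma>. sg \<sigma> ?h * (indicat_real (R \<sigma> ?h) y *\<^sub>R expo \<xi> (X ?h y))) = 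
       (of_bool (below s ?x) - of_bool (above s ?x)) * expo \<xi> ?x"
      unfolding X px by (simp add: expo_add_right)
    have "?x \<in> closure (D s 1) \<longleftrightarrow> above s ?x \<and> \<not> below s ?x"
      using closure_D_generic[of 1, OF _ g] D_iff[OF xh g, of 1] by simp
    moreover have "?x \<in> closure (D s (- 1)) \<longleftrightarrow> below s ?x \<and> \<not> above s ?x"
      using closure_D_generic[of "- 1", OF _ g] D_iff[OF xh g, of "- 1"] by simp
    ultimately show "expo \<xi> q * (\<Sum>\<sigma>\<in>\<Sigma>. sg \<sigma> ?h * (indicat_real (R \<sigma> ?h) y *\<^sub>R expo \<xi> (X ?h y))) = 
      (\<Sum>\<epsilon>\<in>{1, - 1 :: real}. (- of_real \<epsilon>) * (indicator (closure (D s \<epsilon>)) ?x *\<^sub>R expo \<xi> ?x))"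
      unfolding L by (simp add: indicator_def)
  qed
  also have "\<dots> = (\<Sum>\<epsilon>\<in>{1, - 1 :: real}. (- of_real \<epsilon>) * fourier_on W' (closure (D s \<epsilon>)) \<xi>)"
    unfolding fo by (rule flat_int_sum[OF onW' tD])
  finally show ?thesis by simp
qed

text \<open>
  The height over \<open>h\<close> is affine with gradient \<open>v - fst h\<close>, so on the base the exponential has the
  frequency \<open>prj W' \<xi> - (\<xi> \<bullet> v) *\<^sub>R (fst h - v)\<close>, in which the second term prevails when the
  component of \<open>\<xi>\<close> in \<open>perp W'\<close> is small enough.
\<close>

lemma oblique_face_bound:
  assumes h: "h \<in> Hn" "fst h \<noteq> v" and \<sigma>: "\<sigma> \<in> \<Sigma>"
  obtains M where "M \<ge> 0" "\<And>\<xi>. \<xi> \<bullet> v \<noteq> 0 \<Longrightarrow> norm (prj W' \<xi>) \<le> norm (fst h - v) / 2 * \<bar>\<xi> \<bullet> v\<bar> \<Longrightarrow>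
     norm (flat_int W' (\<lambda>y. indicator (R \<sigma> h) y *\<^sub>R expo \<xi> (X h y))) \<le> M / \<bar>\<xi> \<bullet> v\<bar>"
proof -
  obtain B where "\<And>y. y \<in> perp W \<Longrightarrow> y \<in> closedcell H \<sigma> \<Longrightarrow> norm y \<le> B"
    using cell_bound \<sigma> by metis
  then have "norm y \<le> B" if "y \<in> perp W'" "y \<in> R \<sigma> h" for y
    using R_bound h(1) that by metis
  then obtain M where M: "M \<ge> 0" "\<And>\<zeta>. \<zeta> \<in> perp W' \<Longrightarrow> \<zeta> \<noteq> 0 \<Longrightarrow> 
        norm (flat_int W' (\<lambda>y. indicator (R \<sigma> h) y *\<^sub>R expo \<zeta> y)) \<le> M / norm \<zeta>"
    using flat_osc[OF onW' _ R_convex, of \<sigma> h B] R_open[of \<sigma> h] by auto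
  define d where "d = norm (fst h - v)"
  have d: "d > 0" using h(2) by (simp add: d_def)
  have a: "fst h \<in> perp W" "v \<bullet> fst h = 1" using h(1) H[of "fst h" "snd h"] by (auto simp: Hn_def)
  have pa: "prj W' (fst h) = fst h - v" by (simp add: prj_W' prj_id[OF a(1)] a(2))
  show thesis
  proof (rule that)
    show "0 \<le> M * 2 / d" using M d by simp
    fix \<xi> assume t: "\<xi> \<bullet> v \<noteq> 0" and small: "norm (prj W' \<xi>) \<le> norm (fst h - v) / 2 * \<bar>\<xi> \<bullet> v\<bar>"
    define t' where "t' = \<xi> \<bullet> v"
    define \<zeta> where "\<zeta> = prj W' (\<xi> - t' *\<^sub>R fst h)"
    have \<zeta>: "\<zeta> \<in> perp W'" unfolding \<zeta>_def by (rule prj_in_perp[OF onW'])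
    have "norm (t' *\<^sub>R (fst h - v)) \<le> norm (t' *\<^sub>R (fst h - v) - prj W' \<xi>) + norm (prj W' \<xi>)"
      by (metis diff_add_cancel norm_triangle_ineq)
    also have "norm (t' *\<^sub>R (fst h - v) - prj W' \<xi>) = norm \<zeta>"
      unfolding \<zeta>_def prj_diff prj_scale pa by (rule norm_minus_commute)
    finally have n\<zeta>: "norm \<zeta> \<ge> \<bar>t'\<bar> * d / 2" using small unfolding t'_def d_def by (simp add: mult.commute)
    have pos: "\<bar>t'\<bar> * d / 2 > 0" using t d by (simp add: t'_def)
    then have \<zeta>0: "\<zeta> \<noteq> 0" using n\<zeta> by auto
    have "flat_int W' (\<lambda>y. indicator (R \<sigma> h) y *\<^sub>R expo \<xi> (X h y)) = 
        flat_int W' (\<lambda>y. expo t' (snd h) * (indicator (R \<sigma> h) y *\<^sub>R expo \<zeta> y))"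
    proof (rule flat_int_cong[OF onW'])
      fix y assume y: "y \<in> perp W'"
      have "\<zeta> \<bullet> y = (\<xi> - t' *\<^sub>R fst h) \<bullet> y" unfolding \<zeta>_def by (rule inner_prj_left[OF y])
      then have "\<xi> \<bullet> X h y = t' * snd h + \<zeta> \<bullet> y"
        by (simp add: X_def T_def inner_add_right inner_diff_left t'_def algebra_simps)
      then have "expo \<xi> (X h y) = expo t' (snd h) * expo \<zeta> y"
        by (simp add: expo_def distrib_left exp_add)
      then show "indicator (R \<sigma> h) y *\<^sub>R expo \<xi> (X h y) = expo t' (snd h) * (indicator (R \<sigma> h) y *\<^sub>R expo \<zeta> y)"
        by simp
    qed
    then have "norm (flat_int W' (\<lambda>y. indicator (R \<sigma> h) y *\<^sub>R expo \<xi> (X h y))) = 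
       norm (flat_int W' (\<lambda>y. indicator (R \<sigma> h) y *\<^sub>R expo \<zeta> y))"
      unfolding flat_int_mult by (simp add: norm_mult)
    also have "\<dots> \<le> M / norm \<zeta>" by (rule M(2)[OF \<zeta> \<zeta>0])
    also have "\<dots> \<le> M / (\<bar>t'\<bar> * d / 2)" using n\<zeta> pos M(1) \<zeta>0
      by (intro divide_left_mono mult_pos_pos) (simp_all only: zero_less_norm_iff not_False_eq_True)
    also have "\<dots> = M * 2 / d / \<bar>\<xi> \<bullet> v\<bar>" by (simp add: t'_def)
    finally show "norm (flat_int W' (\<lambda>y. indicator (R \<sigma> h) y *\<^sub>R expo \<xi> (X h y))) \<le> M * 2 / d / \<bar>\<xi> \<bullet> v\<bar>" .
  qed
qed

text \<open>
  The hyperplanes orthogonal to \<open>v\<close> give the sum over facets, and all others enter the error. The minus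
  sign on the left reflects that \<open>side_sign\<close> is positive where \<open>F\<close> lies above its facet, which is then a
  lower end of the integration along \<open>v\<close>.
\<close>

lemma fourier_step:
  obtains C c where "c > 0" "\<And>\<xi>. \<xi> \<bullet> v \<noteq> 0 \<Longrightarrow> norm (prj W' \<xi>) \<le> c * \<bar>\<xi> \<bullet> v\<bar> \<Longrightarrow>
     norm (- (2 * of_real pi * \<i> * of_real (\<xi> \<bullet> v)) * fourier_on W F \<xi> - 
       (\<Sum>G\<in>par_facets. of_real (side_sign {x \<in> perp W. v \<bullet> x \<ge> 0} F G) * fourier_on W' G \<xi>)) 
     \<le> C / \<bar>\<xi> \<bullet> v\<bar>"
proof -
  let ?r = "\<lambda>\<xi> \<sigma> h. flat_int W' (\<lambda>y. indicator (R \<sigma> h) y *\<^sub>R expo \<xi> (X h y))"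
  let ?Ho = "{h \<in> Hn. fst h \<noteq> v}" and ?Hp = "{h \<in> Hn. fst h = v}"
  have finHo: "finite ?Ho" using finHn by simp
  define P where "P \<sigma> h M \<longleftrightarrow> (\<forall>\<xi>. \<xi> \<bullet> v \<noteq> 0 \<longrightarrow> norm (prj W' \<xi>) \<le> norm (fst h - v) / 2 * \<bar>\<xi> \<bullet> v\<bar> \<longrightarrow>
     norm (?r \<xi> \<sigma> h) \<le> M / \<bar>\<xi> \<bullet> v\<bar>)" for \<sigma> h M
  define M where "M \<sigma> h = (SOME m. P \<sigma> h m)" for \<sigma> h
  have M: "norm (?r \<xi> \<sigma> h) \<le> M \<sigma> h / \<bar>\<xi> \<bullet> v\<bar>" 
    if "\<sigma> \<in> \<Sigma>" "h \<in> ?Ho" "\<xi> \<bullet> v \<noteq> 0" "norm (prj W' \<xi>) \<le> norm (fst h - v) / 2 * \<bar>\<xi> \<bullet> v\<bar>" for \<sigma> h \<xi>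
  proof -
    have "\<exists>m. P \<sigma> h m"
    proof (rule oblique_face_bound)
      show "h \<in> Hn" "fst h \<noteq> v" "\<sigma> \<in> \<Sigma>" using that by auto
    qed (auto simp: P_def)
    then have "P \<sigma> h (M \<sigma> h)" unfolding M_def by (rule someI_ex)
    then show ?thesis using that(3,4) unfolding P_def by blast
  qed
  \<comment> \<open>Inserting \<open>1\<close> covers the case that there are no oblique hyperplanes.\<close>
  define c where "c = Min (insert 1 ((\<lambda>h. norm (fst h - v) / 2) ` ?Ho))"
  have c0: "c > 0" unfolding c_def using finHo by (subst Min_gr_iff) auto
  have c1: "c \<le> norm (fst h - v) / 2" if "h \<in> ?Ho" for h
    unfolding c_def using finHo that by (intro Min_le) auto
  define C where "C = (\<Sum>h\<in>?Ho. \<Sum>\<sigma>\<in>\<Sigma>. M \<sigma> h)"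
  show thesis
  proof (rule that[OF c0])
    fix \<xi> assume t: "\<xi> \<bullet> v \<noteq> 0" and small: "norm (prj W' \<xi>) \<le> c * \<bar>\<xi> \<bullet> v\<bar>"
    let ?S = "\<lambda>h. expo \<xi> q * (\<Sum>\<sigma>\<in>\<Sigma>. sg \<sigma> h * ?r \<xi> \<sigma> h)"
    have "(2 * of_real pi * \<i> * of_real (\<xi> \<bullet> v)) * fourier_on W F \<xi> = sum ?S Hn"
      by (rule fourier_F_faces[OF t])
    also have "Hn = ?Hp \<union> ?Ho" by blast
    also have "sum ?S (?Hp \<union> ?Ho) = sum ?S ?Hp + sum ?S ?Ho"
      using finHn by (intro sum.union_disjoint) auto
    also have "sum ?S ?Hp = (\<Sum>s\<in>{s. (v, s) \<in> H}. ?S (v, s))"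
    proof -
      have "?Hp = (\<lambda>s. (v, s)) ` {s. (v, s) \<in> H}" using vv by (auto simp: Hn_def)
      then show ?thesis by (simp add: sum.reindex inj_on_def)
    qed
    also have "\<dots> = (\<Sum>s\<in>{s. (v, s) \<in> H}. fourier_on W' (closure (D s (- 1))) \<xi> - fourier_on W' (closure (D s 1)) \<xi>)"
      using parallel_face_term by (intro sum.cong refl) simp
    also have "\<dots> = - (\<Sum>s\<in>{s. (v, s) \<in> H}. fourier_on W' (closure (D s 1)) \<xi> - fourier_on W' (closure (D s (- 1))) \<xi>)"
      unfolding sum_negf[symmetric] by simp
    also have "\<dots> = - (\<Sum>G\<in>par_facets. of_real (side_sign {x \<in> perp W. v \<bullet> x \<ge> 0} F G) * fourier_on W' G \<xi>)"
      using sum_par_facets[of "\<lambda>G. fourier_on W' G \<xi>"] by simp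
    finally have eq: "- (2 * of_real pi * \<i> * of_real (\<xi> \<bullet> v)) * fourier_on W F \<xi> - 
       (\<Sum>G\<in>par_facets. of_real (side_sign {x \<in> perp W. v \<bullet> x \<ge> 0} F G) * fourier_on W' G \<xi>) = - sum ?S ?Ho"
      by (simp add: algebra_simps)
    have "norm (sum ?S ?Ho) \<le> (\<Sum>h\<in>?Ho. \<Sum>\<sigma>\<in>\<Sigma>. M \<sigma> h / \<bar>\<xi> \<bullet> v\<bar>)"
    proof (rule sum_norm_le)
      fix h assume h: "h \<in> ?Ho"
      have "norm (prj W' \<xi>) \<le> norm (fst h - v) / 2 * \<bar>\<xi> \<bullet> v\<bar>"
        using small c1[OF h] by (meson abs_ge_zero mult_right_mono order_trans)
      from M[OF _ h t this] have 1: "norm (?r \<xi> \<sigma> h) \<le> M \<sigma> h / \<bar>\<xi> \<bullet> v\<bar>" if "\<sigma> \<in> \<Sigma>" for \<sigma>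
        using that .
      have "norm (?S h) = norm (\<Sum>\<sigma>\<in>\<Sigma>. sg \<sigma> h * ?r \<xi> \<sigma> h)" by (simp add: norm_mult)
      also have "\<dots> \<le> (\<Sum>\<sigma>\<in>\<Sigma>. M \<sigma> h / \<bar>\<xi> \<bullet> v\<bar>)"
        using 1 by (intro sum_norm_le) (simp add: norm_mult sg_def)
      finally show "norm (?S h) \<le> (\<Sum>\<sigma>\<in>\<Sigma>. M \<sigma> h / \<bar>\<xi> \<bullet> v\<bar>)" .
    qed
    also have "\<dots> = C / \<bar>\<xi> \<bullet> v\<bar>" unfolding C_def by (simp add: sum_divide_distrib)
    finally show "norm (- (2 * of_real pi * \<i> * of_real (\<xi> \<bullet> v)) * fourier_on W F \<xi> - 
       (\<Sum>G\<in>par_facets. of_real (side_sign {x \<in> perp W. v \<bullet> x \<ge> 0} F G) * fourier_on W' G \<xi>)) 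
     \<le> C / \<bar>\<xi> \<bullet> v\<bar>" unfolding eq by simp
  qed
qed

end

section \<open>Volume on a flat\<close>

lemma orthonormal_Un:
  assumes "orthonormal B" "orthonormal W" "B \<subseteq> perp W"
  shows "orthonormal (B \<union> W)" "B \<inter> W = {}"
proof -
  have "b \<bullet> w = 0" if "b \<in> B" "w \<in> W" for b w
    using assms(3) that by (auto simp: perp_def inner_commute)
  then show "orthonormal (B \<union> W)"
    using assms(1,2) unfolding orthonormal_def pairwise_def orthogonal_def
    by (metis UnE inner_commute)
  show "B \<inter> W = {}"
  proof (rule ccontr)
    assume "B \<inter> W \<noteq> {}"
    then obtain x where "x \<in> B" "x \<in> W" by blast
    then have "x \<bullet> x = 0" "norm x = 1" using assms unfolding orthonormal_def perp_def by blast+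
    then show False by simp
  qed
qed

lemma nn_integral_lborel_translate:
  fixes f :: "'a::euclidean_space \<Rightarrow> ennreal"
  assumes [measurable]: "f \<in> borel_measurable borel"
  shows "(\<integral>\<^sup>+x. f (x + c) \<partial>lborel) = (\<integral>\<^sup>+x. f x \<partial>lborel)"
proof -
  have "(\<integral>\<^sup>+x. f x \<partial>lborel) = (\<integral>\<^sup>+x. f x \<partial>distr lborel borel ((+) c))"
    by (simp add: lborel_distr_plus)
  also have "\<dots> = (\<integral>\<^sup>+x. f (c + x) \<partial>lborel)" by (subst nn_integral_distr) auto
  finally show ?thesis by (simp add: add.commute)
qed

text \<open>
  Let \<open>B\<close> be the unit ball. Integrating \<open>indicator A x * indicator B (g y - x)\<close> over both variables
  gives the volume of \<open>A\<close> times that of \<open>B\<close> in one order, and the volume of the preimage of \<open>A\<close> under \<open>g\<close>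
  times that of \<open>B\<close> in the other, by invariance under translations and \<open>g -` B = B\<close>.
\<close>

lemma distr_lborel_orthogonal:
  fixes g :: "'a::euclidean_space \<Rightarrow> 'a"
  assumes g: "orthogonal_transformation g"
  shows "distr lborel borel g = lborel"
proof (rule measure_eqI)
  fix A assume "A \<in> sets (distr lborel borel g)"
  then have A [measurable]: "A \<in> sets borel" by simp
  have lin: "linear g" using g orthogonal_transformation_linear by blast
  then have [measurable]: "g \<in> borel_measurable borel"
    by (intro borel_measurable_continuous_onI linear_continuous_on) (simp add: linear_conv_bounded_linear)
  have bij: "bij g" using g orthogonal_transformation_bij by blast
  define g' where "g' = inv g"
  have gg': "g (g' x) = x" for x unfolding g'_def using bij by (simp add: bij_is_surj surj_f_inv_f)
  define B where "B = ball (0::'a) 1"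
  have [measurable]: "B \<in> sets borel" by (simp add: B_def)
  have gB: "g y \<in> B \<longleftrightarrow> y \<in> B" for y using g by (simp add: B_def orthogonal_transformation)
  have V: "emeasure lborel B \<noteq> 0" "emeasure lborel B \<noteq> \<infinity>"
  proof -
    show "emeasure lborel B \<noteq> \<infinity>" using emeasure_bounded_finite[of B] by (simp add: B_def less_top)
    have "measure lborel B > 0" unfolding B_def by (rule content_ball_pos) simp
    then show "emeasure lborel B \<noteq> 0" by (auto simp: measure_def)
  qed
  let ?f = "\<lambda>x y. indicator A x * indicator B (g y - x) :: ennreal"
  have "emeasure lborel A * emeasure lborel B = (\<integral>\<^sup>+x. indicator A x * emeasure lborel B \<partial>lborel)"
    by (simp add: nn_integral_multc)
  also have "\<dots> = (\<integral>\<^sup>+x. (\<integral>\<^sup>+y. ?f x y \<partial>lborel) \<partial>lborel)"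
  proof (rule nn_integral_cong)
    fix x
    have "(\<integral>\<^sup>+y. indicator B (g y - x) \<partial>lborel) = (\<integral>\<^sup>+y. indicator B (g (y + - g' x)) \<partial>lborel)"
      using lin by (simp add: linear_diff gg')
    also have "\<dots> = (\<integral>\<^sup>+y. indicator B (g y) \<partial>lborel)"
      by (rule nn_integral_lborel_translate[where f = "\<lambda>y. indicator B (g y)"]) measurable
    also have "\<dots> = emeasure lborel B" by (simp add: gB indicator_def flip: nn_integral_indicator)
    finally show "indicator A x * emeasure lborel B = (\<integral>\<^sup>+y. ?f x y \<partial>lborel)"
      by (simp add: nn_integral_cmult)
  qed
  also have "\<dots> = (\<integral>\<^sup>+y. (\<integral>\<^sup>+x. ?f x y \<partial>lborel) \<partial>lborel)"
    by (rule lborel_pair.Fubini'[symmetric]) measurable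
  also have "\<dots> = (\<integral>\<^sup>+y. (\<integral>\<^sup>+x. indicator A (x + g y) * indicator B x \<partial>lborel) \<partial>lborel)"
  proof (rule nn_integral_cong)
    fix y
    have "(\<integral>\<^sup>+x. ?f x y \<partial>lborel) = (\<integral>\<^sup>+x. ?f (x + g y) y \<partial>lborel)"
      by (rule nn_integral_lborel_translate[symmetric]) measurable
    also have "\<dots> = (\<integral>\<^sup>+x. indicator A (x + g y) * indicator B x \<partial>lborel)"
      by (simp add: B_def indicator_def)
    finally show "(\<integral>\<^sup>+x. ?f x y \<partial>lborel) = (\<integral>\<^sup>+x. indicator A (x + g y) * indicator B x \<partial>lborel)" .
  qed
  also have "\<dots> = (\<integral>\<^sup>+x. (\<integral>\<^sup>+y. indicator A (x + g y) * indicator B x \<partial>lborel) \<partial>lborel)"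
    by (rule lborel_pair.Fubini'[symmetric]) measurable
  also have "\<dots> = (\<integral>\<^sup>+x. emeasure (distr lborel borel g) A * indicator B x \<partial>lborel)"
  proof (rule nn_integral_cong)
    fix x
    have "(\<integral>\<^sup>+y. indicator A (x + g y) \<partial>lborel) = (\<integral>\<^sup>+y. indicator A (g (y + g' x)) \<partial>lborel)"
      using lin by (simp add: linear_add gg' add.commute)
    also have "\<dots> = (\<integral>\<^sup>+y. indicator A (g y) \<partial>lborel)"
      by (rule nn_integral_lborel_translate[where f = "\<lambda>y. indicator A (g y)"]) measurable
    also have "\<dots> = (\<integral>\<^sup>+y. indicator A y \<partial>distr lborel borel g)"
      by (subst nn_integral_distr) auto
    also have "\<dots> = emeasure (distr lborel borel g) A" by simp
    finally show "(\<integral>\<^sup>+y. indicator A (x + g y) * indicator B x \<partial>lborel) = emeasure (distr lborel borel g) A * indicator B x"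
      by (simp add: nn_integral_multc)
  qed
  also have "\<dots> = emeasure (distr lborel borel g) A * emeasure lborel B"
    by (simp add: nn_integral_cmult)
  finally show "emeasure (distr lborel borel g) A = emeasure lborel A"
    using V mult_divide_eq_ennreal[of "emeasure lborel B"] by (metis infinity_ennreal_def)
qed simp

lemma orthonormal_sum_inner:
  assumes "orthonormal E" "b \<in> E"
  shows "b \<bullet> (\<Sum>c\<in>E. f c *\<^sub>R c) = f b"
proof -
  have "b \<bullet> (\<Sum>c\<in>E. f c *\<^sub>R c) = (\<Sum>c\<in>E. if c = b then f c else 0)"
    unfolding inner_sum_right by (intro sum.cong refl) (use orthonormal_inner[OF assms(1,2)] in auto)
  then show ?thesis using assms(2) orthonormal_finite[OF assms(1)] by simp
qed

interpretation lborel_real: product_sigma_finite "\<lambda>_::'i. lborel :: real measure" ..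

lemma measurable_PiM_combination:
  fixes f :: "'b \<Rightarrow> 'a::euclidean_space"
  shows "(\<lambda>c. \<Sum>b\<in>E. c b *\<^sub>R f b) \<in> borel_measurable (\<Pi>\<^sub>M b\<in>E. (lborel :: real measure))"
proof (intro borel_measurable_sum borel_measurable_scaleR borel_measurable_const)
  fix b assume "b \<in> E"
  then show "(\<lambda>c. c b) \<in> borel_measurable (\<Pi>\<^sub>M b\<in>E. (lborel :: real measure))"
    using measurable_component_singleton[of b E "\<lambda>_. lborel :: real measure"] by simp
qed

lemma distr_PiM_bij_Basis:
  fixes \<phi> :: "'b \<Rightarrow> 'a::euclidean_space"
  assumes \<phi>: "bij_betw \<phi> E Basis"
  shows "distr (\<Pi>\<^sub>M b\<in>E. lborel) borel (\<lambda>c. \<Sum>b\<in>E. c b *\<^sub>R \<phi> b) = lborel"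
proof (rule lborel_eqI[symmetric])
  have fin: "finite E" using bij_betw_finite[OF \<phi>] by simp
  have m [measurable]: "(\<lambda>c. \<Sum>b\<in>E. c b *\<^sub>R \<phi> b) \<in> borel_measurable (\<Pi>\<^sub>M b\<in>E. lborel)"
    by (rule measurable_PiM_combination)
  fix l u :: 'a assume le: "\<And>b. b \<in> Basis \<Longrightarrow> l \<bullet> b \<le> u \<bullet> b"
  have ip: "(\<Sum>b\<in>E. c b *\<^sub>R \<phi> b) \<bullet> \<phi> b' = c b'" if "b' \<in> E" for c :: "'b \<Rightarrow> real" and b'
  proof -
    have "(\<Sum>b\<in>E. c b *\<^sub>R \<phi> b) \<bullet> \<phi> b' = (\<Sum>b\<in>E. if b = b' then c b else 0)"
      unfolding inner_sum_left
    proof (intro sum.cong refl)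
      fix b assume "b \<in> E"
      then have "\<phi> b \<in> Basis" "\<phi> b' \<in> Basis" "\<phi> b = \<phi> b' \<longleftrightarrow> b = b'"
        using \<phi> that by (auto simp: bij_betw_def inj_on_def)
      then show "c b *\<^sub>R \<phi> b \<bullet> \<phi> b' = (if b = b' then c b else 0)" by (simp add: inner_Basis)
    qed
    then show ?thesis using fin that by simp
  qed
  have "(\<lambda>c. \<Sum>b\<in>E. c b *\<^sub>R \<phi> b) -` box l u \<inter> space (\<Pi>\<^sub>M b\<in>E. lborel) = 
     (\<Pi>\<^sub>E b\<in>E. {l \<bullet> \<phi> b<..<u \<bullet> \<phi> b})" (is "?L = ?R")
  proof (rule set_eqI)
    fix c
    have "(\<Sum>b\<in>E. c b *\<^sub>R \<phi> b) \<in> box l u \<longleftrightarrow> (\<forall>b\<in>E. l \<bullet> \<phi> b < c b \<and> c b < u \<bullet> \<phi> b)"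
    proof -
      have *: "Basis = \<phi> ` E" using \<phi> by (simp add: bij_betw_def)
      show ?thesis unfolding mem_box * by (simp add: ip)
    qed
    then show "c \<in> ?L \<longleftrightarrow> c \<in> ?R" by (auto simp: space_PiM PiE_def Pi_def)
  qed
  then have "emeasure (distr (\<Pi>\<^sub>M b\<in>E. lborel) borel (\<lambda>c. \<Sum>b\<in>E. c b *\<^sub>R \<phi> b)) (box l u) = 
     emeasure (\<Pi>\<^sub>M b\<in>E. lborel) (\<Pi>\<^sub>E b\<in>E. {l \<bullet> \<phi> b<..<u \<bullet> \<phi> b})"
    by (subst emeasure_distr) auto
  also have "\<dots> = (\<Prod>b\<in>E. emeasure lborel {l \<bullet> \<phi> b<..<u \<bullet> \<phi> b})"
    by (rule lborel_real.emeasure_PiM[OF fin]) auto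
  also have "\<dots> = (\<Prod>b\<in>E. ennreal ((u - l) \<bullet> \<phi> b))"
  proof (intro prod.cong refl)
    fix b assume "b \<in> E"
    then have "l \<bullet> \<phi> b \<le> u \<bullet> \<phi> b" using le \<phi> by (auto simp: bij_betw_def)
    then show "emeasure lborel {l \<bullet> \<phi> b<..<u \<bullet> \<phi> b} = ennreal ((u - l) \<bullet> \<phi> b)"
      by (simp add: inner_diff_left)
  qed
  also have "\<dots> = (\<Prod>b\<in>Basis. ennreal ((u - l) \<bullet> b))"
    by (rule prod.reindex_bij_betw[OF \<phi>])
  also have "\<dots> = ennreal (\<Prod>b\<in>Basis. (u - l) \<bullet> b)"
    using le by (intro prod_ennreal) (auto simp: inner_diff_left)
  finally show "emeasure (distr (\<Pi>\<^sub>M b\<in>E. lborel) borel (\<lambda>c. \<Sum>b\<in>E. c b *\<^sub>R \<phi> b)) (box l u) = 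
     ennreal (\<Prod>b\<in>Basis. (u - l) \<bullet> b)" .
qed simp

lemma orthonormal_independent: "orthonormal E \<Longrightarrow> independent E"
  unfolding orthonormal_def by (rule pairwise_orthogonal_independent) auto

text \<open>
  A bijection \<open>\<phi>\<close> onto the standard basis extends to an orthogonal map, and the distribution of
  \<open>\<Sum>b\<in>E. c b *\<^sub>R \<phi> b\<close> can be read off on boxes.
\<close>

lemma distr_PiM_orthonormal:
  fixes E :: "'a::euclidean_space set"
  assumes E: "orthonormal E" "span E = UNIV"
  shows "distr (\<Pi>\<^sub>M b\<in>E. lborel) borel (\<lambda>c. \<Sum>b\<in>E. c b *\<^sub>R b) = lborel"
proof -
  have fin: "finite E" using E orthonormal_finite by blast
  have "card E = card (Basis :: 'a set)"
    using dim_span_eq_card_independent[OF orthonormal_independent[OF E(1)]] E(2) by simp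
  then obtain \<phi> where \<phi>: "bij_betw \<phi> E (Basis :: 'a set)"
    using finite_same_card_bij[OF fin finite_Basis] by blast
  let ?g = "\<lambda>y::'a. \<Sum>b\<in>E. (\<phi> b \<bullet> y) *\<^sub>R b"
  have lin: "linear ?g"
    by (rule linearI) (simp_all add: inner_add_right scaleR_add_left sum.distrib scaleR_sum_right)
  have "norm (?g y) = norm y" for y
  proof -
    have "norm (?g y) ^ 2 = (\<Sum>b\<in>E. norm ((\<phi> b \<bullet> y) *\<^sub>R b) ^ 2)"
      using E(1) unfolding orthonormal_def
      by (intro norm_sum_Pythagorean fin) (auto simp: pairwise_def orthogonal_def)
    also have "\<dots> = (\<Sum>b\<in>E. (\<phi> b \<bullet> y) ^ 2)"
      using E(1) by (intro sum.cong refl) (simp add: orthonormal_def)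
    also have "\<dots> = (\<Sum>i\<in>Basis. (i \<bullet> y) ^ 2)" by (rule sum.reindex_bij_betw[OF \<phi>])
    also have "\<dots> = norm y ^ 2"
      unfolding norm_eq_sqrt_inner euclidean_inner[of y y]
      by (simp add: power2_eq_square inner_commute sum_nonneg)
    finally show ?thesis by simp
  qed
  then have og: "orthogonal_transformation ?g" using lin orthogonal_transformation by blast
  have [measurable]: "?g \<in> borel_measurable borel" by measurable
  let ?h = "\<lambda>c. \<Sum>b\<in>E. c b *\<^sub>R \<phi> b"
  have mh [measurable]: "?h \<in> borel_measurable (\<Pi>\<^sub>M b\<in>E. lborel)"
    by (rule measurable_PiM_combination)
  have "?g (?h c) = (\<Sum>b\<in>E. c b *\<^sub>R b)" for c
  proof (intro sum.cong refl)
    fix b assume b: "b \<in> E"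
    have "\<phi> b \<bullet> ?h c = (\<Sum>b'\<in>E. if b' = b then c b' else 0)"
      unfolding inner_sum_right
    proof (intro sum.cong refl)
      fix b' assume "b' \<in> E"
      then have "\<phi> b \<in> Basis" "\<phi> b' \<in> Basis" "\<phi> b = \<phi> b' \<longleftrightarrow> b = b'"
        using \<phi> b by (auto simp: bij_betw_def inj_on_def)
      then show "\<phi> b \<bullet> c b' *\<^sub>R \<phi> b' = (if b' = b then c b' else 0)" by (auto simp: inner_Basis)
    qed
    then show "(\<phi> b \<bullet> ?h c) *\<^sub>R b = c b *\<^sub>R b" using fin b by simp
  qed
  then have "distr (\<Pi>\<^sub>M b\<in>E. lborel) borel (\<lambda>c. \<Sum>b\<in>E. c b *\<^sub>R b) = 
      distr (\<Pi>\<^sub>M b\<in>E. lborel) borel (?g \<circ> ?h)" by (simp add: o_def)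
  also have "\<dots> = distr (distr (\<Pi>\<^sub>M b\<in>E. lborel) borel ?h) borel ?g"
    by (rule distr_distr[symmetric]) measurable
  also have "\<dots> = lborel" unfolding distr_PiM_bij_Basis[OF \<phi>] distr_lborel_orthogonal[OF og] ..
  finally show ?thesis .
qed

text \<open>
  The set \<open>B \<union> W\<close> is an orthonormal basis of the whole space. In these coordinates the set on the right
  is the product of the set on the left and the unit cube.
\<close>

lemma measure_PiM_thicken:
  fixes F :: "'a::euclidean_space set"
  assumes W: "orthonormal W" and B: "orthonormal B" "span B = perp W" and F [measurable]: "F \<in> sets borel"
  shows "measure (\<Pi>\<^sub>M b\<in>B. lborel) {c \<in> space (\<Pi>\<^sub>M b\<in>B. lborel). p + (\<Sum>b\<in>B. c b *\<^sub>R b) \<in> F} 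
     = measure lborel {x \<in> slab W. p + prj W x \<in> F}"
proof -
  have BW: "B \<subseteq> perp W" using B span_superset by blast
  note E = orthonormal_Un[OF B(1) W BW]
  have finB: "finite B" and finW: "finite W" using B W orthonormal_finite by blast+
  have spanE: "span (B \<union> W) = UNIV"
  proof -
    have "x \<in> span (B \<union> W)" for x
    proof -
      have "prj W x \<in> span B" using prj_in_perp[OF W] B(2) by simp
      then have "prj W x \<in> span (B \<union> W)" by (meson span_mono subsetD sup_ge1)
      moreover have "(\<Sum>w\<in>W. (w \<bullet> x) *\<^sub>R w) \<in> span (B \<union> W)"
        by (intro span_sum span_scale span_base) auto
      ultimately have "prj W x + (\<Sum>w\<in>W. (w \<bullet> x) *\<^sub>R w) \<in> span (B \<union> W)" by (rule span_add)
      then show ?thesis by (simp add: prj_def)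
    qed
    then show ?thesis by blast
  qed
  let ?E = "B \<union> W"
  let ?g = "\<lambda>c. \<Sum>b\<in>?E. c b *\<^sub>R b"
  let ?k = "\<lambda>c. p + (\<Sum>b\<in>B. c b *\<^sub>R b)"
  have [measurable]: "slab W \<in> sets borel" by (rule slab_borel[OF W])
  have mg [measurable]: "?g \<in> borel_measurable (\<Pi>\<^sub>M b\<in>?E. lborel)"
    by (rule measurable_PiM_combination)
  have mk [measurable]: "?k \<in> borel_measurable (\<Pi>\<^sub>M b\<in>B. lborel)"
    by (intro borel_measurable_add borel_measurable_const measurable_PiM_combination)
  let ?S = "{x \<in> slab W. p + prj W x \<in> F}"
  have S [measurable]: "?S \<in> sets borel" by measurable
  have "emeasure lborel ?S = emeasure (distr (\<Pi>\<^sub>M b\<in>?E. lborel) borel ?g) ?S"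
    unfolding distr_PiM_orthonormal[OF E(1) spanE] ..
  also have "\<dots> = (\<integral>\<^sup>+c. indicator ?S (?g c) \<partial>(\<Pi>\<^sub>M b\<in>?E. lborel))"
  proof -
    have "emeasure (distr (\<Pi>\<^sub>M b\<in>?E. lborel) borel ?g) ?S = 
        (\<integral>\<^sup>+z. indicator ?S z \<partial>distr (\<Pi>\<^sub>M b\<in>?E. lborel) borel ?g)" by simp
    also have "\<dots> = (\<integral>\<^sup>+c. indicator ?S (?g c) \<partial>(\<Pi>\<^sub>M b\<in>?E. lborel))"
      by (rule nn_integral_distr) measurable
    finally show ?thesis .
  qed
  also have "\<dots> = (\<integral>\<^sup>+x. (\<integral>\<^sup>+y. indicator ?S (?g (merge B W (x, y))) \<partial>(\<Pi>\<^sub>M b\<in>W. lborel)) \<partial>(\<Pi>\<^sub>M b\<in>B. lborel))"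
    by (rule lborel_real.product_nn_integral_fold[OF E(2) finB finW]) measurable
  also have "\<dots> = (\<integral>\<^sup>+x. (\<integral>\<^sup>+y. indicator F (?k x) * indicator (\<Pi>\<^sub>E w\<in>W. {0..<1::real}) y \<partial>(\<Pi>\<^sub>M b\<in>W. lborel)) \<partial>(\<Pi>\<^sub>M b\<in>B. lborel))"
  proof (rule nn_integral_cong, rule nn_integral_cong)
    fix x y :: "'a \<Rightarrow> real" assume y: "y \<in> space (\<Pi>\<^sub>M b\<in>W. lborel)"
    let ?m = "merge B W (x, y)"
    have "?g ?m = (\<Sum>b\<in>B. ?m b *\<^sub>R b) + (\<Sum>b\<in>W. ?m b *\<^sub>R b)"
      by (rule sum.union_disjoint[OF finB finW E(2)])
    also have "(\<Sum>b\<in>B. ?m b *\<^sub>R b) = (\<Sum>b\<in>B. x b *\<^sub>R b)" by (intro sum.cong refl) (simp add: merge_def)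
    also have "(\<Sum>b\<in>W. ?m b *\<^sub>R b) = (\<Sum>b\<in>W. y b *\<^sub>R b)" 
      using E(2) by (intro sum.cong refl) (auto simp: merge_def)
    finally have g: "?g ?m = (\<Sum>b\<in>B. x b *\<^sub>R b) + (\<Sum>b\<in>W. y b *\<^sub>R b)" .
    have xB: "(\<Sum>b\<in>B. x b *\<^sub>R b) \<in> perp W"
      unfolding B(2)[symmetric] by (intro span_sum span_scale span_base)
    have wg: "w \<bullet> ?g ?m = y w" if "w \<in> W" for w
      using xB that orthonormal_sum_inner[OF W that, of y] unfolding g perp_def by (simp add: inner_add_right)
    then have pg: "prj W (?g ?m) = (\<Sum>b\<in>B. x b *\<^sub>R b)" by (simp add: prj_def g)
    have "?g ?m \<in> slab W \<longleftrightarrow> y \<in> (\<Pi>\<^sub>E w\<in>W. {0..<1::real})"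
      using y wg by (auto simp: slab_def space_PiM PiE_def)
    then have "?g ?m \<in> ?S \<longleftrightarrow> ?k x \<in> F \<and> y \<in> (\<Pi>\<^sub>E w\<in>W. {0..<1::real})"
      unfolding mem_Collect_eq pg by blast
    then show "indicator ?S (?g ?m) = (indicator F (?k x) * indicator (\<Pi>\<^sub>E w\<in>W. {0..<1::real}) y :: ennreal)"
      by (simp add: indicator_def)
  qed
  also have "\<dots> = (\<integral>\<^sup>+x. indicator F (?k x) \<partial>(\<Pi>\<^sub>M b\<in>B. lborel))"
  proof (rule nn_integral_cong)
    fix x :: "'a \<Rightarrow> real"
    have c: "(\<Pi>\<^sub>E w\<in>W. {0..<1::real}) \<in> sets (\<Pi>\<^sub>M b\<in>W. lborel)"
      by (rule sets_PiM_I_finite[OF finW]) auto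
    have "emeasure (\<Pi>\<^sub>M b\<in>W. lborel) (\<Pi>\<^sub>E w\<in>W. {0..<1::real}) = (\<Prod>w\<in>W. emeasure lborel {0..<1::real})"
      by (rule lborel_real.emeasure_PiM[OF finW]) auto
    then have "emeasure (\<Pi>\<^sub>M b\<in>W. lborel) (\<Pi>\<^sub>E w\<in>W. {0..<1::real}) = 1" by simp
    then show "(\<integral>\<^sup>+y. indicator F (?k x) * indicator (\<Pi>\<^sub>E w\<in>W. {0..<1::real}) y \<partial>(\<Pi>\<^sub>M b\<in>W. lborel)) = 
       (indicator F (?k x) :: ennreal)"
      using c by (subst nn_integral_cmult) auto
  qed
  also have "\<dots> = emeasure (\<Pi>\<^sub>M b\<in>B. lborel) {c \<in> space (\<Pi>\<^sub>M b\<in>B. lborel). ?k c \<in> F}"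
  proof -
    have "(\<integral>\<^sup>+x. indicator F (?k x) \<partial>(\<Pi>\<^sub>M b\<in>B. lborel)) = 
       (\<integral>\<^sup>+x. indicator {c \<in> space (\<Pi>\<^sub>M b\<in>B. lborel). ?k c \<in> F} x \<partial>(\<Pi>\<^sub>M b\<in>B. lborel))"
      by (intro nn_integral_cong) (simp add: indicator_def)
    also have "\<dots> = emeasure (\<Pi>\<^sub>M b\<in>B. lborel) {c \<in> space (\<Pi>\<^sub>M b\<in>B. lborel). ?k c \<in> F}"
      by (rule nn_integral_indicator) measurable
    finally show ?thesis .
  qed
  finally show ?thesis by (simp add: measure_def)
qed

text \<open>
  In particular the volume does not depend on the frame that defines \<open>flat_lborel\<close>: all frames satisfy
  \<open>measure_PiM_thicken\<close>, and moving the origin along the flat is a translation that preserves the slab.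
\<close>

lemma flat_vol_eq:
  fixes F :: "'a::euclidean_space set"
  assumes W: "orthonormal W" and F: "affine hull F = (+) q ` perp W" and [measurable]: "F \<in> sets borel"
  shows "flat_vol F = flat_int W (\<lambda>y. indicator F (q + y))"
proof -
  let ?U = "(+) q ` perp W"
  obtain B0 where B0: "pairwise orthogonal B0" "\<And>x. x \<in> B0 \<Longrightarrow> norm x = 1" "span B0 = perp W"
    using orthonormal_basis_subspace[OF subspace_perp[of W]] by metis
  have sh: "(\<lambda>x. x - p) ` ?U = perp W" if "p \<in> ?U" for p
  proof -
    obtain z where z: "p = q + z" "z \<in> perp W" using \<open>p \<in> ?U\<close> by blast
    have "(\<lambda>x. x - p) ` ?U = (\<lambda>y. y - z) ` perp W" by (auto simp: image_image z(1))
    also have "\<dots> = perp W"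
    proof
      show "(\<lambda>y. y - z) ` perp W \<subseteq> perp W" using perp_diff z by blast
      show "perp W \<subseteq> (\<lambda>y. y - z) ` perp W"
      proof
        fix y assume "y \<in> perp W"
        then have "y + z \<in> perp W" using perp_add z by blast
        then show "y \<in> (\<lambda>y. y - z) ` perp W" by (intro image_eqI[of _ _ "y + z"]) auto
      qed
    qed
    finally show ?thesis .
  qed
  have q: "q \<in> ?U" using zero_in_perp by force
  define pB where "pB = (SOME (p, B). orthonormal_frame ?U p B)"
  obtain p B where pB': "pB = (p, B)" by fastforce
  have "orthonormal_frame ?U q B0" unfolding orthonormal_frame_def sh[OF q] using B0 q by blast
  then have "\<exists>pB. case pB of (p, B) \<Rightarrow> orthonormal_frame ?U p B" by blast
  then have "case pB of (p, B) \<Rightarrow> orthonormal_frame ?U p B" unfolding pB_def by (rule someI_ex)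
  then have fr: "orthonormal_frame ?U p B" by (simp add: pB')
  then have pU: "p \<in> ?U" and B: "orthonormal B" "span B = perp W"
    unfolding orthonormal_frame_def orthonormal_def using sh by auto
  obtain z where z: "p = q + z" "z \<in> perp W" using pU by blast
  have fl: "flat_lborel ?U = distr (\<Pi>\<^sub>M b\<in>B. lborel) borel (\<lambda>c. p + (\<Sum>b\<in>B. c b *\<^sub>R b))"
    unfolding flat_lborel_def pB_def[symmetric] pB' by simp
  have [measurable]: "(\<lambda>c. p + (\<Sum>b\<in>B. c b *\<^sub>R b)) \<in> borel_measurable (\<Pi>\<^sub>M b\<in>B. lborel)"
    by (intro borel_measurable_add borel_measurable_const measurable_PiM_combination)
  have "flat_vol F = measure (\<Pi>\<^sub>M b\<in>B. lborel) ((\<lambda>c. p + (\<Sum>b\<in>B. c b *\<^sub>R b)) -` F \<inter> space (\<Pi>\<^sub>M b\<in>B. lborel))"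
    unfolding flat_vol_def F fl by (rule measure_distr) auto
  also have "(\<lambda>c. p + (\<Sum>b\<in>B. c b *\<^sub>R b)) -` F \<inter> space (\<Pi>\<^sub>M b\<in>B. lborel) = 
     {c \<in> space (\<Pi>\<^sub>M b\<in>B. lborel). p + (\<Sum>b\<in>B. c b *\<^sub>R b) \<in> F}" by blast
  also have "measure (\<Pi>\<^sub>M b\<in>B. lborel) \<dots> = measure lborel {x \<in> slab W. p + prj W x \<in> F}"
    by (rule measure_PiM_thicken[OF W B]) simp
  also have "\<dots> = (LINT x|lborel. indicator {x \<in> slab W. p + prj W x \<in> F} x)"
    by simp
  also have "\<dots> = (LINT x|lborel. indicator (slab W) (x + z) *\<^sub>R indicator F (q + prj W (x + z)))"
    using slab_shift[OF z(2)] 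
    by (intro Bochner_Integration.integral_cong refl) (simp add: indicator_def prj_add prj_id[OF z(2)] z(1) add_ac)
  also have "\<dots> = flat_int W (\<lambda>y. indicator F (q + y))"
    unfolding flat_int_def
  proof (rule lborel_integral_translate)
    have [measurable]: "slab W \<in> sets borel" by (rule slab_borel[OF W])
    show "(\<lambda>x. indicat_real (slab W) x *\<^sub>R indicat_real F (q + prj W x)) \<in> borel_measurable borel"
      by measurable
  qed
  finally show ?thesis .
qed

section \<open>Asymptotics of the Fourier integral along a flag\<close>

text \<open>
  A vector that defines the half-space need not belong to \<open>T\<close>, but its component in \<open>T\<close> defines the same
  half-space.
\<close>

lemma flag_step_normal:
  fixes S T P :: "'a::euclidean_space set"
  assumes S: "subspace S" and T: "subspace T" and h: "halfspace_in T S P"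
  obtains u where "u \<in> T" "norm u = 1" "S = {x \<in> T. u \<bullet> x = 0}" "P = {x \<in> T. u \<bullet> x \<ge> 0}"
proof -
  from h obtain a b where ab: "S \<subseteq> T" "aff_dim T = aff_dim S + 1"
    "S = {x \<in> T. a \<bullet> x = b}" "P = {x \<in> T. a \<bullet> x \<ge> b}" unfolding halfspace_in_def by (elim conjE exE)
  have "0 \<in> S" using S subspace_0 by blast
  then have b: "b = 0" using ab(3) by simp
  obtain y z where yz: "y \<in> span T" "\<And>w. w \<in> span T \<Longrightarrow> orthogonal z w" "a = y + z"
    using orthogonal_subspace_decomp_exists by metis
  have yT: "y \<in> T" using yz(1) T span_eq_iff by blast
  have ip: "a \<bullet> x = y \<bullet> x" if "x \<in> T" for x
    using yz(2)[of x] that T span_superset by (auto simp: yz(3) inner_add_left orthogonal_def)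
  have y0: "y \<noteq> 0"
  proof
    assume "y = 0"
    then have "S = T" unfolding ab(3) b using ip by auto
    then show False using ab(2) by simp
  qed
  define u where "u = y /\<^sub>R norm y"
  have "a \<bullet> x = norm y * (u \<bullet> x)" if "x \<in> T" for x using ip[OF that] y0 by (simp add: u_def)
  then have "S = {x \<in> T. u \<bullet> x = 0}" "P = {x \<in> T. u \<bullet> x \<ge> 0}"
    unfolding ab(3,4) b using y0 by (auto simp: zero_le_mult_iff)
  moreover have "u \<in> T" using yT T by (simp add: u_def subspace_scale)
  moreover have "norm u = 1" using y0 by (simp add: u_def)
  ultimately show thesis using that by blast
qed

text \<open>
  A flag given by the unit normals \<open>v k\<close> of \<open>V k\<close> in \<open>V (k + 1)\<close> that point into the positive half-spaces.
\<close>

locale flag_frame =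
  fixes r :: nat and v :: "nat \<Rightarrow> 'a::euclidean_space" and V P :: "nat \<Rightarrow> 'a set"
  assumes r_le: "r \<le> DIM('a)"
    and orthonormal_frame_vectors: "orthonormal (v ` {r..<DIM('a)})" and inj_v: "inj_on v {r..<DIM('a)}"
    and V_eq: "\<And>k. \<lbrakk>r \<le> k; k \<le> DIM('a)\<rbrakk> \<Longrightarrow> V k = perp (v ` {k..<DIM('a)})"
    and P_eq: "\<And>k. \<lbrakk>r \<le> k; k < DIM('a)\<rbrakk> \<Longrightarrow> P k = {x \<in> perp (v ` {Suc k..<DIM('a)}). v k \<bullet> x \<ge> 0}"

lemma is_flag_imp_frame:
  fixes V P :: "nat \<Rightarrow> 'a::euclidean_space set"
  assumes fl: "is_flag r V P" and r: "r \<le> DIM('a)"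
  obtains v where "flag_frame r v V P"
proof -
  let ?d = "DIM('a)"
  have sub: "subspace (V j)" if "r \<le> j" "j \<le> ?d" for j
    using fl that unfolding is_flag_def by auto
  define N where "N j u \<longleftrightarrow> u \<in> V (Suc j) \<and> norm u = 1 \<and> 
      V j = {x \<in> V (Suc j). u \<bullet> x = 0} \<and> P j = {x \<in> V (Suc j). u \<bullet> x \<ge> 0}" for j u
  define v where "v j = (SOME u. N j u)" for j
  have N: "N j (v j)" if j: "r \<le> j" "j < ?d" for j
  proof -
    have h: "halfspace_in (V (Suc j)) (V j) (P j)" using fl j unfolding is_flag_def by auto
    have s: "subspace (V j)" "subspace (V (Suc j))" using sub[of j] sub[of "Suc j"] j by auto
    have "\<exists>u. N j u" by (rule flag_step_normal[OF s h]) (auto simp: N_def)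
    then show ?thesis unfolding v_def by (rule someI_ex)
  qed
  have v: "v j \<in> V (Suc j)" "norm (v j) = 1" "V j = {x \<in> V (Suc j). v j \<bullet> x = 0}" 
    "P j = {x \<in> V (Suc j). v j \<bullet> x \<ge> 0}" if "r \<le> j" "j < ?d" for j
    using N[OF that] unfolding N_def by blast+
  have mono: "V j \<subseteq> V k" if "r \<le> j" "j \<le> k" "k \<le> ?d" for j k
    using that(2,3)
  proof (induction k rule: dec_induct)
    case (step k)
    then have "V k \<subseteq> V (Suc k)" using v(3)[of k] that(1) by auto
    then show ?case using step by auto
  qed simp
  have orth: "v k \<bullet> v j = 0" if "r \<le> j" "j < k" "k < ?d" for j k
  proof -
    have "v j \<in> V k" using v(1)[of j] mono[of "Suc j" k] that by auto
    then show ?thesis using v(3)[of k] that by auto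
  qed
  have ne: "v j \<noteq> v k" if "r \<le> j" "j < k" "k < ?d" for j k
    using orth[OF that] v(2)[of j] that by auto
  have inj: "inj_on v {r..<?d}"
    using ne by (intro inj_onI) (metis atLeastLessThan_iff linorder_neqE_nat)
  have Vk: "V k = perp (v ` {k..<?d})" if "r \<le> k" "k \<le> ?d" for k
    using that(2,1)
  proof (induction k rule: inc_induct)
    case base
    then show ?case using fl unfolding is_flag_def by simp
  next
    case (step k)
    have "{k..<?d} = insert k {Suc k..<?d}" using step by auto
    then show ?case using step v(3)[of k] by (simp add: perp_insert)
  qed
  have on: "orthonormal (v ` {r..<?d})"
    unfolding orthonormal_def pairwise_def orthogonal_def
  proof (intro conjI ballI impI)
    fix x y assume "x \<in> v ` {r..<?d}" "y \<in> v ` {r..<?d}" "x \<noteq> y"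
    then obtain j k where jk: "x = v j" "y = v k" "r \<le> j" "j < ?d" "r \<le> k" "k < ?d" by auto
    then have "j \<noteq> k" using \<open>x \<noteq> y\<close> by auto
    then show "x \<bullet> y = 0" using jk orth[of j k] orth[of k j]
      by (cases j k rule: linorder_cases) (auto simp: inner_commute)
  qed (use v(2) in auto)
  have "flag_frame r v V P"
  proof
    show "P k = {x \<in> perp (v ` {Suc k..<?d}). v k \<bullet> x \<ge> 0}" if "r \<le> k" "k < ?d" for k
      using v(4)[OF that] Vk[of "Suc k"] that by simp
  qed (use r inj on Vk in auto)
  then show thesis using that by blast
qed

definition flag_seqs :: "nat \<Rightarrow> (nat \<Rightarrow> 'a::euclidean_space set) \<Rightarrow> nat \<Rightarrow> 'a set \<Rightarrow> (nat \<Rightarrow> 'a set) set" where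
  "flag_seqs r V k G = {F \<in> extensional {r..k}. F k = G \<and> 
     (\<forall>j\<in>{r..<k}. poly_facet (F (Suc j)) (F j) \<and> (\<exists>u. affine hull (F j) = (+) u ` V j))}"

text \<open>
  The Hadwiger sum for sequences of faces that begin with a \<open>k\<close>-dimensional polytope \<open>G\<close>. It satisfies a
  recursion in \<open>k\<close>, because the second member of a sequence is a facet of \<open>G\<close>.
\<close>

definition partial_hadwiger ::
  "nat \<Rightarrow> (nat \<Rightarrow> 'a::euclidean_space set) \<Rightarrow> (nat \<Rightarrow> 'a set) \<Rightarrow> nat \<Rightarrow> 'a set \<Rightarrow> real" where
  "partial_hadwiger r V P k G = 
     (\<Sum>F\<in>flag_seqs r V k G. (\<Prod>j=r..<k. side_sign (P j) (F (Suc j)) (F j)) * flat_vol (F r))"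

definition parallel_facets :: "'a::euclidean_space set \<Rightarrow> 'a set \<Rightarrow> 'a set set" where
  "parallel_facets L G = {G'. poly_facet G G' \<and> (\<exists>u. affine hull G' = (+) u ` L)}"

lemma hadwiger_eq_partial:
  fixes A :: "'a::euclidean_space set"
  shows "hadwiger r V P A = partial_hadwiger r V P DIM('a) A"
proof -
  have "{F \<in> face_sequences r A. parallel_to r V F} = flag_seqs r V DIM('a) A"
    unfolding face_sequences_def parallel_to_def flag_seqs_def by auto
  then show ?thesis unfolding hadwiger_def partial_hadwiger_def by simp
qed

lemma flag_seqs_base: 
  fixes G :: "'a::euclidean_space set" shows "flag_seqs r V r G = {\<lambda>i\<in>{r}. G}"
proof (rule set_eqI)
  fix F :: "nat \<Rightarrow> 'a set"
  show "F \<in> flag_seqs r V r G \<longleftrightarrow> F \<in> {\<lambda>i\<in>{r}. G}"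
    unfolding flag_seqs_def by (auto simp: extensional_def restrict_def fun_eq_iff)
qed

lemma partial_hadwiger_base: "partial_hadwiger r V P r G = flat_vol G"
  by (simp add: partial_hadwiger_def flag_seqs_base)

lemma flag_seqs_Suc:
  assumes "r \<le> k"
  shows "flag_seqs r V (Suc k) G = (\<Union>G'\<in>parallel_facets (V k) G. (\<lambda>F. F(Suc k := G)) ` flag_seqs r V k G')"
proof (intro equalityI subsetI)
  fix F assume "F \<in> flag_seqs r V (Suc k) G"
  then have F: "F \<in> extensional {r..Suc k}" "F (Suc k) = G" 
    "\<And>j. j \<in> {r..<Suc k} \<Longrightarrow> poly_facet (F (Suc j)) (F j) \<and> (\<exists>u. affine hull (F j) = (+) u ` V j)"
    unfolding flag_seqs_def by auto
  let ?F = "restrict F {r..k}"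
  have eq: "F = ?F(Suc k := G)"
  proof
    fix i show "F i = (?F(Suc k := G)) i"
    proof (cases "i \<in> {r..Suc k}")
      case False
      then show ?thesis using F(1) assms unfolding extensional_def restrict_def by auto
    qed (use F(2) in \<open>auto simp: le_Suc_eq\<close>)
  qed
  have "F k \<in> parallel_facets (V k) G" unfolding parallel_facets_def using F(3)[of k] F(2) assms by auto
  moreover have "?F \<in> flag_seqs r V k (F k)" unfolding flag_seqs_def using F(3) assms by auto
  ultimately show "F \<in> (\<Union>G'\<in>parallel_facets (V k) G. (\<lambda>F. F(Suc k := G)) ` flag_seqs r V k G')"
    using eq by blast
next
  fix F assume "F \<in> (\<Union>G'\<in>parallel_facets (V k) G. (\<lambda>F. F(Suc k := G)) ` flag_seqs r V k G')"
  then obtain G' F' where G': "poly_facet G G'" "\<exists>u. affine hull G' = (+) u ` V k"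
    and F': "F' \<in> flag_seqs r V k G'" "F = F'(Suc k := G)" unfolding parallel_facets_def by blast
  have F'1: "F' \<in> extensional {r..k}" "F' k = G'" 
    "\<And>j. j \<in> {r..<k} \<Longrightarrow> poly_facet (F' (Suc j)) (F' j) \<and> (\<exists>u. affine hull (F' j) = (+) u ` V j)"
    using F'(1) unfolding flag_seqs_def by auto
  have "poly_facet (F (Suc j)) (F j) \<and> (\<exists>u. affine hull (F j) = (+) u ` V j)" if "j \<in> {r..<Suc k}" for j
  proof (cases "j = k")
    case True
    then show ?thesis using G' F'1(2) F'(2) by simp
  next
    case False
    then have "j \<in> {r..<k}" using that by auto
    then show ?thesis using F'1(3)[of j] F'(2) by auto
  qed
  moreover have "F \<in> extensional {r..Suc k}" using F'1(1) assms unfolding F'(2) extensional_def by auto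
  ultimately show "F \<in> flag_seqs r V (Suc k) G" unfolding flag_seqs_def using F'(2) by auto
qed

lemma flag_seqs_upd_inj: "inj_on (\<lambda>F. F(Suc k := G)) (flag_seqs r V k G')"
proof (rule inj_onI)
  fix F F' assume *: "F \<in> flag_seqs r V k G'" "F' \<in> flag_seqs r V k G'" "F(Suc k := G) = F'(Suc k := G)"
  have "F (Suc k) = F' (Suc k)" using *(1,2) unfolding flag_seqs_def extensional_def by auto
  then show "F = F'" using *(3) by (metis fun_upd_triv fun_upd_upd)
qed

lemma
  assumes rk: "r \<le> k" and fin: "finite (parallel_facets (V k) G)" 
    and fins: "\<And>G'. G' \<in> parallel_facets (V k) G \<Longrightarrow> finite (flag_seqs r V k G')"
  shows finite_flag_seqs_Suc: "finite (flag_seqs r V (Suc k) G)"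
    and partial_hadwiger_Suc: "partial_hadwiger r V P (Suc k) G = 
      (\<Sum>G'\<in>parallel_facets (V k) G. side_sign (P k) G G' * partial_hadwiger r V P k G')"
proof -
  show "finite (flag_seqs r V (Suc k) G)" unfolding flag_seqs_Suc[OF rk] using fin fins by blast
  let ?t = "\<lambda>k F. (\<Prod>j=r..<k. side_sign (P j) (F (Suc j)) (F j)) * flat_vol (F r)"
  have "partial_hadwiger r V P (Suc k) G = 
      (\<Sum>G'\<in>parallel_facets (V k) G. \<Sum>F\<in>(\<lambda>F. F(Suc k := G)) ` flag_seqs r V k G'. ?t (Suc k) F)"
    unfolding partial_hadwiger_def flag_seqs_Suc[OF rk]
  proof (rule sum.UNION_disjoint[OF fin])
    show "\<forall>G'\<in>parallel_facets (V k) G. finite ((\<lambda>F. F(Suc k := G)) ` flag_seqs r V k G')" using fins by blast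
    show "\<forall>G'\<in>parallel_facets (V k) G. \<forall>G''\<in>parallel_facets (V k) G. G' \<noteq> G'' \<longrightarrow> 
       (\<lambda>F. F(Suc k := G)) ` flag_seqs r V k G' \<inter> (\<lambda>F. F(Suc k := G)) ` flag_seqs r V k G'' = {}"
    proof (intro ballI impI, rule ccontr)
      fix G' G'' assume "G' \<noteq> G''" 
        "(\<lambda>F. F(Suc k := G)) ` flag_seqs r V k G' \<inter> (\<lambda>F. F(Suc k := G)) ` flag_seqs r V k G'' \<noteq> {}"
      then obtain F F' where F: "F k = G'" "F' k = G''" "F(Suc k := G) = F'(Suc k := G)"
        unfolding flag_seqs_def by auto
      have "F k = F' k" using fun_cong[OF F(3), of k] by simp
      then show False using F(1,2) \<open>G' \<noteq> G''\<close> by simp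
    qed
  qed
  also have "\<dots> = (\<Sum>G'\<in>parallel_facets (V k) G. \<Sum>F\<in>flag_seqs r V k G'. ?t (Suc k) (F(Suc k := G)))"
    by (rule sum.cong[OF refl]) (simp only: sum.reindex[OF flag_seqs_upd_inj] o_def)
  also have "\<dots> = (\<Sum>G'\<in>parallel_facets (V k) G. \<Sum>F\<in>flag_seqs r V k G'. side_sign (P k) G G' * ?t k F)"
  proof (intro sum.cong refl)
    fix G' F assume "F \<in> flag_seqs r V k G'"
    then have Fk: "F k = G'" unfolding flag_seqs_def by auto
    let ?F = "F(Suc k := G)"
    have "(\<Prod>j=r..<Suc k. side_sign (P j) (?F (Suc j)) (?F j)) = 
       (\<Prod>j=r..<k. side_sign (P j) (?F (Suc j)) (?F j)) * side_sign (P k) G G'"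
      using rk Fk by simp
    also have "(\<Prod>j=r..<k. side_sign (P j) (?F (Suc j)) (?F j)) = (\<Prod>j=r..<k. side_sign (P j) (F (Suc j)) (F j))"
      by (intro prod.cong refl) auto
    finally show "?t (Suc k) ?F = side_sign (P k) G G' * ?t k F" using rk Fk by simp
  qed
  also have "\<dots> = (\<Sum>G'\<in>parallel_facets (V k) G. side_sign (P k) G G' * partial_hadwiger r V P k G')"
    unfolding partial_hadwiger_def by (simp add: sum_distrib_left)
  finally show "partial_hadwiger r V P (Suc k) G = 
      (\<Sum>G'\<in>parallel_facets (V k) G. side_sign (P k) G G' * partial_hadwiger r V P k G')" .
qed

lemma flat_int_dominated:
  fixes F :: "'a::euclidean_space set"
  assumes W: "orthonormal W" and F: "F \<in> sets borel" "bounded F" and \<xi>: "(\<lambda>n. prj W (\<xi> n)) \<longlonglongrightarrow> 0"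
  shows "(\<lambda>n. flat_int W (\<lambda>y. indicator F (q + y) *\<^sub>R expo (\<xi> n) y)) \<longlonglongrightarrow> 
    of_real (flat_int W (\<lambda>y. indicator F (q + y)))"
proof -
  have [measurable]: "F \<in> sets borel" "slab W \<in> sets borel" using F slab_borel[OF W] by auto
  obtain B where B: "\<And>x. x \<in> F \<Longrightarrow> norm x \<le> B" using F bounded_iff by metis
  have tm: "tame W (\<lambda>y. indicator {y. q + y \<in> F} y *\<^sub>R (1::complex))"
  proof (rule tame_indicator_expo)
    show "{y. q + y \<in> F} \<in> sets borel" by measurable
    show "norm y \<le> B + norm q" if "y \<in> {y. q + y \<in> F}" for y
    proof -
      have "norm (q + y) \<le> B" using B that by blast
      moreover have "norm y \<le> norm (q + y) + norm q"
        by (metis add.commute add_diff_cancel_right' norm_triangle_ineq4)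
      ultimately show ?thesis by simp
    qed
  qed auto
  have int: "integrable lborel (\<lambda>x. indicator (slab W) x *\<^sub>R (indicator {y. q + y \<in> F} (prj W x) *\<^sub>R (1::complex)))"
    using tame_integrable[OF W tm] .
  let ?g = "\<lambda>n x. indicat_real (slab W) x *\<^sub>R indicat_real F (q + prj W x) *\<^sub>R expo (\<xi> n) (prj W x)"
  have "(\<lambda>n. LINT x|lborel. ?g n x) \<longlonglongrightarrow> (LINT x|lborel. indicat_real (slab W) x *\<^sub>R indicat_real F (q + prj W x) *\<^sub>R (1::complex))"
  proof (rule integral_dominated_convergence[OF _ _ integrable_norm[OF int]])
    show "AE x in lborel. (\<lambda>n. ?g n x) \<longlonglongrightarrow> indicat_real (slab W) x *\<^sub>R indicat_real F (q + prj W x) *\<^sub>R (1::complex)"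
    proof (rule AE_I2)
      fix x
      have "expo (\<xi> n) (prj W x) = expo (prj W (\<xi> n)) (prj W x)" for n
        by (rule expo_cong) (simp add: inner_prj_left prj_in_perp[OF W])
      moreover have "(\<lambda>n. expo (prj W (\<xi> n)) (prj W x)) \<longlonglongrightarrow> expo 0 (prj W x)"
        by (rule tendsto_expo_left[OF \<xi>])
      ultimately have "(\<lambda>n. expo (\<xi> n) (prj W x)) \<longlonglongrightarrow> 1" by simp
      then show "(\<lambda>n. ?g n x) \<longlonglongrightarrow> indicat_real (slab W) x *\<^sub>R indicat_real F (q + prj W x) *\<^sub>R (1::complex)"
        by (intro tendsto_intros)
    qed
    show "AE x in lborel. norm (?g n x) \<le> norm (indicat_real (slab W) x *\<^sub>R (indicator {y. q + y \<in> F} (prj W x) *\<^sub>R (1::complex)))" for n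
      by (rule AE_I2) (simp add: indicator_def)
  qed measurable
  also have "(LINT x|lborel. indicat_real (slab W) x *\<^sub>R indicat_real F (q + prj W x) *\<^sub>R (1::complex)) =
      (LINT x|lborel. complex_of_real (indicat_real (slab W) x *\<^sub>R indicat_real F (q + prj W x)))"
    by (intro Bochner_Integration.integral_cong refl) (simp add: indicator_def)
  also have "\<dots> = of_real (flat_int W (\<lambda>y. indicator F (q + y)))"
    unfolding flat_int_def by (rule integral_complex_of_real)
  finally show ?thesis unfolding flat_int_def .
qed

text \<open>
  For such frequencies the error in \<open>fourier_step\<close> remains negligible at each level \<open>k\<close> after
  multiplication by the lower coordinates of \<open>\<xi> n\<close>.
\<close>

definition flag_dominated :: "nat \<Rightarrow> (nat \<Rightarrow> 'a::euclidean_space) \<Rightarrow> (nat \<Rightarrow> 'a) \<Rightarrow> bool" where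
  "flag_dominated r v \<xi> \<longleftrightarrow> (\<lambda>n. prj (v ` {r..<DIM('a)}) (\<xi> n)) \<longlonglongrightarrow> 0 \<and>
     (\<forall>k\<in>{r..<DIM('a)}. filterlim (\<lambda>n. \<xi> n \<bullet> v k) at_top sequentially \<and>
        (\<lambda>n. norm (prj (v ` {k..<DIM('a)}) (\<xi> n)) / (\<xi> n \<bullet> v k)) \<longlonglongrightarrow> 0 \<and>
        (\<lambda>n. (\<Prod>j=r..<k. \<xi> n \<bullet> v j) / (\<xi> n \<bullet> v k)) \<longlonglongrightarrow> 0)"

context flag_frame
begin

definition W where "W k = v ` {k..<DIM('a)}"

lemma W_Suc: "k < DIM('a) \<Longrightarrow> W k = insert (v k) (W (Suc k))"
proof -
  assume "k < DIM('a)"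
  then have "{k..<DIM('a)} = insert k {Suc k..<DIM('a)}" by auto
  then show ?thesis unfolding W_def by simp
qed

lemma orthonormal_W: "r \<le> k \<Longrightarrow> orthonormal (W k)"
  using orthonormal_frame_vectors unfolding W_def orthonormal_def pairwise_def by auto

lemma v_notin: "\<lbrakk>r \<le> k; k < DIM('a)\<rbrakk> \<Longrightarrow> v k \<notin> W (Suc k)"
  using inj_v unfolding W_def inj_on_def by force

text \<open>
  An \<open>r\<close>-dimensional face contributes its volume times the phase of \<open>\<xi> n\<close> at the foot of its flat; \<open>Q\<close>
  collects these feet. In the step from \<open>k\<close> to \<open>k + 1\<close> the facets are treated by induction.
\<close>

lemma fourier_asymptotics:
  assumes "r \<le> k" "k \<le> DIM('a)" and q: "prj (W k) q = 0" and F: "polytope_in ((+) q ` perp (W k)) F"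
  shows "finite (flag_seqs r V k F) \<and> (\<exists>Q. finite Q \<and> (\<forall>\<xi>. flag_dominated r v \<xi> \<longrightarrow> 
     (\<forall>p\<in>Q. (\<lambda>n. expo (\<xi> n) p) \<longlonglongrightarrow> 1) \<longrightarrow>
     (\<lambda>n. (\<Prod>j=r..<k. - (2 * of_real pi * \<i> * of_real (\<xi> n \<bullet> v j))) * fourier_on (W k) F (\<xi> n)) \<longlonglongrightarrow> 
        of_real (partial_hadwiger r V P k F)))"
  using assms
proof (induction k arbitrary: q F rule: dec_induct)
  case base
  have on: "orthonormal (W r)" using orthonormal_W by blast
  have hull: "affine hull F = (+) q ` perp (W r)" using base polytope_in_affine_hull by blast
  have FU: "F \<subseteq> (+) q ` perp (W r)" using hull hull_subset[of F affine] by simp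
  have cF: "compact F" using base polytope_in_compact by blast
  then have FB: "F \<in> sets borel" "bounded F" by (auto simp: compact_imp_closed compact_imp_bounded)
  have "(\<lambda>n. fourier_on (W r) F (\<xi> n)) \<longlonglongrightarrow> of_real (flat_vol F)"
    if \<xi>: "flag_dominated r v \<xi>" and ph: "(\<lambda>n. expo (\<xi> n) q) \<longlonglongrightarrow> 1" for \<xi>
  proof -
    have "fourier_on (W r) F (\<xi> n) = expo (\<xi> n) q * flat_int (W r) (\<lambda>y. indicator F (q + y) *\<^sub>R expo (\<xi> n) y)" for n
      unfolding fourier_on_eq[OF FU base(2)] flat_int_mult[symmetric] by (simp add: expo_add_right)
    moreover have "(\<lambda>n. prj (W r) (\<xi> n)) \<longlonglongrightarrow> 0" using \<xi> unfolding flag_dominated_def W_def by blast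
    then have "(\<lambda>n. expo (\<xi> n) q * flat_int (W r) (\<lambda>y. indicator F (q + y) *\<^sub>R expo (\<xi> n) y)) \<longlonglongrightarrow> 
        1 * of_real (flat_int (W r) (\<lambda>y. indicator F (q + y)))"
      by (intro tendsto_mult ph flat_int_dominated on FB)
    ultimately show ?thesis unfolding flat_vol_eq[OF on hull FB(1)] by simp
  qed
  then show ?case
    by (intro conjI exI[of _ "{q}"]) (auto simp: flag_seqs_base partial_hadwiger_base)
next
  case (step k)
  have k: "r \<le> k" "k < DIM('a)" using step by auto
  have WS: "W k = insert (v k) (W (Suc k))" using W_Suc k by blast
  have onI: "orthonormal (insert (v k) (W (Suc k)))" using orthonormal_W[OF k(1)] WS by simp
  have onS: "orthonormal (W (Suc k))" using orthonormal_W k by simp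
  obtain H S where HS: "finite H" 
    "\<And>a b. (a, b) \<in> H \<Longrightarrow> a \<in> perp (W (Suc k)) \<and> a \<noteq> 0 \<and> (v k \<bullet> a = 0 \<or> v k \<bullet> a = 1)"
    "S \<subseteq> Pow H" "S \<noteq> {}" "\<And>\<sigma>. \<sigma> \<in> S \<Longrightarrow> opencell H \<sigma> \<inter> ((+) q ` perp (W (Suc k))) \<noteq> {}"
    "F = (+) q ` perp (W (Suc k)) \<inter> \<Union>(closedcell H ` S)"
    by (rule polytope_in_imp_closedcells[OF onS step.prems(2) refl step.prems(3)]) (rule that)
  interpret c: cellular "W (Suc k)" "v k" q "(+) q ` perp (W (Suc k))" F H S
    by standard (fact onI v_notin[OF k] step.prems(2,3) HS refl)+
  have W': "c.W' = W k" unfolding c.W'_def WS ..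
  have pf: "c.par_facets = parallel_facets (V k) F"
    unfolding c.par_facets_def parallel_facets_def W' using V_eq[of k] k by (simp add: W_def)
  have Pk: "{x \<in> perp (W (Suc k)). v k \<bullet> x \<ge> 0} = P k" using P_eq[OF k] by (simp add: W_def)
  have IH: "finite (flag_seqs r V k G) \<and> (\<exists>Q. finite Q \<and> (\<forall>\<xi>. flag_dominated r v \<xi> \<longrightarrow> 
     (\<forall>p\<in>Q. (\<lambda>n. expo (\<xi> n) p) \<longlonglongrightarrow> 1) \<longrightarrow>
     (\<lambda>n. (\<Prod>j=r..<k. - (2 * of_real pi * \<i> * of_real (\<xi> n \<bullet> v j))) * fourier_on (W k) G (\<xi> n)) \<longlonglongrightarrow> 
        of_real (partial_hadwiger r V P k G)))" if "G \<in> parallel_facets (V k) F" for G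
  proof -
    obtain s \<epsilon> where G: "G = closure (c.D s \<epsilon>)" "\<epsilon> = 1 \<or> \<epsilon> = - 1" "c.D s \<epsilon> \<noteq> {}"
    proof -
      have "G \<in> (\<lambda>(s, \<epsilon>). closure (c.D s \<epsilon>)) ` {(s, \<epsilon>). (\<epsilon> = 1 \<or> \<epsilon> = - 1) \<and> (v k, s) \<in> H \<and> c.D s \<epsilon> \<noteq> {}}"
        using \<open>G \<in> parallel_facets (V k) F\<close> unfolding pf[symmetric] c.par_facets_eq .
      then show thesis by (elim imageE) (use that in auto)
    qed
    have "polytope_in (c.hyp s) G" unfolding G(1) by (rule c.polytope_closure_D[OF G(2,3)])
    then show ?thesis using step.IH[of "q + s *\<^sub>R v k" G] c.prj_hyp[of s] k unfolding c.hyp_eq W' by simp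
  qed
  have fin: "finite (parallel_facets (V k) F)" using c.finite_par_facets unfolding pf .
  have fins: "finite (flag_seqs r V k G)" if "G \<in> parallel_facets (V k) F" for G using IH[OF that] by blast
  have hS: "partial_hadwiger r V P (Suc k) F = 
      (\<Sum>G\<in>parallel_facets (V k) F. side_sign (P k) F G * partial_hadwiger r V P k G)"
    by (rule partial_hadwiger_Suc[OF k(1) fin fins])
  define Q where "Q G = (SOME Q. finite Q \<and> (\<forall>\<xi>. flag_dominated r v \<xi> \<longrightarrow> 
     (\<forall>p\<in>Q. (\<lambda>n. expo (\<xi> n) p) \<longlonglongrightarrow> 1) \<longrightarrow>
     (\<lambda>n. (\<Prod>j=r..<k. - (2 * of_real pi * \<i> * of_real (\<xi> n \<bullet> v j))) * fourier_on (W k) G (\<xi> n)) \<longlonglongrightarrow> 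
        of_real (partial_hadwiger r V P k G)))" for G
  have Q: "finite (Q G) \<and> (\<forall>\<xi>. flag_dominated r v \<xi> \<longrightarrow> 
     (\<forall>p\<in>Q G. (\<lambda>n. expo (\<xi> n) p) \<longlonglongrightarrow> 1) \<longrightarrow>
     (\<lambda>n. (\<Prod>j=r..<k. - (2 * of_real pi * \<i> * of_real (\<xi> n \<bullet> v j))) * fourier_on (W k) G (\<xi> n)) \<longlonglongrightarrow> 
        of_real (partial_hadwiger r V P k G))" if "G \<in> parallel_facets (V k) F" for G
    unfolding Q_def by (rule someI_ex) (use IH[OF that] in blast)
  have finQ: "finite (\<Union>(Q ` parallel_facets (V k) F))" using fin Q by blast
  obtain C c where c: "c > 0" "\<And>\<xi>. \<xi> \<bullet> v k \<noteq> 0 \<Longrightarrow> norm (prj c.W' \<xi>) \<le> c * \<bar>\<xi> \<bullet> v k\<bar> \<Longrightarrow>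
     norm (- (2 * of_real pi * \<i> * of_real (\<xi> \<bullet> v k)) * fourier_on (W (Suc k)) F \<xi> - 
       (\<Sum>G\<in>c.par_facets. of_real (side_sign {x \<in> perp (W (Suc k)). v k \<bullet> x \<ge> 0} F G) * fourier_on c.W' G \<xi>)) 
     \<le> C / \<bar>\<xi> \<bullet> v k\<bar>"
    by (rule c.fourier_step) (rule that)
  have lim: "(\<lambda>n. (\<Prod>j=r..<Suc k. - (2 * of_real pi * \<i> * of_real (\<xi> n \<bullet> v j))) * fourier_on (W (Suc k)) F (\<xi> n)) \<longlonglongrightarrow> 
        of_real (partial_hadwiger r V P (Suc k) F)"
    if \<xi>: "flag_dominated r v \<xi>" and ph: "\<forall>p\<in>\<Union>(Q ` parallel_facets (V k) F). (\<lambda>n. expo (\<xi> n) p) \<longlonglongrightarrow> 1" for \<xi>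
  proof -
    let ?p = "\<lambda>n. \<Prod>j=r..<k. - (2 * of_real pi * \<i> * of_real (\<xi> n \<bullet> v j)) :: complex"
    let ?S = "\<lambda>n. \<Sum>G\<in>parallel_facets (V k) F. of_real (side_sign (P k) F G) * fourier_on (W k) G (\<xi> n)"
    let ?A = "\<lambda>n. - (2 * of_real pi * \<i> * of_real (\<xi> n \<bullet> v k)) * fourier_on (W (Suc k)) F (\<xi> n)"
    have t: "filterlim (\<lambda>n. \<xi> n \<bullet> v k) at_top sequentially"
      "(\<lambda>n. norm (prj (W k) (\<xi> n)) / (\<xi> n \<bullet> v k)) \<longlonglongrightarrow> 0"
      "(\<lambda>n. (\<Prod>j=r..<k. \<xi> n \<bullet> v j) / (\<xi> n \<bullet> v k)) \<longlonglongrightarrow> 0"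
      using \<xi> k unfolding flag_dominated_def W_def by auto
    have "(\<lambda>n. \<Sum>G\<in>parallel_facets (V k) F. of_real (side_sign (P k) F G) * (?p n * fourier_on (W k) G (\<xi> n)))
       \<longlonglongrightarrow> (\<Sum>G\<in>parallel_facets (V k) F. of_real (side_sign (P k) F G) * of_real (partial_hadwiger r V P k G))"
    proof (intro tendsto_sum tendsto_mult tendsto_const)
      fix G assume G: "G \<in> parallel_facets (V k) F"
      then show "(\<lambda>n. ?p n * fourier_on (W k) G (\<xi> n)) \<longlonglongrightarrow> of_real (partial_hadwiger r V P k G)"
        using Q[OF G] \<xi> ph by blast
    qed
    moreover have "?p n * ?S n = 
      (\<Sum>G\<in>parallel_facets (V k) F. of_real (side_sign (P k) F G) * (?p n * fourier_on (W k) G (\<xi> n)))" for n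
      unfolding sum_distrib_left by (simp only: mult.left_commute)
    ultimately have main: "(\<lambda>n. ?p n * ?S n) \<longlonglongrightarrow> of_real (partial_hadwiger r V P (Suc k) F)"
      unfolding hS by simp
    have ev: "eventually (\<lambda>n. norm (?p n * (?A n - ?S n)) \<le> 
        ((2 * pi) ^ (k - r) * C) * \<bar>(\<Prod>j=r..<k. \<xi> n \<bullet> v j) / (\<xi> n \<bullet> v k)\<bar>) sequentially"
    proof -
      have "eventually (\<lambda>n. norm (prj (W k) (\<xi> n)) / (\<xi> n \<bullet> v k) < c) sequentially"
        using t(2) c(1) by (rule order_tendstoD(2))
      moreover have "eventually (\<lambda>n. \<xi> n \<bullet> v k > 0) sequentially"
        using t(1) by (simp add: filterlim_at_top_dense)
      ultimately show ?thesis
      proof eventually_elim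
        case (elim n)
        then have nz: "\<xi> n \<bullet> v k \<noteq> 0" and small: "norm (prj c.W' (\<xi> n)) \<le> c * \<bar>\<xi> n \<bullet> v k\<bar>"
          unfolding W' by (auto simp: pos_divide_less_eq)
        have b: "norm (?A n - ?S n) \<le> C / \<bar>\<xi> n \<bullet> v k\<bar>"
          using c(2)[OF nz small] unfolding pf Pk W' .
        have "norm (?p n) = (\<Prod>j=r..<k. (2 * pi) * \<bar>\<xi> n \<bullet> v j\<bar>)"
          by (simp add: prod_norm[symmetric] norm_mult)
        also have "\<dots> = (2 * pi) ^ (k - r) * \<bar>\<Prod>j=r..<k. \<xi> n \<bullet> v j\<bar>"
          by (simp add: prod.distrib abs_prod)
        finally have np: "norm (?p n) = (2 * pi) ^ (k - r) * \<bar>\<Prod>j=r..<k. \<xi> n \<bullet> v j\<bar>" .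
        have "norm (?p n * (?A n - ?S n)) \<le> ((2 * pi) ^ (k - r) * \<bar>\<Prod>j=r..<k. \<xi> n \<bullet> v j\<bar>) * (C / \<bar>\<xi> n \<bullet> v k\<bar>)"
          unfolding norm_mult np using b by (intro mult_left_mono) auto
        then show ?case by (simp add: abs_divide mult_ac)
      qed
    qed
    have "(\<lambda>n. ?p n * (?A n - ?S n)) \<longlonglongrightarrow> 0"
      by (rule Lim_null_comparison[OF ev]) (use tendsto_mult_right_zero[OF tendsto_rabs_zero[OF t(3)]] in blast)
    from tendsto_add[OF this main]
    have "(\<lambda>n. ?p n * ?A n) \<longlonglongrightarrow> of_real (partial_hadwiger r V P (Suc k) F)"
      by (simp add: algebra_simps)
    moreover have "?p n * ?A n = (\<Prod>j=r..<Suc k. - (2 * of_real pi * \<i> * of_real (\<xi> n \<bullet> v j))) * fourier_on (W (Suc k)) F (\<xi> n)" for n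
      using k(1) by (simp add: mult_ac)
    ultimately show ?thesis by simp
  qed
  show ?case
    using finite_flag_seqs_Suc[OF k(1) fin fins] finQ lim by blast
qed

end

section \<open>Spectra are relatively dense\<close>

lemma integral_lebesgue_on_borel:
  fixes h :: "'a::euclidean_space \<Rightarrow> 'b::{banach, second_countable_topology}"
  assumes "A \<in> sets borel" "h \<in> borel_measurable borel"
  shows "integral\<^sup>L (lebesgue_on A) h = (LINT x|lborel. indicator A x *\<^sub>R h x)"
proof -
  have "integral\<^sup>L (lebesgue_on A) h = (LINT x|lebesgue. indicator A x *\<^sub>R h x)"
    using assms by (intro integral_restrict_space) auto
  also have "\<dots> = (LINT x|lborel. indicator A x *\<^sub>R h x)"
  proof (rule integral_completion)
    have [measurable]: "A \<in> sets borel" "h \<in> borel_measurable borel" using assms by auto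
    show "(\<lambda>x. indicator A x *\<^sub>R h x) \<in> borel_measurable lborel" by measurable
  qed
  finally show ?thesis .
qed

definition bounded_borel :: "('a::euclidean_space \<Rightarrow> complex) \<Rightarrow> bool" where
  "bounded_borel f \<longleftrightarrow> f \<in> borel_measurable borel \<and> (\<exists>B. \<forall>x. norm (f x) \<le> B)"

lemma bounded_borel_mult: "\<lbrakk>bounded_borel f; bounded_borel g\<rbrakk> \<Longrightarrow> bounded_borel (\<lambda>x. f x * g x)"
proof -
  assume "bounded_borel f" "bounded_borel g"
  then obtain B C where "f \<in> borel_measurable borel" "g \<in> borel_measurable borel"
    and B: "\<And>x. norm (f x) \<le> B" and C: "\<And>x. norm (g x) \<le> C" unfolding bounded_borel_def by blast
  moreover have "norm (f x * g x) \<le> B * C" for x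
    unfolding norm_mult using B[of x] C[of x] by (intro mult_mono) (auto intro: order_trans[OF norm_ge_zero])
  ultimately show ?thesis unfolding bounded_borel_def by (intro conjI borel_measurable_times) auto
qed

lemma bounded_borel_add: "\<lbrakk>bounded_borel f; bounded_borel g\<rbrakk> \<Longrightarrow> bounded_borel (\<lambda>x. f x + g x)"
proof -
  assume "bounded_borel f" "bounded_borel g"
  then obtain B C where "f \<in> borel_measurable borel" "g \<in> borel_measurable borel"
    and B: "\<And>x. norm (f x) \<le> B" and C: "\<And>x. norm (g x) \<le> C" unfolding bounded_borel_def by blast
  moreover have "norm (f x + g x) \<le> B + C" for x
    using B[of x] C[of x] norm_triangle_ineq[of "f x" "g x"] by linarith
  ultimately show ?thesis unfolding bounded_borel_def by (intro conjI borel_measurable_add) auto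
qed

lemma bounded_borel_const [simp]: "bounded_borel (\<lambda>x. c)"
  unfolding bounded_borel_def by auto

lemma bounded_borel_expo [simp]: "bounded_borel (expo l)"
  unfolding bounded_borel_def by (auto intro: exI[of _ 1])

lemma bounded_borel_sum: "(\<And>i. i \<in> I \<Longrightarrow> bounded_borel (f i)) \<Longrightarrow> bounded_borel (\<lambda>x. \<Sum>i\<in>I. f i x)"
  by (induction I rule: infinite_finite_induct) (auto intro: bounded_borel_add)

lemma borel_measurable_cnj: "f \<in> borel_measurable M \<Longrightarrow> (\<lambda>x. cnj (f x)) \<in> borel_measurable M"
  by (rule borel_measurable_continuous_on[of cnj]) (auto intro: continuous_intros)

lemma bounded_borel_cnj: "bounded_borel f \<Longrightarrow> bounded_borel (\<lambda>x. cnj (f x))"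
  unfolding bounded_borel_def by (auto intro: borel_measurable_cnj)

lemma bounded_borel_uminus: "bounded_borel f \<Longrightarrow> bounded_borel (\<lambda>x. - f x)"
  using bounded_borel_mult[of "\<lambda>x. - 1" f] by simp

lemma bounded_borel_diff: "\<lbrakk>bounded_borel f; bounded_borel g\<rbrakk> \<Longrightarrow> bounded_borel (\<lambda>x. f x - g x)"
  using bounded_borel_add[of f "\<lambda>x. - g x"] bounded_borel_uminus[of g] by simp

definition set_int :: "'a::euclidean_space set \<Rightarrow> ('a \<Rightarrow> complex) \<Rightarrow> complex" where
  "set_int A f = (LINT x|lborel. indicator A x *\<^sub>R f x)"

lemma bounded_borel_integrable:
  assumes "compact A" "bounded_borel f"
  shows "integrable lborel (\<lambda>x. indicator A x *\<^sub>R f x)"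
proof -
  obtain B where fm: "f \<in> borel_measurable borel" and B: "\<And>x. norm (f x) \<le> B"
    using assms unfolding bounded_borel_def by blast
  obtain R where R: "\<And>x. x \<in> A \<Longrightarrow> norm x \<le> R"
    using assms compact_imp_bounded bounded_iff by metis
  have "A \<in> sets borel" using assms by (simp add: compact_imp_closed)
  then have "(\<lambda>x. indicator A x *\<^sub>R f x) \<in> borel_measurable borel" using fm by measurable
  then show ?thesis
  proof (rule integrable_bounded_support[where B = B and R = R])
    show "norm (indicator A x *\<^sub>R f x) \<le> B" for x
      using B[of x] order_trans[OF norm_ge_zero B[of x]] by (auto simp: indicator_def)
  qed (use R in \<open>auto simp: indicator_def split: if_splits\<close>)
qed

lemma set_int_sum:
  assumes "compact A" "\<And>i. i \<in> I \<Longrightarrow> bounded_borel (f i)"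
  shows "set_int A (\<lambda>x. \<Sum>i\<in>I. c i * f i x) = (\<Sum>i\<in>I. c i * set_int A (f i))"
proof -
  have "set_int A (\<lambda>x. \<Sum>i\<in>I. c i * f i x) = (LINT x|lborel. (\<Sum>i\<in>I. c i * (indicator A x *\<^sub>R f i x)))"
    unfolding set_int_def by (simp add: scaleR_sum_right)
  also have "\<dots> = (\<Sum>i\<in>I. (LINT x|lborel. c i * (indicator A x *\<^sub>R f i x)))"
    by (intro Bochner_Integration.integral_sum integrable_mult_right bounded_borel_integrable assms)
  also have "\<dots> = (\<Sum>i\<in>I. c i * set_int A (f i))"
    unfolding set_int_def by (intro sum.cong refl integral_mult_right_zero)
  finally show ?thesis .
qed

lemma set_int_diff:
  assumes "compact A" "bounded_borel f" "bounded_borel g"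
  shows "set_int A (\<lambda>x. f x - g x) = set_int A f - set_int A g"
  unfolding set_int_def scaleR_diff_right
  by (rule Bochner_Integration.integral_diff) (intro bounded_borel_integrable assms)+

lemma set_int_cnj: "set_int A (\<lambda>x. cnj (f x)) = cnj (set_int A f)"
proof -
  have "set_int A (\<lambda>x. cnj (f x)) = (LINT x|lborel. cnj (indicator A x *\<^sub>R f x))"
    unfolding set_int_def by simp
  also have "\<dots> = cnj (set_int A f)" unfolding set_int_def by (rule Bochner_Integration.integral_cnj)
  finally show ?thesis .
qed

lemma set_int_norm2:
  assumes "A \<in> sets borel" "bounded_borel f"
  shows "set_int A (\<lambda>x. f x * cnj (f x)) = of_real (L2_norm A f ^ 2)"
proof -
  have fm [measurable]: "f \<in> borel_measurable borel" using assms by (simp add: bounded_borel_def)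
  have "integral\<^sup>L (lebesgue_on A) (\<lambda>x. (norm (f x))\<^sup>2) = (LINT x|lborel. indicator A x *\<^sub>R (norm (f x))\<^sup>2)"
    by (rule integral_lebesgue_on_borel[OF assms(1)]) measurable
  moreover have "0 \<le> integral\<^sup>L (lebesgue_on A) (\<lambda>x. (norm (f x))\<^sup>2)"
    by (rule Bochner_Integration.integral_nonneg) simp
  ultimately have "L2_norm A f ^ 2 = (LINT x|lborel. indicator A x *\<^sub>R (norm (f x))\<^sup>2)"
    unfolding L2_norm_def by simp
  then have "of_real (L2_norm A f ^ 2) = (LINT x|lborel. complex_of_real (indicator A x *\<^sub>R (norm (f x))\<^sup>2))"
    by (simp only: integral_complex_of_real)
  also have "\<dots> = set_int A (\<lambda>x. f x * cnj (f x))"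
    unfolding set_int_def
  proof (intro Bochner_Integration.integral_cong refl)
    fix x show "complex_of_real (indicat_real A x *\<^sub>R (norm (f x))\<^sup>2) = indicat_real A x *\<^sub>R (f x * cnj (f x))"
      using complex_norm_square[of "f x"] by (cases "x \<in> A") (simp_all del: of_real_power)
  qed
  finally show ?thesis by simp
qed

lemma L2_inner_expo:
  assumes "A \<in> sets borel"
  shows "L2_inner A (expo l) (expo m) = set_int A (expo (l - m))"
proof -
  have "L2_inner A (expo l) (expo m) = integral\<^sup>L (lebesgue_on A) (expo (l - m))"
  proof -
    have "(\<lambda>x. expo l x * cnj (expo m x)) = expo (l - m)" by (rule ext) (simp add: expo_diff_left)
    then show ?thesis unfolding L2_inner_def by simp
  qed
  then show ?thesis unfolding set_int_def by (simp add: integral_lebesgue_on_borel assms)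
qed

text \<open>
  By orthogonality the square of the distance is a sum of terms in single coefficients, and each of
  them is completed to a square.
\<close>

lemma L2_distance_expansion:
  fixes f :: "'a::euclidean_space \<Rightarrow> complex"
  assumes A: "compact A" and m: "m > 0" "set_int A (\<lambda>x. 1) = of_real m"
    and orth: "orthogonal_exponentials A \<Lambda>" and f: "bounded_borel f" and T: "finite T" "T \<subseteq> \<Lambda>"
  defines "a \<equiv> \<lambda>l. set_int A (\<lambda>x. f x * expo (- l) x)"
  shows "L2_norm A (\<lambda>x. f x - (\<Sum>l\<in>T. c l * expo l x)) ^ 2 = 
    L2_norm A f ^ 2 - (\<Sum>l\<in>T. norm (a l) ^ 2) / m + m * (\<Sum>l\<in>T. norm (c l - a l / of_real m) ^ 2)"
proof -
  have AB: "A \<in> sets borel" using A by (simp add: compact_imp_closed)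
  let ?p = "\<lambda>x. \<Sum>l\<in>T. c l * expo l x"
  have p: "bounded_borel ?p" by (intro bounded_borel_sum bounded_borel_mult) auto
  have orth': "set_int A (expo (l - k)) = (if l = k then of_real m else 0)" if "l \<in> T" "k \<in> T" for l k
  proof (cases "l = k")
    case True
    have "expo (0::'a) = (\<lambda>x. 1)" by (rule ext) simp
    then show ?thesis using True m by simp
  next
    case False
    then have "L2_inner A (expo l) (expo k) = 0"
      using orth that T(2) unfolding orthogonal_exponentials_def by blast
    then show ?thesis using False L2_inner_expo[OF AB] by simp
  qed
  have fp: "set_int A (\<lambda>x. f x * cnj (?p x)) = (\<Sum>l\<in>T. cnj (c l) * a l)"
  proof -
    have "f x * cnj (?p x) = (\<Sum>l\<in>T. cnj (c l) * (f x * expo (- l) x))" for x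
      by (simp add: sum_distrib_left expo_uminus mult_ac)
    then have "set_int A (\<lambda>x. f x * cnj (?p x)) = set_int A (\<lambda>x. \<Sum>l\<in>T. cnj (c l) * (f x * expo (- l) x))" by simp
    also have "\<dots> = (\<Sum>l\<in>T. cnj (c l) * a l)"
      unfolding a_def by (intro set_int_sum A bounded_borel_mult f bounded_borel_expo)
    finally show ?thesis .
  qed
  have pf: "set_int A (\<lambda>x. ?p x * cnj (f x)) = cnj (\<Sum>l\<in>T. cnj (c l) * a l)"
    unfolding fp[symmetric] set_int_cnj[symmetric] by (simp add: mult.commute)
  have pp: "set_int A (\<lambda>x. ?p x * cnj (?p x)) = (\<Sum>l\<in>T. of_real m * (c l * cnj (c l)))"
  proof -
    have "?p x * cnj (?p x) = (\<Sum>l\<in>T. c l * (\<Sum>k\<in>T. cnj (c k) * expo (l - k) x))" for x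
      unfolding cnj_sum sum_product by (simp add: sum_distrib_left expo_diff_left mult_ac)
    then have "set_int A (\<lambda>x. ?p x * cnj (?p x)) = set_int A (\<lambda>x. \<Sum>l\<in>T. c l * (\<Sum>k\<in>T. cnj (c k) * expo (l - k) x))"
      by simp
    also have "\<dots> = (\<Sum>l\<in>T. c l * set_int A (\<lambda>x. \<Sum>k\<in>T. cnj (c k) * expo (l - k) x))"
      by (intro set_int_sum A bounded_borel_sum bounded_borel_mult bounded_borel_expo bounded_borel_const)
    also have "\<dots> = (\<Sum>l\<in>T. c l * (\<Sum>k\<in>T. cnj (c k) * set_int A (expo (l - k))))"
      by (intro sum.cong refl arg_cong2[where f = "(*)"] set_int_sum A bounded_borel_expo)
    also have "\<dots> = (\<Sum>l\<in>T. c l * (\<Sum>k\<in>T. if l = k then cnj (c k) * of_real m else 0))"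
      using orth' by (intro sum.cong refl arg_cong2[where f = "(*)"]) auto
    also have "\<dots> = (\<Sum>l\<in>T. of_real m * (c l * cnj (c l)))"
      using T(1) by (intro sum.cong refl) (simp add: mult_ac)
    finally show ?thesis .
  qed
  have "of_real (L2_norm A (\<lambda>x. f x - ?p x) ^ 2) = set_int A (\<lambda>x. (f x - ?p x) * cnj (f x - ?p x))"
    by (rule set_int_norm2[OF AB bounded_borel_diff[OF f p], symmetric])
  also have "\<dots> = set_int A (\<lambda>x. (f x * cnj (f x) - f x * cnj (?p x)) - (?p x * cnj (f x) - ?p x * cnj (?p x)))"
    by (simp add: algebra_simps)
  also have "\<dots> = (set_int A (\<lambda>x. f x * cnj (f x)) - set_int A (\<lambda>x. f x * cnj (?p x))) - 
       (set_int A (\<lambda>x. ?p x * cnj (f x)) - set_int A (\<lambda>x. ?p x * cnj (?p x)))"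
    by (simp only: set_int_diff A f p bounded_borel_diff bounded_borel_mult bounded_borel_cnj)
  also have "\<dots> = of_real (L2_norm A f ^ 2) - (\<Sum>l\<in>T. cnj (c l) * a l) - 
       (\<Sum>l\<in>T. c l * cnj (a l)) + (\<Sum>l\<in>T. of_real m * (c l * cnj (c l)))"
    unfolding set_int_norm2[OF AB f] fp pf pp by simp
  also have "\<dots> = of_real (L2_norm A f ^ 2) - (\<Sum>l\<in>T. cnj (c l) * a l + c l * cnj (a l) - of_real m * (c l * cnj (c l)))"
    by (simp add: sum.distrib sum_subtractf)
  also have "(\<Sum>l\<in>T. cnj (c l) * a l + c l * cnj (a l) - of_real m * (c l * cnj (c l))) = 
      (\<Sum>l\<in>T. of_real (norm (a l) ^ 2 / m - m * norm (c l - a l / of_real m) ^ 2))"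
  proof (intro sum.cong refl)
    fix l
    have "of_real (norm (a l) ^ 2 / m - m * norm (c l - a l / of_real m) ^ 2) = 
       (a l * cnj (a l)) / of_real m - of_real m * ((c l - a l / of_real m) * cnj (c l - a l / of_real m))"
      unfolding of_real_diff of_real_divide of_real_mult complex_norm_square ..
    also have "\<dots> = cnj (c l) * a l + c l * cnj (a l) - of_real m * (c l * cnj (c l))"
      using m(1) by (simp add: field_simps)
    finally show "cnj (c l) * a l + c l * cnj (a l) - of_real m * (c l * cnj (c l)) = 
       of_real (norm (a l) ^ 2 / m - m * norm (c l - a l / of_real m) ^ 2)" by simp
  qed
  finally have "of_real (L2_norm A (\<lambda>x. f x - ?p x) ^ 2) = 
     complex_of_real (L2_norm A f ^ 2 - (\<Sum>l\<in>T. norm (a l) ^ 2 / m - m * norm (c l - a l / of_real m) ^ 2))"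
    by simp
  then have "L2_norm A (\<lambda>x. f x - ?p x) ^ 2 = 
     L2_norm A f ^ 2 - (\<Sum>l\<in>T. norm (a l) ^ 2 / m - m * norm (c l - a l / of_real m) ^ 2)"
    by (rule of_real_eq_iff[THEN iffD1])
  then show ?thesis by (simp add: sum_subtractf sum_divide_distrib sum_distrib_left)
qed

lemma bessel_inequality:
  fixes f :: "'a::euclidean_space \<Rightarrow> complex"
  assumes "compact A" "m > 0" "set_int A (\<lambda>x. 1) = of_real m"
    "orthogonal_exponentials A \<Lambda>" "bounded_borel f" "finite T" "T \<subseteq> \<Lambda>"
  shows "(\<Sum>l\<in>T. norm (set_int A (\<lambda>x. f x * expo (- l) x)) ^ 2) \<le> m * L2_norm A f ^ 2"
proof -
  let ?a = "\<lambda>l. set_int A (\<lambda>x. f x * expo (- l) x)"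
  have "0 \<le> L2_norm A (\<lambda>x. f x - (\<Sum>l\<in>T. ?a l / of_real m * expo l x)) ^ 2" by simp
  also have "\<dots> = L2_norm A f ^ 2 - (\<Sum>l\<in>T. norm (?a l) ^ 2) / m"
    unfolding L2_distance_expansion[OF assms] by simp
  finally show ?thesis using assms(2) by (simp add: field_simps)
qed

text \<open>
  The linear combination that completeness provides has coefficients other than the optimal ones, but
  by \<open>L2_distance_expansion\<close> replacing them by the optimal ones only decreases the distance.
\<close>

lemma parseval_approximation:
  fixes f :: "'a::euclidean_space \<Rightarrow> complex"
  assumes A: "compact A" and m: "m > 0" "set_int A (\<lambda>x. 1) = of_real m"
    and orth: "orthogonal_exponentials A \<Lambda>" and f: "bounded_borel f" and compl: "complete_exponentials A \<Lambda>" and e: "e > 0"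
  obtains T where "finite T" "T \<subseteq> \<Lambda>" 
    "m * L2_norm A f ^ 2 \<le> (\<Sum>l\<in>T. norm (set_int A (\<lambda>x. f x * expo (- l) x)) ^ 2) + e"
proof -
  have AB: "A \<in> sets borel" using A by (simp add: compact_imp_closed)
  have fm [measurable]: "f \<in> borel_measurable borel" using f by (simp add: bounded_borel_def)
  obtain B where B: "\<And>x. norm (f x) \<le> B" using f unfolding bounded_borel_def by blast
  have sq: "square_integrable_on f A"
    unfolding square_integrable_on_def
  proof
    show fA: "f \<in> borel_measurable (lebesgue_on A)"
      using fm by (intro measurable_restrict_space1) (simp add: measurable_completion)
    have "integrable lborel (\<lambda>x. indicator A x *\<^sub>R (norm (f x))\<^sup>2)"
    proof -
      have "bounded_borel (\<lambda>x. complex_of_real ((norm (f x))\<^sup>2))"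
        using bounded_borel_mult[OF f bounded_borel_cnj[OF f]]
        by (simp add: complex_norm_square del: of_real_power)
      from integrable_Re[OF bounded_borel_integrable[OF A this]] show ?thesis by simp
    qed
    then have "integrable lebesgue (\<lambda>x. indicator A x *\<^sub>R (norm (f x))\<^sup>2)"
      by (rule integrable_completion[THEN iffD2, rotated]) (use AB in measurable)
    then show "integrable (lebesgue_on A) (\<lambda>x. (norm (f x))\<^sup>2)"
      using AB by (subst integrable_restrict_space) auto
  qed
  define \<epsilon> where "\<epsilon> = sqrt (e / m)"
  have \<epsilon>: "\<epsilon> > 0" using e m by (simp add: \<epsilon>_def)
  from compl[unfolded complete_exponentials_def, rule_format, OF sq \<epsilon>]
  obtain T c where T: "finite T" "T \<subseteq> \<Lambda>" "L2_norm A (\<lambda>x. f x - (\<Sum>l\<in>T. c l * expo l x)) < \<epsilon>"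
    by (elim exE conjE)
  have "0 \<le> L2_norm A (\<lambda>x. f x - (\<Sum>l\<in>T. c l * expo l x))"
    unfolding L2_norm_def by (intro real_sqrt_ge_zero Bochner_Integration.integral_nonneg) simp
  then have "L2_norm A (\<lambda>x. f x - (\<Sum>l\<in>T. c l * expo l x)) ^ 2 \<le> \<epsilon> ^ 2"
    using T(3) by (intro power_mono) auto
  also have "\<epsilon> ^ 2 = e / m" using e m by (simp add: \<epsilon>_def)
  finally have "L2_norm A f ^ 2 - (\<Sum>l\<in>T. norm (set_int A (\<lambda>x. f x * expo (- l) x)) ^ 2) / m + 
      m * (\<Sum>l\<in>T. norm (c l - set_int A (\<lambda>x. f x * expo (- l) x) / of_real m) ^ 2) \<le> e / m"
    unfolding L2_distance_expansion[OF A m orth f T(1,2)] .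
  moreover have "0 \<le> m * (\<Sum>l\<in>T. norm (c l - set_int A (\<lambda>x. f x * expo (- l) x) / of_real m) ^ 2)"
    using m by (intro mult_nonneg_nonneg sum_nonneg) auto
  ultimately have "L2_norm A f ^ 2 \<le> (\<Sum>l\<in>T. norm (set_int A (\<lambda>x. f x * expo (- l) x)) ^ 2) / m + e / m" by linarith
  then have "m * L2_norm A f ^ 2 \<le> (\<Sum>l\<in>T. norm (set_int A (\<lambda>x. f x * expo (- l) x)) ^ 2) + e"
    using m by (simp add: field_simps)
  then show thesis using that T by blast
qed

lemma continuous_bound_cball:
  fixes f :: "'a::euclidean_space \<Rightarrow> 'b::real_normed_vector"
  assumes "continuous_on UNIV f"
  obtains C where "\<And>x. x \<in> cball a r \<Longrightarrow> norm (f x) \<le> C"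
proof -
  have "compact (f ` cball a r)"
    using assms by (intro compact_continuous_image) (auto intro: continuous_on_subset)
  then have "bounded (f ` cball a r)" by (rule compact_imp_bounded)
  then obtain C where "\<forall>y\<in>f ` cball a r. norm y \<le> C" unfolding bounded_iff by blast
  then show thesis by (intro that[of C]) blast
qed

lemma DERIV_max_sq: "((\<lambda>t::real. (max 0 t) ^ 2) has_real_derivative 2 * max 0 t) (at t)"
proof (cases t "0::real" rule: linorder_cases)
  case less
  then have "eventually (\<lambda>s. (max 0 s)\<^sup>2 = 0) (nhds t)"
    by (intro eventually_nhds_in_open[of "{..<0}", THEN eventually_mono]) auto
  moreover have "((\<lambda>s::real. 0::real) has_real_derivative 2 * max 0 t) (at t)" using less by simp
  ultimately show ?thesis by (subst DERIV_cong_ev[OF refl _ refl]) auto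
next
  case greater
  then have "eventually (\<lambda>s. (max 0 s)\<^sup>2 = s\<^sup>2) (nhds t)"
    by (intro eventually_nhds_in_open[of "{0<..}", THEN eventually_mono]) auto
  moreover have "((\<lambda>s::real. s\<^sup>2) has_real_derivative 2 * max 0 t) (at t)"
    using greater by (auto intro!: derivative_eq_intros)
  ultimately show ?thesis by (subst DERIV_cong_ev[OF refl _ refl]) auto
next
  case equal
  have "((\<lambda>h. ((max 0 (0 + h))\<^sup>2 - (max 0 0)\<^sup>2) / h) \<longlongrightarrow> 0) (at (0::real))"
  proof (rule Lim_null_comparison)
    show "\<forall>\<^sub>F h in at 0. norm (((max 0 (0 + h))\<^sup>2 - (max 0 0)\<^sup>2) / h) \<le> \<bar>h\<bar>"
      by (rule always_eventually) (auto simp: max_def power2_eq_square)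
    show "((\<lambda>h::real. \<bar>h\<bar>) \<longlongrightarrow> 0) (at 0)" by (rule tendsto_rabs_zero) simp
  qed
  then show ?thesis unfolding DERIV_def equal by simp
qed

text \<open>
  On each line in direction \<open>u\<close> the integral of the derivative vanishes by the fundamental theorem of
  calculus.
\<close>

lemma integral_directional_derivative:
  fixes g g' :: "'a::euclidean_space \<Rightarrow> complex"
  assumes u: "norm u = 1" and supp: "\<And>x. norm x > B \<Longrightarrow> g x = 0" "\<And>x. norm x > B \<Longrightarrow> g' x = 0"
    and cont: "continuous_on UNIV g'"
    and deriv: "\<And>x s. ((\<lambda>s. g (x + s *\<^sub>R u)) has_vector_derivative g' (x + s *\<^sub>R u)) (at s)"
  shows "(LINT x|lborel. g' x) = 0"
proof -
  have g'm: "g' \<in> borel_measurable borel" using cont by (rule borel_measurable_continuous_onI)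
  obtain C where "\<And>x. x \<in> cball 0 B \<Longrightarrow> norm (g' x) \<le> C" using continuous_bound_cball[OF cont] by blast
  then have C: "norm (g' x) \<le> C" if "norm x \<le> B" for x using that by simp
  have tame: "tame {} g'"
    unfolding tame_def
  proof (intro conjI g'm exI[of _ "max (max 0 C) B"] ballI)
    fix x show "norm (g' x) \<le> max (max 0 C) B"
      using C[of x] supp(2)[of x] by (cases "norm x \<le> B") auto
    show "g' x \<noteq> 0 \<longrightarrow> norm x \<le> max (max 0 C) B" using supp(2)[of x] by fastforce
  qed
  have inner: "(LINT s|lborel. g' (x + s *\<^sub>R u)) = 0" for x
  proof -
    \<comment> \<open>Beyond \<open>N\<close> the line through \<open>x\<close> has left the support.\<close>
    define N where "N = \<bar>B\<bar> + norm x + 1"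
    have big: "norm (x + s *\<^sub>R u) > B" if "\<bar>s\<bar> \<ge> N" for s
    proof -
      have "\<bar>s\<bar> = norm (s *\<^sub>R u)" using u by simp
      also have "\<dots> \<le> norm (x + s *\<^sub>R u) + norm x" by (metis add_diff_cancel_left' norm_triangle_ineq4)
      finally show ?thesis using that by (simp add: N_def)
    qed
    have "(LINT s|lborel. g' (x + s *\<^sub>R u)) = (LINT s|lborel. indicator {- N..N} s *\<^sub>R g' (x + s *\<^sub>R u))"
    proof (intro Bochner_Integration.integral_cong refl)
      fix s show "g' (x + s *\<^sub>R u) = indicator {- N..N} s *\<^sub>R g' (x + s *\<^sub>R u)"
        using supp(2)[OF big[of s]] by (cases "s \<in> {- N..N}") auto
    qed
    also have "\<dots> = g (x + N *\<^sub>R u) - g (x + (- N) *\<^sub>R u)"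
    proof (rule integral_FTC_Icc)
      show "- N \<le> N" by (simp add: N_def)
      show "((\<lambda>s. g (x + s *\<^sub>R u)) has_vector_derivative g' (x + s *\<^sub>R u)) (at s within {- N..N})" for s
        using deriv by (rule has_vector_derivative_at_within)
      show "continuous_on {- N..N} (\<lambda>s. g' (x + s *\<^sub>R u))"
        by (rule continuous_on_compose2[OF cont]) (auto intro!: continuous_intros)
    qed
    also have "\<dots> = 0" using supp(1)[OF big[of N]] supp(1)[OF big[of "- N"]] by (simp add: N_def)
    finally show ?thesis .
  qed
  show ?thesis unfolding slice_unit[OF tame u] inner by simp
qed

text \<open>
  The square of the positive part of \<open>\<rho>\<^sup>2 - norm (x - x0) ^ 2\<close> is continuously differentiable. The last
  property is integration by parts for its derivative \<open>g' b\<close> in direction \<open>b\<close>.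
\<close>

lemma bump_function:
  fixes x0 :: "'a::euclidean_space"
  assumes \<rho>: "\<rho> > 0"
  obtains g :: "'a \<Rightarrow> real" and g' :: "'a \<Rightarrow> 'a \<Rightarrow> real" where
    "continuous_on UNIV g" "\<And>b. continuous_on UNIV (g' b)" "g x0 \<noteq> 0"
    "\<And>x. x \<notin> ball x0 \<rho> \<Longrightarrow> g x = 0" "\<And>b x. x \<notin> ball x0 \<rho> \<Longrightarrow> g' b x = 0"
    "\<And>b \<eta>. norm b = 1 \<Longrightarrow> (LINT x|lborel. of_real (g' b x) * expo \<eta> x) = 
       - (2 * of_real pi * \<i> * of_real (\<eta> \<bullet> b)) * (LINT x|lborel. of_real (g x) * expo \<eta> x)"
proof -
  define w where "w x = \<rho>\<^sup>2 - (x - x0) \<bullet> (x - x0)" for x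
  define g where "g x = (max 0 (w x))\<^sup>2" for x
  define g' where "g' b x = - 4 * ((x - x0) \<bullet> b) * max 0 (w x)" for b x
  have out: "w x \<le> 0" if "x \<notin> ball x0 \<rho>" for x
  proof -
    have "\<rho> \<le> norm (x - x0)" using that by (simp add: dist_norm norm_minus_commute)
    then have "\<rho>\<^sup>2 \<le> norm (x - x0) ^ 2" using \<rho> by (intro power_mono) auto
    then show ?thesis by (simp add: w_def power2_norm_eq_inner)
  qed
  have gs: "g x = 0" "g' b x = 0" if "x \<notin> ball x0 \<rho>" for x b
    using out[OF that] by (simp_all add: g_def g'_def)
  have cw: "continuous_on UNIV w" unfolding w_def by (intro continuous_intros)
  have cg: "continuous_on UNIV g" unfolding g_def by (intro continuous_intros cw)
  have cg': "continuous_on UNIV (g' b)" for b unfolding g'_def by (intro continuous_intros cw)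
  have fin: "(LINT x|lborel. of_real (g' b x) * expo \<eta> x) = 
       - (2 * of_real pi * \<i> * of_real (\<eta> \<bullet> b)) * (LINT x|lborel. of_real (g x) * expo \<eta> x)" 
    if b: "norm b = 1" for b \<eta>
  proof -
    let ?c = "2 * of_real pi * \<i> * of_real (\<eta> \<bullet> b) :: complex"
    let ?B = "norm x0 + \<rho>"
    have far: "x \<notin> ball x0 \<rho>" if "norm x > ?B" for x
    proof
      assume "x \<in> ball x0 \<rho>"
      then have "norm (x - x0) < \<rho>" by (simp add: dist_norm norm_minus_commute)
      then show False using that norm_triangle_sub[of x x0] by linarith
    qed
    have int: "integrable lborel (\<lambda>x. of_real (h x) * expo \<eta> x :: complex)" 
      if h: "continuous_on UNIV h" "\<And>x. x \<notin> ball x0 \<rho> \<Longrightarrow> h x = 0" for h :: "'a \<Rightarrow> real"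
    proof -
      have [measurable]: "h \<in> borel_measurable borel" using h(1) by (rule borel_measurable_continuous_onI)
      obtain C where C: "\<And>x. x \<in> cball x0 \<rho> \<Longrightarrow> norm (h x) \<le> C"
        by (rule continuous_bound_cball[OF h(1)]) (rule that)
      show ?thesis
      proof (rule integrable_bounded_support[where B = "max 0 C" and R = ?B])
        show "(\<lambda>x. complex_of_real (h x) * expo \<eta> x) \<in> borel_measurable borel" by measurable
        show "norm (complex_of_real (h x) * expo \<eta> x) \<le> max 0 C" for x
          using C[of x] h(2)[of x] by (cases "x \<in> ball x0 \<rho>") (auto simp: norm_mult)
        show "norm x \<le> ?B" if "complex_of_real (h x) * expo \<eta> x \<noteq> 0" for x
          using far[of x] h(2)[of x] that by force
      qed
    qed
    have "(LINT x|lborel. of_real (g' b x) * expo \<eta> x + ?c * (of_real (g x) * expo \<eta> x)) = 0"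
    proof (rule integral_directional_derivative[OF b, where B = ?B and g = "\<lambda>x. of_real (g x) * expo \<eta> x"])
      show "of_real (g x) * expo \<eta> x = 0" "of_real (g' b x) * expo \<eta> x + ?c * (of_real (g x) * expo \<eta> x) = 0"
        if "norm x > ?B" for x using gs[OF far[OF that]] by simp_all
      show "continuous_on UNIV (\<lambda>x. of_real (g' b x) * expo \<eta> x + ?c * (of_real (g x) * expo \<eta> x))"
        by (intro continuous_intros cg cg' continuous_on_id)
      fix x s
      have bb: "b \<bullet> b = 1" using b by (simp add: norm_eq_1)
      have "((\<lambda>s. w (x + s *\<^sub>R b)) has_real_derivative - 2 * ((x + s *\<^sub>R b - x0) \<bullet> b)) (at s)"
      proof -
        have "w (x + s *\<^sub>R b) = \<rho>\<^sup>2 - ((x - x0) \<bullet> (x - x0) + 2 * s * ((x - x0) \<bullet> b) + s\<^sup>2)" for s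
          unfolding w_def by (simp add: inner_add_left inner_add_right inner_diff_left inner_diff_right bb
              inner_commute power2_eq_square algebra_simps)
        moreover have "((\<lambda>s. \<rho>\<^sup>2 - ((x - x0) \<bullet> (x - x0) + 2 * s * ((x - x0) \<bullet> b) + s\<^sup>2)) has_real_derivative
           - 2 * ((x + s *\<^sub>R b - x0) \<bullet> b)) (at s)"
          by (auto intro!: derivative_eq_intros simp: inner_add_left inner_diff_left bb algebra_simps)
        ultimately show ?thesis by simp
      qed
      from DERIV_chain2[OF DERIV_max_sq this]
      have "((\<lambda>s. g (x + s *\<^sub>R b)) has_real_derivative g' b (x + s *\<^sub>R b)) (at s)"
        unfolding g_def g'_def by (simp add: algebra_simps)
      then have d1: "((\<lambda>s. complex_of_real (g (x + s *\<^sub>R b))) has_vector_derivative complex_of_real (g' b (x + s *\<^sub>R b))) (at s)"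
        by (intro has_vector_derivative_of_real) (simp add: has_real_derivative_iff_has_vector_derivative)
      have d2: "((\<lambda>s. expo \<eta> (x + s *\<^sub>R b)) has_vector_derivative ?c * expo \<eta> (x + s *\<^sub>R b)) (at s)"
      proof -
        have "((\<lambda>z. expo \<eta> x * exp (?c * z)) has_field_derivative expo \<eta> x * (exp (?c * of_real s) * ?c)) (at (of_real s))"
          by (auto intro!: derivative_eq_intros)
        from has_vector_derivative_real_field[OF this, of UNIV]
        have D: "((\<lambda>s. expo \<eta> x * exp (?c * of_real s)) has_vector_derivative expo \<eta> x * (exp (?c * of_real s) * ?c)) (at s)" .
        have e: "expo \<eta> (x + s *\<^sub>R b) = expo \<eta> x * exp (?c * of_real s)" for s
          unfolding expo_add_right by (simp add: expo_def mult_ac)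
        show ?thesis unfolding e using D by (simp only: mult_ac)
      qed
      show "((\<lambda>s. complex_of_real (g (x + s *\<^sub>R b)) * expo \<eta> (x + s *\<^sub>R b)) has_vector_derivative
          complex_of_real (g' b (x + s *\<^sub>R b)) * expo \<eta> (x + s *\<^sub>R b) + 
          ?c * (complex_of_real (g (x + s *\<^sub>R b)) * expo \<eta> (x + s *\<^sub>R b))) (at s)"
        using has_vector_derivative_mult[OF d1 d2] by (simp add: algebra_simps)
    qed
    also have "(LINT x|lborel. of_real (g' b x) * expo \<eta> x + ?c * (of_real (g x) * expo \<eta> x)) = 
       (LINT x|lborel. of_real (g' b x) * expo \<eta> x) + (LINT x|lborel. ?c * (of_real (g x) * expo \<eta> x))"
      by (intro Bochner_Integration.integral_add integrable_mult_right int cg cg' gs)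
    also have "(LINT x|lborel. ?c * (of_real (g x) * expo \<eta> x)) = ?c * (LINT x|lborel. of_real (g x) * expo \<eta> x)"
      by (rule integral_mult_right_zero)
    finally show ?thesis by (simp add: add_eq_0_iff2)
  qed
  have "g x0 \<noteq> 0" using \<rho> by (simp add: g_def w_def)
  with cg cg' gs fin show thesis using that by blast
qed

text \<open>
  Let \<open>g\<close> be a bump function supported in \<open>A\<close>, and let \<open>c\<close> be the centre of a ball of radius \<open>R\<close> that
  contains no frequency. The coefficients of \<open>g\<close> times the exponential of \<open>c\<close> are values of the Fourier
  integral of \<open>g\<close> at points of norm greater than \<open>R\<close>. There it is at most \<open>1 / (2 * pi * R)\<close> times the
  Euclidean norm of the Fourier integrals of its partial derivatives, and Bessel's inequality bounds
  the sum of the squares of these independently of \<open>c\<close>. For large \<open>R\<close> this contradicts completeness.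
\<close>

lemma spectrum_relatively_dense:
  fixes A :: "'a::euclidean_space set"
  assumes A: "compact A" "interior A \<noteq> {}"
    and orth: "orthogonal_exponentials A \<Lambda>" and compl: "complete_exponentials A \<Lambda>"
  obtains R where "\<And>c. \<exists>l\<in>\<Lambda>. dist l c \<le> R"
proof -
  have AB: "A \<in> sets borel" using A by (simp add: compact_imp_closed)
  define m where "m = measure lborel A"
  obtain x0 \<rho> where \<rho>: "\<rho> > 0" "ball x0 \<rho> \<subseteq> A"
    using A(2) by (meson all_not_in_conv mem_interior)
  have mA: "emeasure lborel A < \<infinity>" using emeasure_bounded_finite[OF compact_imp_bounded[OF A(1)]] by simp
  have m0: "m > 0"
  proof -
    have "measure lborel (ball x0 \<rho>) \<le> m" unfolding m_def
      using \<rho> AB mA by (intro measure_mono_fmeasurable) (auto simp: fmeasurable_def)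
    then show ?thesis using content_ball_pos[OF \<rho>(1), of x0] by linarith
  qed
  have mi: "set_int A (\<lambda>x. 1) = of_real m"
  proof -
    have "set_int A (\<lambda>x. 1) = (LINT x|lborel. complex_of_real (indicator A x))"
      unfolding set_int_def by (intro Bochner_Integration.integral_cong refl) (simp add: indicator_def)
    also have "\<dots> = of_real (LINT x|lborel. indicator A x)" by (rule integral_complex_of_real)
    finally show ?thesis using AB by (simp add: m_def)
  qed
  obtain g :: "'a \<Rightarrow> real" and g' :: "'a \<Rightarrow> 'a \<Rightarrow> real" where
    g: "continuous_on UNIV g" "\<And>b. continuous_on UNIV (g' b)" "g x0 \<noteq> 0"
    "\<And>x. x \<notin> ball x0 \<rho> \<Longrightarrow> g x = 0" "\<And>b x. x \<notin> ball x0 \<rho> \<Longrightarrow> g' b x = 0"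
    "\<And>b \<eta>. norm b = 1 \<Longrightarrow> (LINT x|lborel. of_real (g' b x) * expo \<eta> x) = 
       - (2 * of_real pi * \<i> * of_real (\<eta> \<bullet> b)) * (LINT x|lborel. of_real (g x) * expo \<eta> x)"
    by (rule bump_function[OF \<rho>(1), of x0]) (rule that)
  have bb: "bounded_borel (\<lambda>x. complex_of_real (h x))" 
    if h: "continuous_on UNIV h" "\<And>x. x \<notin> ball x0 \<rho> \<Longrightarrow> h x = 0" for h :: "'a \<Rightarrow> real"
  proof -
    have [measurable]: "h \<in> borel_measurable borel" using h(1) by (rule borel_measurable_continuous_onI)
    obtain C where C: "\<And>x. x \<in> cball x0 \<rho> \<Longrightarrow> norm (h x) \<le> C"
      by (rule continuous_bound_cball[OF h(1)]) (rule that)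
    have "norm (complex_of_real (h x)) \<le> max 0 C" for x
      using C[of x] h(2)[of x] by (cases "x \<in> ball x0 \<rho>") auto
    moreover have "(\<lambda>x. complex_of_real (h x)) \<in> borel_measurable borel" by measurable
    ultimately show ?thesis unfolding bounded_borel_def by blast
  qed
  have bg: "bounded_borel (\<lambda>x. of_real (g x))" "bounded_borel (\<lambda>x. of_real (g' b x))" for b
    using bb g by blast+
  have coeff: "set_int A (\<lambda>x. (of_real (h x) * expo c x) * expo (- l) x) = (LINT x|lborel. of_real (h x) * expo (c - l) x)"
    if "\<And>x. x \<notin> ball x0 \<rho> \<Longrightarrow> h x = 0" for h :: "'a \<Rightarrow> real" and c l
    unfolding set_int_def
  proof (intro Bochner_Integration.integral_cong refl)
    fix x
    have "expo (c - l) x = expo c x * expo (- l) x" using expo_add_left[of c "- l" x] by simp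
    moreover have "h x = 0" if "x \<notin> A" using \<open>\<And>x. x \<notin> ball x0 \<rho> \<Longrightarrow> h x = 0\<close> that \<rho>(2) by blast
    ultimately show "indicator A x *\<^sub>R ((of_real (h x) * expo c x) * expo (- l) x) = of_real (h x) * expo (c - l) x"
      by (cases "x \<in> A") (simp_all add: mult_ac)
  qed
  have nrm: "L2_norm A (\<lambda>x. of_real (h x) * expo c x) = L2_norm A (\<lambda>x. of_real (h x))" for h :: "'a \<Rightarrow> real" and c
    unfolding L2_norm_def by (simp add: norm_mult)
  define N where "N = L2_norm A (\<lambda>x. of_real (g x)) ^ 2"
  \<comment> \<open>\<open>N\<close> is the squared norm of the bump function and \<open>K / R\<^sup>2\<close> will bound the coefficients beyond distance \<open>R\<close>.\<close>
  define K where "K = (\<Sum>b\<in>Basis. m * L2_norm A (\<lambda>x. of_real (g' b x)) ^ 2) / (4 * pi\<^sup>2)"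
  have N0: "N > 0"
  proof -
    have gA: "g x = 0" if "x \<notin> A" for x using g(4)[of x] that \<rho>(2) by blast
    have [measurable]: "g \<in> borel_measurable borel" using g(1) by (rule borel_measurable_continuous_onI)
    have "N = (LINT x|lborel. indicator A x *\<^sub>R (norm (complex_of_real (g x)))\<^sup>2)"
    proof -
      have "integral\<^sup>L (lebesgue_on A) (\<lambda>x. (norm (complex_of_real (g x)))\<^sup>2) = 
         (LINT x|lborel. indicator A x *\<^sub>R (norm (complex_of_real (g x)))\<^sup>2)"
        by (rule integral_lebesgue_on_borel[OF AB]) measurable
      moreover have "0 \<le> integral\<^sup>L (lebesgue_on A) (\<lambda>x. (norm (complex_of_real (g x)))\<^sup>2)"
        by (rule Bochner_Integration.integral_nonneg) simp
      ultimately show ?thesis unfolding N_def L2_norm_def by simp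
    qed
    also have "\<dots> = (LINT x|lborel. (g x)\<^sup>2)"
    proof (intro Bochner_Integration.integral_cong refl)
      fix x show "indicator A x *\<^sub>R (norm (complex_of_real (g x)))\<^sup>2 = (g x)\<^sup>2"
        using gA[of x] by (cases "x \<in> A") auto
    qed
    finally have NI: "N = (LINT x|lborel. (g x)\<^sup>2)" .
    have int: "integrable lborel (\<lambda>x. (g x)\<^sup>2)"
    proof -
      have "integrable lborel (\<lambda>x. Re (indicator A x *\<^sub>R (complex_of_real (g x) * complex_of_real (g x))))"
        by (intro integrable_Re bounded_borel_integrable A bounded_borel_mult bg)
      moreover have "Re (indicator A x *\<^sub>R (complex_of_real (g x) * complex_of_real (g x))) = (g x)\<^sup>2" for x
        using gA[of x] by (cases "x \<in> A") (auto simp: power2_eq_square)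
      ultimately show ?thesis by simp
    qed
    have "N \<noteq> 0"
    proof
      assume "N = 0"
      then have "AE x in lborel. (g x)\<^sup>2 = 0"
        unfolding NI using integral_nonneg_eq_0_iff_AE[OF int] by simp
      then have AE: "AE x in lborel. g x = 0" by eventually_elim simp
      have "open (g -` (- {0}))" using g(1) by (intro open_vimage) (auto simp: continuous_on_eq_continuous_at)
      moreover have "x0 \<in> g -` (- {0})" using g(3) by simp
      ultimately obtain e where e: "e > 0" "ball x0 e \<subseteq> g -` (- {0})" by (rule openE)
      from AE_imp_dense[OF AE e(1), of x0] show False using e(2) by blast
    qed
    moreover have "N \<ge> 0" unfolding N_def by simp
    ultimately show ?thesis by simp
  qed
  have K0: "K \<ge> 0" unfolding K_def using m0 by (intro divide_nonneg_nonneg sum_nonneg) auto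
  let ?ghat = "\<lambda>\<eta>. LINT x|lborel. complex_of_real (g x) * expo \<eta> x"
  have tail: "(\<Sum>l\<in>T. norm (?ghat (c - l)) ^ 2) * R\<^sup>2 \<le> K" 
    if T: "finite T" "T \<subseteq> \<Lambda>" and far: "\<And>l. l \<in> T \<Longrightarrow> R \<le> dist l c" and R: "R > 0" for T c R
  proof -
    have bes: "(\<Sum>l\<in>T. norm (2 * of_real pi * \<i> * of_real ((c - l) \<bullet> b) * ?ghat (c - l)) ^ 2) \<le> 
       m * L2_norm A (\<lambda>x. of_real (g' b x)) ^ 2" if b: "b \<in> Basis" for b
    proof -
      have "(\<Sum>l\<in>T. norm (set_int A (\<lambda>x. (of_real (g' b x) * expo c x) * expo (- l) x)) ^ 2) \<le> 
        m * L2_norm A (\<lambda>x. of_real (g' b x) * expo c x) ^ 2"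
        by (rule bessel_inequality[OF A(1) m0 mi orth bounded_borel_mult[OF bg(2) bounded_borel_expo] T])
      moreover have "set_int A (\<lambda>x. (of_real (g' b x) * expo c x) * expo (- l) x) = 
          - (2 * of_real pi * \<i> * of_real ((c - l) \<bullet> b) * ?ghat (c - l))" for l
        using coeff[of "g' b" c l] g(5)[of _ b] g(6)[OF norm_Basis[OF b], of "c - l"] by simp
      ultimately show ?thesis unfolding nrm by (simp only: norm_minus_cancel)
    qed
    have "4 * pi\<^sup>2 * ((\<Sum>l\<in>T. norm (?ghat (c - l)) ^ 2) * R\<^sup>2) = (\<Sum>l\<in>T. 4 * pi\<^sup>2 * norm (?ghat (c - l)) ^ 2 * R\<^sup>2)"
      by (simp add: sum_distrib_left sum_distrib_right mult_ac)
    also have "\<dots> \<le> (\<Sum>l\<in>T. 4 * pi\<^sup>2 * norm (?ghat (c - l)) ^ 2 * (\<Sum>b\<in>Basis. ((c - l) \<bullet> b)\<^sup>2))"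
    proof (intro sum_mono mult_left_mono)
      fix l assume "l \<in> T"
      then have "R\<^sup>2 \<le> dist l c ^ 2" using far R by (intro power_mono) auto
      also have "\<dots> = (\<Sum>b\<in>Basis. ((c - l) \<bullet> b)\<^sup>2)"
        unfolding dist_norm norm_minus_commute[of l c] power2_norm_eq_inner euclidean_inner[of "c - l" "c - l"]
        by (simp add: power2_eq_square)
      finally show "R\<^sup>2 \<le> (\<Sum>b\<in>Basis. ((c - l) \<bullet> b)\<^sup>2)" .
    qed simp
    also have "\<dots> = (\<Sum>l\<in>T. \<Sum>b\<in>Basis. norm (2 * of_real pi * \<i> * of_real ((c - l) \<bullet> b) * ?ghat (c - l)) ^ 2)"
      unfolding sum_distrib_left by (intro sum.cong refl) (simp add: norm_mult power_mult_distrib)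
    also have "\<dots> = (\<Sum>b\<in>Basis. \<Sum>l\<in>T. norm (2 * of_real pi * \<i> * of_real ((c - l) \<bullet> b) * ?ghat (c - l)) ^ 2)"
      by (rule sum.swap)
    also have "\<dots> \<le> (\<Sum>b\<in>Basis. m * L2_norm A (\<lambda>x. of_real (g' b x)) ^ 2)"
      by (intro sum_mono bes)
    also have "\<dots> = 4 * pi\<^sup>2 * K" unfolding K_def by simp
    finally show ?thesis by simp
  qed
  \<comment> \<open>With this \<open>R\<close> the bound \<open>K / R\<^sup>2\<close> on the far coefficients is less than half of \<open>m * N\<close>.\<close>
  define R where "R = sqrt ((2 * K + 1) / (m * N)) + 1"
  have q0: "0 \<le> sqrt ((2 * K + 1) / (m * N))" using K0 m0 N0 by simp
  have R0: "R > 0" using q0 unfolding R_def by linarith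
  have R2: "2 * K < m * N * R\<^sup>2"
  proof -
    have "(sqrt ((2 * K + 1) / (m * N)))\<^sup>2 \<le> R\<^sup>2" using q0 unfolding R_def by (intro power_mono) auto
    then have "(2 * K + 1) / (m * N) \<le> R\<^sup>2" using K0 m0 N0 by simp
    then have "2 * K + 1 \<le> m * N * R\<^sup>2" using m0 N0 by (simp add: pos_divide_le_eq mult.commute)
    then show ?thesis by simp
  qed
  have "\<exists>l\<in>\<Lambda>. dist l c \<le> R" for c
  proof (rule ccontr)
    assume none: "\<not> ?thesis"
    have half: "m * N / 2 > 0" using m0 N0 by simp
    obtain T where T: "finite T" "T \<subseteq> \<Lambda>" 
      "m * L2_norm A (\<lambda>x. of_real (g x) * expo c x) ^ 2 \<le> 
        (\<Sum>l\<in>T. norm (set_int A (\<lambda>x. (of_real (g x) * expo c x) * expo (- l) x)) ^ 2) + m * N / 2"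
      by (rule parseval_approximation[OF A(1) m0 mi orth bounded_borel_mult[OF bg(1) bounded_borel_expo] compl half]) (rule that)
    have "m * N \<le> (\<Sum>l\<in>T. norm (?ghat (c - l)) ^ 2) + m * N / 2"
    proof -
      have "set_int A (\<lambda>x. (of_real (g x) * expo c x) * expo (- l) x) = ?ghat (c - l)" for l
        using coeff[of g c l] g(4) by simp
      then show ?thesis using T(3) unfolding nrm N_def by (simp only:)
    qed
    then have "m * N \<le> 2 * (\<Sum>l\<in>T. norm (?ghat (c - l)) ^ 2)" by simp
    then have "m * N * R\<^sup>2 \<le> 2 * (\<Sum>l\<in>T. norm (?ghat (c - l)) ^ 2) * R\<^sup>2" by (rule mult_right_mono) simp
    also have "\<dots> = 2 * ((\<Sum>l\<in>T. norm (?ghat (c - l)) ^ 2) * R\<^sup>2)" by simp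
    also have "\<dots> \<le> 2 * K"
    proof -
      have "R \<le> dist l c" if "l \<in> T" for l using none T(2) that less_imp_le[OF not_le_imp_less] by blast
      from tail[OF T(1,2) this R0] show ?thesis by simp
    qed
    finally show False using R2 by simp
  qed
  then show thesis using that by blast
qed

section \<open>Vanishing of the Hadwiger functionals\<close>

lemma simultaneous_convergent_subsequence:
  fixes g :: "'p \<Rightarrow> nat \<Rightarrow> 'b::heine_borel"
  assumes "finite Q" "\<And>p. p \<in> Q \<Longrightarrow> bounded (range (g p))"
  obtains \<phi> :: "nat \<Rightarrow> nat" where "strict_mono \<phi>" "\<And>p. p \<in> Q \<Longrightarrow> convergent (g p \<circ> \<phi>)"
proof -
  have "\<exists>\<phi>::nat \<Rightarrow> nat. strict_mono \<phi> \<and> (\<forall>p\<in>Q. convergent (g p \<circ> \<phi>))"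
    using assms
  proof (induction Q)
    case empty
    show ?case by (intro exI[of _ id]) (auto simp: strict_mono_def)
  next
    case (insert p Q)
    then obtain \<phi> :: "nat \<Rightarrow> nat" where \<phi>: "strict_mono \<phi>" "\<forall>p\<in>Q. convergent (g p \<circ> \<phi>)"
      using insert.IH[OF insert.prems[OF insertI2]] by blast
    have "bounded (range (g p \<circ> \<phi>))"
      by (rule bounded_subset[of "range (g p)"]) (use insert.prems in auto)
    then obtain l \<psi> where \<psi>: "strict_mono (\<psi> :: nat \<Rightarrow> nat)" "((g p \<circ> \<phi>) \<circ> \<psi>) \<longlonglongrightarrow> l"
      using bounded_imp_convergent_subsequence by blast
    have "convergent (g p' \<circ> (\<phi> \<circ> \<psi>))" if "p' \<in> insert p Q" for p'
    proof (cases "p' = p")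
      case True
      then show ?thesis using \<psi>(2) unfolding convergent_def by (auto simp: o_assoc)
    next
      case False
      then have "convergent (g p' \<circ> \<phi>)" using \<phi>(2) that by blast
      from convergent_subseq_convergent[OF this \<psi>(1)] show ?thesis by (simp add: o_assoc)
    qed
    moreover have "strict_mono (\<phi> \<circ> \<psi>)" using \<phi>(1) \<psi>(1) by (rule strict_mono_o)
    ultimately show ?case by blast
  qed
  then show thesis using that by blast
qed

lemma power_quotient_tendsto_0:
  fixes x :: "nat \<Rightarrow> real"
  assumes x: "filterlim x at_top sequentially" and "i < k"
  shows "(\<lambda>n. x n ^ i / x n ^ k) \<longlonglongrightarrow> 0"
proof -
  have "filterlim (\<lambda>n. x n ^ (k - i)) at_top sequentially"
    using assms by (intro filterlim_pow_at_top) auto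
  then have "(\<lambda>n. inverse (x n ^ (k - i))) \<longlonglongrightarrow> 0" by (rule tendsto_inverse_0_at_top)
  moreover have "eventually (\<lambda>n. inverse (x n ^ (k - i)) = x n ^ i / x n ^ k) sequentially"
  proof -
    have "eventually (\<lambda>n. x n > 0) sequentially" using x by (simp add: filterlim_at_top_dense)
    then show ?thesis
    proof eventually_elim
      case (elim n)
      have "x n ^ k = x n ^ i * x n ^ (k - i)" using assms(2) by (simp flip: power_add)
      then show ?case using elim by (simp add: field_simps)
    qed
  qed
  ultimately show ?thesis by (rule Lim_transform_eventually)
qed

lemma bounded_over_power_tendsto_0:
  fixes x e :: "nat \<Rightarrow> real"
  assumes x: "filterlim x at_top sequentially" and e: "\<And>n. \<bar>e n\<bar> \<le> C" and k: "k > 0"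
  shows "(\<lambda>n. e n / x n ^ k) \<longlonglongrightarrow> 0"
proof (rule Lim_null_comparison)
  have "(\<lambda>n. x n ^ 0 / x n ^ k) \<longlonglongrightarrow> 0" by (rule power_quotient_tendsto_0[OF x k])
  then show "(\<lambda>n. C * \<bar>x n ^ 0 / x n ^ k\<bar>) \<longlonglongrightarrow> 0"
    by (intro tendsto_mult_right_zero tendsto_rabs_zero)
  show "\<forall>\<^sub>F n in sequentially. norm (e n / x n ^ k) \<le> C * \<bar>x n ^ 0 / x n ^ k\<bar>"
    using e by (intro always_eventually allI) (simp add: abs_divide divide_right_mono)
qed

context flag_frame
begin

lemma v_inner: "\<lbrakk>j \<in> {r..<DIM('a)}; k \<in> {r..<DIM('a)}\<rbrakk> \<Longrightarrow> v j \<bullet> v k = (if j = k then 1 else 0)"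
  using orthonormal_inner[OF orthonormal_frame_vectors, of "v j" "v k"] inj_v
  by (auto simp: inj_on_def)

text \<open>
  As \<open>2 ^ k\<close> exceeds the sum of \<open>2 ^ j\<close> over \<open>j < k\<close>, each coordinate outgrows the product of the
  preceding ones when \<open>x\<close> tends to infinity.
\<close>

definition target :: "real \<Rightarrow> 'a" where
  "target x = (\<Sum>j\<in>{r..<DIM('a)}. x ^ (2 ^ j) *\<^sub>R v j)"

lemma target_inner: "k \<in> {r..<DIM('a)} \<Longrightarrow> target x \<bullet> v k = x ^ (2 ^ k)"
proof -
  assume k: "k \<in> {r..<DIM('a)}"
  have "target x \<bullet> v k = (\<Sum>j\<in>{r..<DIM('a)}. if j = k then x ^ (2 ^ j) else 0)"
    unfolding target_def inner_sum_left by (intro sum.cong refl) (use k v_inner in auto)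
  then show ?thesis using k by simp
qed

lemma target_prj: 
  assumes k: "k \<in> {r..DIM('a)}"
  shows "prj (W k) (target x) = (\<Sum>j\<in>{r..<k}. x ^ (2 ^ j) *\<^sub>R v j)"
proof -
  have pv: "prj (W k) (v j) = (if j < k then v j else 0)" if j: "j \<in> {r..<DIM('a)}" for j
  proof (cases "j < k")
    case True
    then have "v j \<in> perp (W k)" unfolding perp_def W_def using v_inner j k by auto
    then show ?thesis using True by (simp add: prj_id)
  next
    case False
    have "(\<Sum>w\<in>W k. (w \<bullet> v j) *\<^sub>R w) = (\<Sum>i\<in>{k..<DIM('a)}. (v i \<bullet> v j) *\<^sub>R v i)"
      unfolding W_def using inj_v k by (subst sum.reindex) (auto intro: inj_on_subset)
    also have "\<dots> = (\<Sum>i\<in>{k..<DIM('a)}. if i = j then v i else 0)"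
      using v_inner j k by (intro sum.cong refl) auto
    also have "\<dots> = v j" using False j by simp
    finally show ?thesis using False by (simp add: prj_def)
  qed
  have "prj (W k) (target x) = (\<Sum>j\<in>{r..<DIM('a)}. x ^ (2 ^ j) *\<^sub>R prj (W k) (v j))"
    unfolding target_def by (simp add: linear_sum[OF linear_prj] prj_scale)
  also have "\<dots> = (\<Sum>j\<in>{r..<DIM('a)}. if j < k then x ^ (2 ^ j) *\<^sub>R v j else 0)"
    using pv by (intro sum.cong refl) auto
  also have "\<dots> = (\<Sum>j\<in>{r..<k}. x ^ (2 ^ j) *\<^sub>R v j)"
    using k by (intro sum.mono_neutral_cong_right) auto
  finally show ?thesis .
qed

text \<open>
  A bounded perturbation changes neither the growth of the coordinates nor that of the projections.
\<close>

lemma near_target_dominated: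
  assumes x: "filterlim x at_top sequentially" and near: "\<And>n. norm (\<mu> n - target (x n)) \<le> C"
    and k: "k \<in> {r..<DIM('a)}"
  shows "filterlim (\<lambda>n. \<mu> n \<bullet> v k) at_top sequentially"
    and "(\<lambda>n. norm (prj (W k) (\<mu> n)) / (\<mu> n \<bullet> v k)) \<longlonglongrightarrow> 0"
    and "(\<lambda>n. (\<Prod>j=r..<k. \<mu> n \<bullet> v j) / (\<mu> n \<bullet> v k)) \<longlonglongrightarrow> 0"
proof -
  have a: "(\<lambda>n. (\<mu> n \<bullet> v j) / x n ^ (2 ^ j)) \<longlonglongrightarrow> 1" if j: "j \<in> {r..<DIM('a)}" for j
  proof -
    have "\<bar>(\<mu> n - target (x n)) \<bullet> v j\<bar> \<le> C" for n
    proof -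
      have "norm (v j) = 1" using v_inner[OF j j] by (simp add: norm_eq_1)
      then show ?thesis using Cauchy_Schwarz_ineq2[of "\<mu> n - target (x n)" "v j"] near[of n] by simp
    qed
    then have "(\<lambda>n. ((\<mu> n - target (x n)) \<bullet> v j) / x n ^ (2 ^ j)) \<longlonglongrightarrow> 0"
      by (rule bounded_over_power_tendsto_0[OF x]) simp
    then have "(\<lambda>n. 1 + ((\<mu> n - target (x n)) \<bullet> v j) / x n ^ (2 ^ j)) \<longlonglongrightarrow> 1 + 0"
      by (intro tendsto_add tendsto_const)
    then have 1: "(\<lambda>n. 1 + ((\<mu> n - target (x n)) \<bullet> v j) / x n ^ (2 ^ j)) \<longlonglongrightarrow> 1" by simp
    have "eventually (\<lambda>n. x n > 0) sequentially" using x by (simp add: filterlim_at_top_dense)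
    then have "eventually (\<lambda>n. 1 + ((\<mu> n - target (x n)) \<bullet> v j) / x n ^ (2 ^ j) = (\<mu> n \<bullet> v j) / x n ^ (2 ^ j)) sequentially"
      by eventually_elim (simp add: inner_diff_left target_inner[OF j] field_simps)
    with 1 show ?thesis by (rule Lim_transform_eventually)
  qed
  have pos: "eventually (\<lambda>n. x n > 0) sequentially" using x by (simp add: filterlim_at_top_dense)
  have xk: "filterlim (\<lambda>n. x n ^ (2 ^ k)) at_top sequentially" using x by (intro filterlim_pow_at_top) auto
  have "filterlim (\<lambda>n. (\<mu> n \<bullet> v k) / x n ^ (2 ^ k) * x n ^ (2 ^ k)) at_top sequentially"
    by (rule filterlim_tendsto_pos_mult_at_top[OF a[OF k] _ xk]) simp
  moreover have ev: "eventually (\<lambda>n. (\<mu> n \<bullet> v k) / x n ^ (2 ^ k) * x n ^ (2 ^ k) = \<mu> n \<bullet> v k) sequentially"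
    using pos by eventually_elim simp
  ultimately show "filterlim (\<lambda>n. \<mu> n \<bullet> v k) at_top sequentially"
    by (subst (asm) filterlim_cong[OF refl refl ev])
  have quot: "(\<lambda>n. f n / (\<mu> n \<bullet> v k)) \<longlonglongrightarrow> 0" if "(\<lambda>n. f n / x n ^ (2 ^ k)) \<longlonglongrightarrow> 0" for f :: "nat \<Rightarrow> real"
  proof -
    have "(\<lambda>n. (f n / x n ^ (2 ^ k)) / ((\<mu> n \<bullet> v k) / x n ^ (2 ^ k))) \<longlonglongrightarrow> 0 / 1"
      by (intro tendsto_divide that a[OF k]) simp
    moreover have "eventually (\<lambda>n. (f n / x n ^ (2 ^ k)) / ((\<mu> n \<bullet> v k) / x n ^ (2 ^ k)) = f n / (\<mu> n \<bullet> v k)) sequentially"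
      using pos by eventually_elim simp
    ultimately show ?thesis using Lim_transform_eventually by force
  qed
  show "(\<lambda>n. norm (prj (W k) (\<mu> n)) / (\<mu> n \<bullet> v k)) \<longlonglongrightarrow> 0"
  proof (rule quot)
    have "(\<lambda>n. C / x n ^ (2 ^ k) + (\<Sum>j\<in>{r..<k}. x n ^ (2 ^ j) / x n ^ (2 ^ k))) \<longlonglongrightarrow> 0 + (\<Sum>j\<in>{r..<k}. 0)"
      by (intro tendsto_add tendsto_sum power_quotient_tendsto_0[OF x] bounded_over_power_tendsto_0[OF x order_refl]) auto
    then have lim: "(\<lambda>n. C / x n ^ (2 ^ k) + (\<Sum>j\<in>{r..<k}. x n ^ (2 ^ j) / x n ^ (2 ^ k))) \<longlonglongrightarrow> 0" by simp
    have "eventually (\<lambda>n. norm (norm (prj (W k) (\<mu> n)) / x n ^ (2 ^ k)) \<le> 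
        C / x n ^ (2 ^ k) + (\<Sum>j\<in>{r..<k}. x n ^ (2 ^ j) / x n ^ (2 ^ k))) sequentially"
      using pos
    proof eventually_elim
      case (elim n)
      have on: "orthonormal (W k)" using orthonormal_W k by simp
      have k': "k \<in> {r..DIM('a)}" using k by auto
      have "norm (prj (W k) (\<mu> n)) \<le> norm (prj (W k) (\<mu> n - target (x n))) + norm (prj (W k) (target (x n)))"
        unfolding prj_diff by (metis diff_add_cancel norm_triangle_ineq)
      also have "norm (prj (W k) (\<mu> n - target (x n))) \<le> C"
        using norm_prj_le[OF on] near order_trans by blast
      also have "norm (prj (W k) (target (x n))) \<le> (\<Sum>j\<in>{r..<k}. x n ^ (2 ^ j))"
        unfolding target_prj[OF k']
      proof (rule sum_norm_le)
        fix j assume "j \<in> {r..<k}"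
        then have "j \<in> {r..<DIM('a)}" using k by auto
        then have "norm (v j) = 1" using v_inner[of j j] by (simp add: norm_eq_1)
        then show "norm (x n ^ (2 ^ j) *\<^sub>R v j) \<le> x n ^ (2 ^ j)" using elim by simp
      qed
      finally have "norm (prj (W k) (\<mu> n)) / x n ^ (2 ^ k) \<le> (C + (\<Sum>j\<in>{r..<k}. x n ^ (2 ^ j))) / x n ^ (2 ^ k)"
        using elim by (intro divide_right_mono) auto
      then show ?case using elim by (simp add: add_divide_distrib sum_divide_distrib)
    qed
    then show "(\<lambda>n. norm (prj (W k) (\<mu> n)) / x n ^ (2 ^ k)) \<longlonglongrightarrow> 0" using lim by (rule Lim_null_comparison)
  qed
  show "(\<lambda>n. (\<Prod>j=r..<k. \<mu> n \<bullet> v j) / (\<mu> n \<bullet> v k)) \<longlonglongrightarrow> 0"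
  proof (rule quot)
    let ?s = "\<Sum>j=r..<k. (2::nat) ^ j"
    have "?s \<le> (\<Sum>j<k. 2 ^ j)" by (intro sum_mono2) auto
    also have "\<dots> < 2 ^ k" by (induction k) auto
    finally have s: "?s < 2 ^ k" .
    have "(\<lambda>n. (\<Prod>j=r..<k. (\<mu> n \<bullet> v j) / x n ^ (2 ^ j)) * (x n ^ ?s / x n ^ (2 ^ k))) \<longlonglongrightarrow> (\<Prod>j=r..<k. 1) * 0"
      using k by (intro tendsto_mult tendsto_prod a power_quotient_tendsto_0[OF x s]) auto
    then have "(\<lambda>n. (\<Prod>j=r..<k. (\<mu> n \<bullet> v j) / x n ^ (2 ^ j)) * (x n ^ ?s / x n ^ (2 ^ k))) \<longlonglongrightarrow> 0" by simp
    moreover have "eventually (\<lambda>n. (\<Prod>j=r..<k. (\<mu> n \<bullet> v j) / x n ^ (2 ^ j)) * (x n ^ ?s / x n ^ (2 ^ k)) = 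
        (\<Prod>j=r..<k. \<mu> n \<bullet> v j) / x n ^ (2 ^ k)) sequentially"
      using pos
    proof eventually_elim
      case (elim n)
      have "x n ^ ?s = (\<Prod>j=r..<k. x n ^ (2 ^ j))" by (rule power_sum)
      then show ?case using elim by (simp add: prod_dividef)
    qed
    ultimately show "(\<lambda>n. (\<Prod>j=r..<k. \<mu> n \<bullet> v j) / x n ^ (2 ^ k)) \<longlonglongrightarrow> 0" by (rule Lim_transform_eventually)
  qed
qed

text \<open>
  Take \<open>L n\<close> in \<open>\<Lambda>\<close> near the target of \<open>n\<close>. Its component in \<open>perp (W r)\<close> is bounded, and so are the phases
  at the points of \<open>Q\<close>; along a subsequence \<open>\<mu>\<close> they all converge. Subtracting \<open>\<mu> n\<close> from a member of the
  subsequence that lies far enough beyond it cancels the limits and preserves the growth.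
\<close>

lemma dominated_differences_exist:
  assumes dense: "\<And>c. \<exists>l\<in>\<Lambda>. dist l c \<le> R" and Q: "finite Q"
  obtains \<xi> where "flag_dominated r v \<xi>" "\<And>n. \<exists>l\<in>\<Lambda>. \<exists>l'\<in>\<Lambda>. \<xi> n = l - l'"
    "\<And>p. p \<in> Q \<Longrightarrow> (\<lambda>n. expo (\<xi> n) p) \<longlonglongrightarrow> 1"
proof -
  let ?d = "DIM('a)"
  have "\<forall>n. \<exists>l. l \<in> \<Lambda> \<and> dist l (target (real n)) \<le> R" using dense by blast
  from choice[OF this] obtain L where L: "\<And>n. L n \<in> \<Lambda>" "\<And>n. dist (L n) (target (real n)) \<le> R" by blast
  have onr: "orthonormal (W r)" by (rule orthonormal_W) simp
  have "prj (W r) (L n) = prj (W r) (L n - target (real n))" for n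
    unfolding prj_diff using target_prj[of r "real n"] r_le by simp
  then have "norm (prj (W r) (L n)) \<le> R" for n
    using norm_prj_le[OF onr, of "L n - target (real n)"] L(2)[of n] by (simp add: dist_norm)
  then have "bounded (range (\<lambda>n. prj (W r) (L n)))" by (auto simp: bounded_iff)
  then obtain \<phi>1 z where \<phi>1: "strict_mono (\<phi>1 :: nat \<Rightarrow> nat)" "((\<lambda>n. prj (W r) (L n)) \<circ> \<phi>1) \<longlonglongrightarrow> z"
    using bounded_imp_convergent_subsequence by blast
  have "bounded (range (\<lambda>n. expo (L (\<phi>1 n)) p))" for p by (auto simp: bounded_iff intro: exI[of _ 1])
  then obtain \<phi>2 where \<phi>2: "strict_mono (\<phi>2 :: nat \<Rightarrow> nat)" "\<And>p. p \<in> Q \<Longrightarrow> convergent ((\<lambda>n. expo (L (\<phi>1 n)) p) \<circ> \<phi>2)"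
    using simultaneous_convergent_subsequence[OF Q, of "\<lambda>p n. expo (L (\<phi>1 n)) p"] by blast
  define \<phi> where "\<phi> = \<phi>1 \<circ> \<phi>2"
  define \<mu> where "\<mu> n = L (\<phi> n)" for n
  have sm: "strict_mono \<phi>" unfolding \<phi>_def using \<phi>1(1) \<phi>2(1) by (rule strict_mono_o)
  have z: "(\<lambda>n. prj (W r) (\<mu> n)) \<longlonglongrightarrow> z"
    using LIMSEQ_subseq_LIMSEQ[OF \<phi>1(2) \<phi>2(1)] by (simp add: \<mu>_def \<phi>_def o_def)
  have ph: "convergent (\<lambda>n. expo (\<mu> n) p)" if "p \<in> Q" for p
    using \<phi>2(2)[OF that] by (simp add: \<mu>_def \<phi>_def o_def)
  have x: "filterlim (\<lambda>n. real (\<phi> n)) at_top sequentially"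
    using filterlim_compose[OF filterlim_real_sequentially filterlim_subseq[OF sm]] .
  let ?good = "\<lambda>n \<delta>. \<forall>k\<in>{r..<?d}. real n \<le> \<delta> \<bullet> v k \<and> 
      \<bar>norm (prj (W k) \<delta>) / (\<delta> \<bullet> v k)\<bar> < inverse (real (Suc n)) \<and> 
      \<bar>(\<Prod>j=r..<k. \<delta> \<bullet> v j) / (\<delta> \<bullet> v k)\<bar> < inverse (real (Suc n))"
  have "\<exists>m. n \<le> m \<and> ?good n (\<mu> m - \<mu> n)" for n
  proof -
    have near: "norm ((\<mu> m - \<mu> n) - target (real (\<phi> m))) \<le> R + norm (\<mu> n)" for m
    proof -
      have "norm ((\<mu> m - \<mu> n) - target (real (\<phi> m))) \<le> norm (\<mu> m - target (real (\<phi> m))) + norm (\<mu> n)"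
        using norm_triangle_ineq4[of "\<mu> m - target (real (\<phi> m))" "\<mu> n"] by (simp add: algebra_simps)
      then show ?thesis using L(2)[of "\<phi> m"] by (simp add: \<mu>_def dist_norm)
    qed
    have "eventually (\<lambda>m. real n \<le> (\<mu> m - \<mu> n) \<bullet> v k \<and> 
      \<bar>norm (prj (W k) (\<mu> m - \<mu> n)) / ((\<mu> m - \<mu> n) \<bullet> v k)\<bar> < inverse (real (Suc n)) \<and> 
      \<bar>(\<Prod>j=r..<k. (\<mu> m - \<mu> n) \<bullet> v j) / ((\<mu> m - \<mu> n) \<bullet> v k)\<bar> < inverse (real (Suc n))) sequentially"
      if k: "k \<in> {r..<?d}" for k
    proof (intro eventually_conj)
      note lims = near_target_dominated[OF x near k]
      show "eventually (\<lambda>m. real n \<le> (\<mu> m - \<mu> n) \<bullet> v k) sequentially"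
        using lims(1) by (simp add: filterlim_at_top)
      show "eventually (\<lambda>m. \<bar>norm (prj (W k) (\<mu> m - \<mu> n)) / ((\<mu> m - \<mu> n) \<bullet> v k)\<bar> < inverse (real (Suc n))) sequentially"
        by (rule order_tendstoD(2)[OF tendsto_rabs_zero[OF lims(2)]]) simp
      show "eventually (\<lambda>m. \<bar>(\<Prod>j=r..<k. (\<mu> m - \<mu> n) \<bullet> v j) / ((\<mu> m - \<mu> n) \<bullet> v k)\<bar> < inverse (real (Suc n))) sequentially"
        by (rule order_tendstoD(2)[OF tendsto_rabs_zero[OF lims(3)]]) simp
    qed
    then have "eventually (\<lambda>m. ?good n (\<mu> m - \<mu> n)) sequentially"
      by (intro eventually_ball_finite ballI) auto
    then have "eventually (\<lambda>m. n \<le> m \<and> ?good n (\<mu> m - \<mu> n)) sequentially"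
      using eventually_ge_at_top[of n] by eventually_elim auto
    then show ?thesis by (rule eventually_happens'[OF sequentially_bot])
  qed
  then have "\<forall>n. \<exists>m. n \<le> m \<and> ?good n (\<mu> m - \<mu> n)" by blast
  from choice[OF this] obtain M where M: "\<And>n. n \<le> M n" "\<And>n. ?good n (\<mu> (M n) - \<mu> n)" by blast
  define \<xi> where "\<xi> n = \<mu> (M n) - \<mu> n" for n
  have Mlim: "filterlim M at_top sequentially" 
    by (rule filterlim_at_top_mono[OF filterlim_ident]) (use M(1) in auto)
  have inv: "(\<lambda>n. inverse (real (Suc n))) \<longlonglongrightarrow> 0" by (rule LIMSEQ_inverse_real_of_nat)
  have dom: "flag_dominated r v \<xi>"
    unfolding flag_dominated_def W_def[symmetric]
  proof (intro conjI ballI)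
    have "(\<lambda>n. prj (W r) (\<mu> (M n)) - prj (W r) (\<mu> n)) \<longlonglongrightarrow> z - z"
      by (intro tendsto_diff z filterlim_compose[OF z Mlim])
    then show "(\<lambda>n. prj (W r) (\<xi> n)) \<longlonglongrightarrow> 0" by (simp add: \<xi>_def prj_diff)
    fix k assume k: "k \<in> {r..<?d}"
    have good: "real n \<le> \<xi> n \<bullet> v k" "\<bar>norm (prj (W k) (\<xi> n)) / (\<xi> n \<bullet> v k)\<bar> < inverse (real (Suc n))"
      "\<bar>(\<Prod>j=r..<k. \<xi> n \<bullet> v j) / (\<xi> n \<bullet> v k)\<bar> < inverse (real (Suc n))" for n
      using M(2)[of n] k unfolding \<xi>_def by blast+
    show "filterlim (\<lambda>n. \<xi> n \<bullet> v k) at_top sequentially"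
      by (rule filterlim_at_top_mono[OF filterlim_real_sequentially]) (use good(1) in auto)
    show "(\<lambda>n. norm (prj (W k) (\<xi> n)) / (\<xi> n \<bullet> v k)) \<longlonglongrightarrow> 0"
      by (rule Lim_null_comparison[OF always_eventually inv]) (use good(2) less_imp_le in \<open>simp only: real_norm_def, blast\<close>)
    show "(\<lambda>n. (\<Prod>j=r..<k. \<xi> n \<bullet> v j) / (\<xi> n \<bullet> v k)) \<longlonglongrightarrow> 0"
      by (rule Lim_null_comparison[OF always_eventually inv]) (use good(3) less_imp_le in \<open>simp only: real_norm_def, blast\<close>)
  qed
  have one: "(\<lambda>n. expo (\<xi> n) p) \<longlonglongrightarrow> 1" if p: "p \<in> Q" for p
  proof -
    obtain w where w: "(\<lambda>n. expo (\<mu> n) p) \<longlonglongrightarrow> w" using ph[OF p] unfolding convergent_def by blast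
    have "norm w = 1"
    proof -
      have "(\<lambda>n. norm (expo (\<mu> n) p)) \<longlonglongrightarrow> norm w" by (rule tendsto_norm[OF w])
      then show ?thesis by (simp add: LIMSEQ_const_iff)
    qed
    then have ww: "w * cnj w = 1" using complex_norm_square[of w] by simp
    have "(\<lambda>n. expo (\<mu> (M n)) p * cnj (expo (\<mu> n) p)) \<longlonglongrightarrow> w * cnj w"
      by (intro tendsto_mult tendsto_cnj w filterlim_compose[OF w Mlim])
    then show ?thesis unfolding ww \<xi>_def expo_diff_left .
  qed
  show thesis
  proof (rule that[OF dom _ one])
    show "\<exists>l\<in>\<Lambda>. \<exists>l'\<in>\<Lambda>. \<xi> n = l - l'" for n using L(1) by (auto simp: \<xi>_def \<mu>_def)
  qed
qed

end

theorem theorem1p2: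
  fixes A :: "(real ^ 'n) set"
    and V P :: "nat \<Rightarrow> (real ^ 'n) set"
    and r :: nat
  assumes "polytope_in UNIV A"
    and "spectral_set A"
    and "1 \<le> r" and "r \<le> CARD('n) - 1"
    and "is_flag r V P"
  shows "hadwiger r V P A = 0"
proof -
  have dim: "DIM(real ^ 'n) = CARD('n)" by simp
  have "CARD('n) > 0" by simp
  then have r: "r \<le> DIM(real ^ 'n)" "r < DIM(real ^ 'n)" using assms(3,4) by auto
  obtain v where "flag_frame r v V P" using is_flag_imp_frame[OF assms(5) r(1)] by blast
  then interpret flag_frame r v V P .
  obtain \<Lambda> where orth: "orthogonal_exponentials A \<Lambda>" and compl: "complete_exponentials A \<Lambda>"
    using assms(2) unfolding spectral_set_def by blast
  have cA: "compact A" using assms(1) by (rule polytope_in_compact)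
  then have AB: "A \<in> sets borel" by (simp add: compact_imp_closed)
  have intA: "interior A \<noteq> {}"
  proof -
    obtain T S where S: "S \<in> T" "aff_dim (UNIV :: (real ^ 'n) set) simplex S" "A = \<Union>T"
      using assms(1) unfolding polytope_in_def by blast
    have "aff_dim S = DIM(real ^ 'n)" using aff_dim_simplex[OF S(2)] by simp
    moreover have "convex S" using S(2) convex_simplex by blast
    moreover have "S \<noteq> {}" using calculation(1) by auto
    ultimately have "interior S \<noteq> {}"
      using rel_interior_eq_empty[of S] rel_interior_interior[of S] aff_dim_eq_full[of S] by simp
    moreover have "interior S \<subseteq> interior A" using S by (intro interior_mono) auto
    ultimately show ?thesis by blast
  qed
  obtain R where R: "\<And>c. \<exists>l\<in>\<Lambda>. dist l c \<le> R"
    using spectrum_relatively_dense[OF cA intA orth compl] by blast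
  have Wd: "W (DIM(real ^ 'n)) = {}" by (simp add: W_def)
  have "polytope_in ((+) 0 ` perp (W (DIM(real ^ 'n)))) A" unfolding Wd using assms(1) by simp
  from fourier_asymptotics[OF r(1) order_refl prj_zero this, unfolded Wd]
  obtain Q where Q: "finite Q" and asym: "\<And>\<xi>. flag_dominated r v \<xi> \<Longrightarrow> 
     (\<And>p. p \<in> Q \<Longrightarrow> (\<lambda>n. expo (\<xi> n) p) \<longlonglongrightarrow> 1) \<Longrightarrow>
     (\<lambda>n. (\<Prod>j=r..<DIM(real ^ 'n). - (2 * of_real pi * \<i> * of_real (\<xi> n \<bullet> v j))) * fourier_on {} A (\<xi> n)) \<longlonglongrightarrow> 
        of_real (partial_hadwiger r V P (DIM(real ^ 'n)) A)"
    by blast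
  obtain \<xi> where \<xi>: "flag_dominated r v \<xi>" "\<And>n. \<exists>l\<in>\<Lambda>. \<exists>l'\<in>\<Lambda>. \<xi> n = l - l'"
    "\<And>p. p \<in> Q \<Longrightarrow> (\<lambda>n. expo (\<xi> n) p) \<longlonglongrightarrow> 1"
    using dominated_differences_exist[OF R Q] by blast
  have four: "fourier_on {} A \<eta> = set_int A (expo \<eta>)" for \<eta>
    using fourier_on_eq[of A 0 "{}" \<eta>] by (simp add: flat_int_def set_int_def)
  have "filterlim (\<lambda>n. \<xi> n \<bullet> v r) at_top sequentially"
    using \<xi>(1) r unfolding flag_dominated_def by auto
  then have "eventually (\<lambda>n. \<xi> n \<bullet> v r > 0) sequentially" by (simp add: filterlim_at_top_dense)
  then have "eventually (\<lambda>n. (\<Prod>j=r..<DIM(real ^ 'n). - (2 * of_real pi * \<i> * of_real (\<xi> n \<bullet> v j))) * 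
      fourier_on {} A (\<xi> n) = 0) sequentially"
  proof eventually_elim
    case (elim n)
    obtain l l' where l: "l \<in> \<Lambda>" "l' \<in> \<Lambda>" "\<xi> n = l - l'" using \<xi>(2) by blast
    then have "l \<noteq> l'" using elim by auto
    then have "L2_inner A (expo l) (expo l') = 0" using orth l unfolding orthogonal_exponentials_def by blast
    then show ?case unfolding four l(3) L2_inner_expo[OF AB] by simp
  qed
  then have "(\<lambda>n. (\<Prod>j=r..<DIM(real ^ 'n). - (2 * of_real pi * \<i> * of_real (\<xi> n \<bullet> v j))) * 
      fourier_on {} A (\<xi> n)) \<longlonglongrightarrow> 0" by (rule tendsto_eventually)
  from LIMSEQ_unique[OF this asym[OF \<xi>(1,3)]] show ?thesis
    unfolding hadwiger_eq_partial by simp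
qed

end
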